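(* Let $K$ be a wall in $\{0\le x_1\le M\}$ that is directionally convex in the direction $x_1$. If propagation occurs for $K$, then $\bar v(x)=1$ for all $x\in\Omega$.
   Context: Standing setting: $N\ge2$, $x=(x_1,y)$, $y\in\mathbb R^{N-1}$. $f\in C^1(\mathbb R)$ is bistable: for some $\alpha\in(0,1)$, $f(0)=f(\alpha)=f(1)=0$, $f'(0)<0$, $f'(\alpha)>0$, $f'(1)<0$, $f<0$ on $(0,\alpha)$, $f>0$ on $(\alpha,1)$, $\int_0^1f>0$. Let $c>0$, $\phi$ be the unique traveling wave: $\phi''+c\phi'+f(\phi)=0$, $0<\phi<1$, $\phi(-\infty)=1$, $\phi(+\infty)=0$, $\phi(0)=\alpha$. A wall is a closed set $K\subset\{0\le x_1\le M\}$ (some $M>0$) with uniformly smooth boundary such that $\Omega:=\mathbb R^N\setminus K$ is connected. $\bar u$ is the unique entire solution of $u_t=\Delta u+f(u)$ in $\Omega$, $\partial_\nu u=0$ on $\partial\Omega$, with $0<\bar u<1$ and $\sup_{x\in\Omega}|\bar u(t,x)-\phi(x_1-ct)|\to0$ as $t\to-\infty$; the limit profile is $\bar v:=\lim_{t\to+\infty}\bar u(t,\cdot)$; propagation means $\bar v(x_1,y)\to1$ as $x_1\to+\infty$. $K$ is directionally convex in the direction $x_1$ if for some $a\in\mathbb R$: (i) for every line $\Lambda$ parallel to the $x_1$-axis, $K\cap\Lambda$ is either empty or a single line segment; (ii) $K\cap\{x_1=a\}=\pi(K)$, where $\pi(K)$ is the orthogonal projection of $K$ onto the hyperplane $\{x_1=a\}$.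 *)

theory Defs
  imports "HOL-Analysis.Analysis"
begin

text \<open>Points of R^N are pairs (x1, y) with y in R^(N-1) = real^'m; since every type is
nonempty, N - 1 >= 1, i.e. N >= 2.\<close>

definition bistable :: "(real \<Rightarrow> real) \<Rightarrow> real \<Rightarrow> bool" where
  "bistable f \<alpha> \<longleftrightarrow>
     0 < \<alpha> \<and> \<alpha> < 1 \<and>
     (\<exists>f'. (\<forall>s. (f has_real_derivative f' s) (at s)) \<and> continuous_on UNIV f' \<and>
           f' 0 < 0 \<and> f' \<alpha> > 0 \<and> f' 1 < 0) \<and>
     f 0 = 0 \<and> f \<alpha> = 0 \<and> f 1 = 0 \<and>
     (\<forall>s. 0 < s \<and> s < \<alpha> \<longrightarrow> f s < 0) \<and>
     (\<forall>s. \<alpha> < s \<and> s < 1 \<longrightarrow> f s > 0) \<and>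
     integral {0..1} f > 0"

definition traveling_wave :: "(real \<Rightarrow> real) \<Rightarrow> real \<Rightarrow> real \<Rightarrow> (real \<Rightarrow> real) \<Rightarrow> bool" where
  "traveling_wave f \<alpha> c \<phi> \<longleftrightarrow>
     (\<exists>\<phi>1 \<phi>2. \<forall>s. (\<phi> has_real_derivative \<phi>1 s) (at s) \<and>
                   (\<phi>1 has_real_derivative \<phi>2 s) (at s) \<and>
                   \<phi>2 s + c * \<phi>1 s + f (\<phi> s) = 0) \<and>
     (\<forall>s. 0 < \<phi> s \<and> \<phi> s < 1) \<and>
     (\<phi> \<longlongrightarrow> 1) at_bot \<and> (\<phi> \<longlongrightarrow> 0) at_top \<and> \<phi> 0 = \<alpha>"

text \<open>A wall in the slab {0 <= x1 <= M} with uniformly smooth (uniformly C^2) boundary, given by a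
  defining function rho: K = {rho <= 0}, rho is C^2 with gradient g, g bounded, its derivative H
  bounded and uniformly continuous, and |grad rho| bounded below on the boundary {rho = 0}.
  Moreover Omega = complement of K is connected.\<close>
definition wall :: "real \<Rightarrow> (real \<times> (real^'m)) set \<Rightarrow> (real \<times> (real^'m) \<Rightarrow> real)
                    \<Rightarrow> (real \<times> (real^'m) \<Rightarrow> real \<times> (real^'m)) \<Rightarrow> bool" where
  "wall M K \<rho> g \<longleftrightarrow>
     M > 0 \<and> closed K \<and> K \<subseteq> {x. 0 \<le> fst x \<and> fst x \<le> M} \<and>
     K = {x. \<rho> x \<le> 0} \<and>
     (\<forall>x. (\<rho> has_derivative (\<lambda>h. g x \<bullet> h)) (at x)) \<and>
     bounded (range g) \<and>
     (\<exists>H. (\<forall>x. (g has_derivative H x) (at x)) \<and>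
          (\<exists>B. \<forall>x. onorm (H x) \<le> B) \<and>
          (\<forall>\<epsilon>>0. \<exists>\<delta>>0. \<forall>x z. dist x z < \<delta> \<longrightarrow> onorm (\<lambda>h. H x h - H z h) < \<epsilon>)) \<and>
     (\<exists>\<delta>>0. \<forall>x. \<rho> x = 0 \<longrightarrow> norm (g x) \<ge> \<delta>) \<and>
     connected (- K)"

definition dir_convex :: "(real \<times> (real^'m)) set \<Rightarrow> bool" where
  "dir_convex K \<longleftrightarrow>
     (\<exists>a. (\<forall>y. {s. (s, y) \<in> K} = {} \<or> (\<exists>p q. p \<le> q \<and> {s. (s, y) \<in> K} = {p..q})) \<and>
          K \<inter> {x. fst x = a} = (\<lambda>x. (a, snd x)) ` K)"

definition lap :: "('a::euclidean_space \<Rightarrow> real) \<Rightarrow> 'a \<Rightarrow> real" where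
  "lap v x = (\<Sum>b\<in>Basis. frechet_derivative (\<lambda>z. frechet_derivative v (at z) b) (at x) b)"

text \<open>Classical entire solution of u_t = Delta u + f(u) in Omega = -K, with d_nu u = 0 on the
  boundary frontier K = {rho = 0} (normal direction g x = grad rho(x)).\<close>
definition entire_solution :: "(real \<Rightarrow> real) \<Rightarrow> (real \<times> (real^'m)) set
      \<Rightarrow> (real \<times> (real^'m) \<Rightarrow> real \<times> (real^'m)) \<Rightarrow> (real \<Rightarrow> real \<times> (real^'m) \<Rightarrow> real) \<Rightarrow> bool" where
  "entire_solution f K g u \<longleftrightarrow>
     continuous_on (UNIV \<times> closure (- K)) (\<lambda>(t, x). u t x) \<and>
     (\<forall>t. \<forall>x\<in>- K.
        (\<lambda>s. u s x) differentiable (at t) \<and>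
        u t differentiable (at x) \<and>
        (\<forall>b\<in>Basis. (\<lambda>z. frechet_derivative (u t) (at z) b) differentiable (at x)) \<and>
        deriv (\<lambda>s. u s x) t = lap (u t) x + f (u t x)) \<and>
     (\<forall>t. \<forall>x\<in>frontier K.
        ((\<lambda>z. frechet_derivative (u t) (at z) (g x)) \<longlongrightarrow> 0) (at x within - K))"

end

theory Submission
  imports Defs
begin

text \<open>
  Only the parabolic comparison principle is used. Let \<open>\<zeta> = R - |x\<^sub>1 - a| - s t + \<kappa> \<eta>(x)\<close>, where \<open>\<eta>\<close> is
  comparable to \<open>|x|\<close>, has bounded gradient and Laplacian, and decreases strictly along the normal pointing
  into \<open>\<Omega>\<close>. For small \<open>q\<close> and much smaller \<open>\<kappa>\<close>, the function \<open>\<phi>(\<zeta>) - q\<close> is a subsolution where it is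
  positive: its kink on \<open>x\<^sub>1 = a\<close> is convex, and directional convexity gives \<open>\<zeta>\<close> the right normal
  derivative on the wall. It describes two fronts that move from both sides towards the hyperplane
  \<open>x\<^sub>1 = a\<close>, and it tends to at least \<open>1 - 2q\<close>. On the left the initial ordering holds because
  \<open>u\<close> stays close to 1 near \<open>x\<^sub>1 = -\<infinity>\<close>. On the right the function is cut off at a plane \<open>x\<^sub>1 = X\<^sub>1\<close>, where it
  is positive only on a bounded set; there \<open>u \<ge> 1 - q\<close> for large times. To see this, an interior
  gradient bound turns the pointwise limits into \<open>u \<ge> 1 - q\<close> on one large ball, and a ball-shaped
  subsolution carries this bound along the plane by sliding slowly.
\<close>

section \<open>Gradients, Laplacians and extrema\<close>

text \<open>The hypotheses give \<open>v\<close> only as a pointwise limit, and its convergence to 1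
  at x1 = +infinity separately for each y, so nothing is uniform along a hyperplane on the right. To
  get by without compactness of families of solutions, the argument treats one target point at a
  time. Because \<open>u t x\<close> is assumed to converge as t grows, it suffices to find
  arbitrarily late times with \<open>u t x \<ge> 1 - 2 * q\<close>, and each such bound may use a
  subsolution built for that point and that starting time.

  The delicate point is the order of the choices. Control on the cut-off plane is needed on a
  bounded set and holds only after a time depending on that set; the starting time determines how
  far left \<open>u\<close> is close to 1, and this determines \<open>R\<close>, which seems to
  enter the bounded set again. The circle is broken because the distance that the fronts still have
  to travel grows exactly as \<open>R\<close>, so that \<open>R\<close> cancels.

  The profile decreases, so adding \<kappa> \<eta> to its argument lowers the subsolution: this
  confines its positivity in the unbounded directions y. Moving the fronts at speed c/8 instead of c
  leaves a surplus of speed that absorbs the errors from \<eta>.\<close>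

definition has_jet :: "('a::euclidean_space \<Rightarrow> real) \<Rightarrow> ('a \<Rightarrow> 'a) \<Rightarrow> ('a \<Rightarrow> 'a) \<Rightarrow> 'a \<Rightarrow> bool" where
  "has_jet h G H x \<longleftrightarrow>
     (\<forall>\<^sub>F z in nhds x. (h has_derivative (\<lambda>k. G z \<bullet> k)) (at z)) \<and> (G has_derivative H) (at x)"

text \<open>Applied to the derivative of a gradient field, this trace is the Laplacian.\<close>

definition tr :: "('a::euclidean_space \<Rightarrow> 'a) \<Rightarrow> real" where
  "tr H = (\<Sum>b\<in>Basis. H b \<bullet> b)"

lemma has_jet_gradient: "has_jet h G H x \<Longrightarrow> (h has_derivative (\<lambda>k. G x \<bullet> k)) (at x)"
  unfolding has_jet_def using eventually_nhds_x_imp_x by blast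

lemma tr_add: "tr (\<lambda>k. A k + B k) = tr A + tr B"
  by (simp add: tr_def inner_add_left sum.distrib)

lemma tr_scale: "tr (\<lambda>k. r *\<^sub>R A k) = r * tr A"
  by (simp add: tr_def sum_distrib_left)

lemma tr_zero: "tr (\<lambda>k. 0) = 0"
  by (simp add: tr_def)

lemma tr_rank_one: "tr (\<lambda>k. (p \<bullet> k) *\<^sub>R q) = p \<bullet> q"
  by (simp add: tr_def euclidean_inner[of p q])

lemma tr_id: "tr (\<lambda>k::'a::euclidean_space. k) = DIM('a)"
  by (simp add: tr_def)

lemma has_jet_add:
  assumes "has_jet h G H x" "has_jet h' G' H' x"
  shows "has_jet (\<lambda>z. h z + h' z) (\<lambda>z. G z + G' z) (\<lambda>k. H k + H' k) x"
proof -
  have "\<forall>\<^sub>F z in nhds x. (h has_derivative (\<lambda>k. G z \<bullet> k)) (at z) \<and> (h' has_derivative (\<lambda>k. G' z \<bullet> k)) (at z)"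
    using assms by (simp add: has_jet_def eventually_conj_iff)
  then have "\<forall>\<^sub>F z in nhds x. ((\<lambda>z. h z + h' z) has_derivative (\<lambda>k. (G z + G' z) \<bullet> k)) (at z)"
    by eventually_elim (auto simp: inner_add_left intro!: has_derivative_add)
  then show ?thesis using assms unfolding has_jet_def by (auto intro!: has_derivative_add)
qed

lemma has_jet_scale:
  assumes "has_jet h G H x"
  shows "has_jet (\<lambda>z. r * h z) (\<lambda>z. r *\<^sub>R G z) (\<lambda>k. r *\<^sub>R H k) x"
proof -
  have "\<forall>\<^sub>F z in nhds x. (h has_derivative (\<lambda>k. G z \<bullet> k)) (at z)"
    using assms by (simp add: has_jet_def)
  then have "\<forall>\<^sub>F z in nhds x. ((\<lambda>z. r * h z) has_derivative (\<lambda>k. (r *\<^sub>R G z) \<bullet> k)) (at z)"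
    by eventually_elim (auto intro!: has_derivative_mult_right)
  moreover have "((\<lambda>z. r *\<^sub>R G z) has_derivative (\<lambda>k. r *\<^sub>R H k)) (at x)"
    using assms unfolding has_jet_def by (blast intro: has_derivative_scaleR_right)
  ultimately show ?thesis unfolding has_jet_def by (rule conjI)
qed

lemma has_jet_affine: "has_jet (\<lambda>z. p \<bullet> z + r) (\<lambda>z. p) (\<lambda>k. 0) x"
  unfolding has_jet_def by (auto intro!: always_eventually derivative_eq_intros)

lemma has_jet_compose:
  assumes "has_jet h G H x"
    and "\<forall>\<^sub>F s in nhds (h x). (F has_real_derivative F1 s) (at s)"
    and "(F1 has_real_derivative F2) (at (h x))"
  shows "has_jet (\<lambda>z. F (h z)) (\<lambda>z. F1 (h z) *\<^sub>R G z)
     (\<lambda>k. F1 (h x) *\<^sub>R H k + (F2 * (G x \<bullet> k)) *\<^sub>R G x) x"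
proof -
  have dx: "(h has_derivative (\<lambda>k. G x \<bullet> k)) (at x)" by (rule has_jet_gradient[OF assms(1)])
  have "isCont h x" using dx by (rule has_derivative_continuous)
  then have "filterlim h (nhds (h x)) (nhds x)" by (simp add: continuous_at tendsto_at_iff_tendsto_nhds)
  then have "\<forall>\<^sub>F z in nhds x. (F has_real_derivative F1 (h z)) (at (h z))"
    using assms(2) eventually_compose_filterlim by blast
  moreover have "\<forall>\<^sub>F z in nhds x. (h has_derivative (\<lambda>k. G z \<bullet> k)) (at z)"
    using assms(1) by (simp add: has_jet_def)
  ultimately have "\<forall>\<^sub>F z in nhds x. ((\<lambda>z. F (h z)) has_derivative (\<lambda>k. (F1 (h z) *\<^sub>R G z) \<bullet> k)) (at z)"
  proof eventually_elim
    case (elim z)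
    have "(F has_derivative (*) (F1 (h z))) (at (h z))" using elim(1) by (simp add: has_field_derivative_def)
    from has_derivative_compose[OF elim(2) this] show ?case by simp
  qed
  moreover have "(F1 has_derivative (*) F2) (at (h x))" using assms(3) by (simp add: has_field_derivative_def)
  from has_derivative_compose[OF dx this]
  have "((\<lambda>z. F1 (h z)) has_derivative (\<lambda>k. F2 * (G x \<bullet> k))) (at x)" .
  from has_derivative_scaleR[OF this]
  have "(G has_derivative H) (at x) \<Longrightarrow> ((\<lambda>z. F1 (h z) *\<^sub>R G z) has_derivative
      (\<lambda>k. F1 (h x) *\<^sub>R H k + (F2 * (G x \<bullet> k)) *\<^sub>R G x)) (at x)" .
  moreover have "(G has_derivative H) (at x)" using assms(1) by (simp add: has_jet_def)
  ultimately show ?thesis unfolding has_jet_def by blast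
qed

text \<open>This is the chain rule Delta F(h) = F' Delta h + F'' |grad h|^2, with \<open>r\<close>
  and \<open>s\<close> in the roles of F' and F'' at h(x).\<close>

lemma tr_compose: "tr (\<lambda>k. r *\<^sub>R H k + (s * (p \<bullet> k)) *\<^sub>R p) = r * tr H + s * (norm p)\<^sup>2"
proof -
  have "(\<lambda>k. r *\<^sub>R H k + (s * (p \<bullet> k)) *\<^sub>R p) = (\<lambda>k. r *\<^sub>R H k + s *\<^sub>R ((p \<bullet> k) *\<^sub>R p))" by simp
  then show ?thesis by (simp only: tr_add tr_scale tr_rank_one dot_square_norm)
qed

lemma jet_of_composition:
  assumes "has_jet h G H x"
    and "\<forall>\<^sub>F s in nhds (h x). (F has_real_derivative F1 s) (at s)"
    and "(F1 has_real_derivative F2) (at (h x))"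
  obtains H' where "has_jet (\<lambda>z. F (h z)) (\<lambda>z. F1 (h z) *\<^sub>R G z) H' x"
    "tr H' = F1 (h x) * tr H + F2 * (norm (G x))\<^sup>2"
  using has_jet_compose[OF assms] tr_compose by blast

lemma has_jet_translate:
  assumes "has_jet h G H (x - a)"
  shows "has_jet (\<lambda>z. h (z - a)) (\<lambda>z. G (z - a)) H x"
proof -
  have "filterlim (\<lambda>z. z - a) (nhds (x - a)) (nhds x)"
    by (intro tendsto_intros) (simp add: filterlim_ident)
  then have "\<forall>\<^sub>F z in nhds x. (h has_derivative (\<lambda>k. G (z - a) \<bullet> k)) (at (z - a))"
    using assms by (auto simp: has_jet_def filterlim_iff)
  then have "\<forall>\<^sub>F z in nhds x. ((\<lambda>z. h (z - a)) has_derivative (\<lambda>k. G (z - a) \<bullet> k)) (at z)"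
  proof eventually_elim
    case (elim z)
    have "((\<lambda>z. z - a) has_derivative (\<lambda>k. k)) (at z)" by (auto intro!: derivative_eq_intros)
    from has_derivative_compose[OF this elim] show ?case .
  qed
  moreover have "((\<lambda>z. z - a) has_derivative (\<lambda>k. k)) (at x)" by (auto intro!: derivative_eq_intros)
  moreover have "(G has_derivative H) (at (x - a))" using assms by (simp add: has_jet_def)
  ultimately show ?thesis unfolding has_jet_def using has_derivative_compose by blast
qed

lemma has_jet_line:
  assumes "has_jet h G H x"
  shows "\<forall>\<^sub>F s in nhds 0. ((\<lambda>s. h (x + s *\<^sub>R b)) has_real_derivative G (x + s *\<^sub>R b) \<bullet> b) (at s)"
    and "((\<lambda>s. G (x + s *\<^sub>R b) \<bullet> b) has_real_derivative H b \<bullet> b) (at 0)"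
proof -
  have *: "((\<lambda>s. x + s *\<^sub>R b) has_derivative (\<lambda>s. s *\<^sub>R b)) (at s)" for s :: real
    by (auto intro!: derivative_eq_intros)
  have "filterlim (\<lambda>s. x + s *\<^sub>R b) (nhds (x + 0 *\<^sub>R b)) (nhds 0)"
    by (intro tendsto_intros) (simp add: filterlim_ident)
  then have "\<forall>\<^sub>F s in nhds 0. (h has_derivative (\<lambda>k. G (x + s *\<^sub>R b) \<bullet> k)) (at (x + s *\<^sub>R b))"
    using assms by (auto simp: has_jet_def filterlim_iff)
  then show "\<forall>\<^sub>F s in nhds 0. ((\<lambda>s. h (x + s *\<^sub>R b)) has_real_derivative G (x + s *\<^sub>R b) \<bullet> b) (at s)"
  proof eventually_elim
    case (elim s)
    from has_derivative_compose[OF * elim] show ?case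
      by (simp add: has_field_derivative_def mult.commute[of _ "G (x + s *\<^sub>R b) \<bullet> b"])
  qed
  have GH: "(G has_derivative H) (at (x + 0 *\<^sub>R b))" using assms by (simp add: has_jet_def)
  then have "linear H" by (meson has_derivative_bounded_linear bounded_linear.linear)
  have "((\<lambda>s. G (x + s *\<^sub>R b)) has_derivative (\<lambda>s. H (s *\<^sub>R b))) (at 0)"
    using has_derivative_compose[OF * GH] .
  from has_derivative_inner_left[OF this, of b]
  have "((\<lambda>s. G (x + s *\<^sub>R b) \<bullet> b) has_derivative (\<lambda>s. H (s *\<^sub>R b) \<bullet> b)) (at 0)" .
  moreover have "(\<lambda>s. H (s *\<^sub>R b) \<bullet> b) = (*) (H b \<bullet> b)"
    using \<open>linear H\<close> by (simp add: linear_scale fun_eq_iff)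
  ultimately show "((\<lambda>s. G (x + s *\<^sub>R b) \<bullet> b) has_real_derivative H b \<bullet> b) (at 0)"
    by (simp add: has_field_derivative_def)
qed

text \<open>\<open>h'\<close> is differentiable only at 0, so no Taylor formula with a second
  derivative nearby is at hand. Instead, D < 0 would make \<open>h'\<close> negative just to the
  right of its zero, and the mean value theorem would push \<open>h\<close> below its
  minimum.\<close>

lemma second_derivative_at_min:
  fixes h h' :: "real \<Rightarrow> real"
  assumes d: "\<forall>\<^sub>F s in nhds 0. (h has_real_derivative h' s) (at s)"
    and d2: "(h' has_real_derivative D) (at 0)"
    and mn: "\<forall>\<^sub>F s in nhds 0. h 0 \<le> h s"
  shows "h' 0 = 0" and "D \<ge> 0"
proof -
  obtain e where e: "e > 0" "\<And>s. \<bar>s\<bar> < e \<Longrightarrow> (h has_real_derivative h' s) (at s) \<and> h 0 \<le> h s"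
    using eventually_conj[OF d mn] by (auto simp: eventually_nhds_metric dist_real_def)
  show z: "h' 0 = 0"
    by (rule DERIV_local_min[of h "h' 0" 0 e]) (use e in auto)
  show "D \<ge> 0"
  proof (rule ccontr)
    assume "\<not> D \<ge> 0"
    then obtain k where k: "k > 0" "\<And>s. 0 < s \<Longrightarrow> s < k \<Longrightarrow> h' s < h' 0"
      using DERIV_neg_dec_right[OF d2] by force
    define s where "s = min e k / 2"
    have s: "0 < s" "s < e" "s < k" using e k by (auto simp: s_def)
    have "\<exists>y>0. y < s \<and> h s - h 0 = (s - 0) * h' y"
      by (rule MVT2) (use s e in auto)
    then obtain y where y: "y > 0" "y < s" "h s - h 0 = s * h' y" by auto
    have "h' y < 0" using k(2)[of y] y s z by simp
    then have "s * h' y < 0" using s by (simp add: mult_pos_neg)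
    then show False using y(3) e(2)[of s] s by simp
  qed
qed

lemma has_jet_min:
  assumes j: "has_jet h G H x" and mn: "\<forall>\<^sub>F z in nhds x. h x \<le> h z"
  shows "tr H \<ge> 0"
proof -
  have "H b \<bullet> b \<ge> 0" for b
  proof -
    have "filterlim (\<lambda>s. x + s *\<^sub>R b) (nhds (x + 0 *\<^sub>R b)) (nhds 0)"
      by (intro tendsto_intros) (simp add: filterlim_ident)
    then have "\<forall>\<^sub>F s in nhds 0. h (x + 0 *\<^sub>R b) \<le> h (x + s *\<^sub>R b)"
      using mn by (auto simp: filterlim_iff)
    from second_derivative_at_min(2)[OF has_jet_line[OF j] this] show ?thesis .
  qed
  then show ?thesis unfolding tr_def by (rule sum_nonneg)
qed

text \<open>At a first contact only earlier times can be compared, so only one sign of the time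
  derivative is available; it is the one needed.\<close>

lemma derivative_nonpos_at_left_min:
  fixes h :: "real \<Rightarrow> real"
  assumes d: "(h has_real_derivative D) (at t)" and T: "T < t"
    and le: "\<And>s. T < s \<Longrightarrow> s < t \<Longrightarrow> h t \<le> h s"
  shows "D \<le> 0"
proof (rule ccontr)
  assume "\<not> D \<le> 0"
  then obtain e where e: "e > 0" "\<And>k. 0 < k \<Longrightarrow> k < e \<Longrightarrow> h (t - k) < h t"
    using DERIV_pos_inc_left[OF d] by force
  define k where "k = min e (t - T) / 2"
  have "0 < k" "k < e" "k < t - T" using e T by (auto simp: k_def)
  then show False using e(2)[of k] le[of "t - k"] by auto
qed

section \<open>A smooth substitute for the norm\<close>

definition bump :: "'a::euclidean_space \<Rightarrow> real" where
  "bump x = sqrt (1 + x \<bullet> x)"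

lemma bump_ge: "bump x \<ge> 1" "bump x \<ge> norm x" "bump x > 0"
proof -
  show 1: "bump x \<ge> 1" by (simp add: bump_def)
  then show "bump x > 0" by simp
  show "bump x \<ge> norm x" by (simp add: bump_def norm_eq_sqrt_inner)
qed

lemma bump_sq: "(bump x)\<^sup>2 = 1 + (norm x)\<^sup>2"
  by (simp add: bump_def dot_square_norm add_nonneg_nonneg)

lemma bump_jet:
  fixes x :: "'a::euclidean_space"
  obtains H where "has_jet bump (\<lambda>z. z /\<^sub>R bump z) H x"
    "tr H = DIM('a) / bump x - (norm x)\<^sup>2 / (bump x)^3"
proof -
  let ?F = "\<lambda>s. sqrt (1 + s)" and ?F1 = "\<lambda>s. inverse (sqrt (1 + s)) / 2"
  have j: "has_jet (\<lambda>z::'a. z \<bullet> z) (\<lambda>z. 2 *\<^sub>R z) (\<lambda>k. 2 *\<^sub>R k) x"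
    unfolding has_jet_def
    by (auto intro!: always_eventually derivative_eq_intros simp: inner_commute)
  have "open {-1::real<..}" "x \<bullet> x \<in> {-1<..}" by (auto intro: less_le_trans[of _ 0])
  then have "\<forall>\<^sub>F s in nhds (x \<bullet> x). s \<in> {-1<..}" by (rule eventually_nhds_in_open)
  then have F: "\<forall>\<^sub>F s in nhds (x \<bullet> x). (?F has_real_derivative ?F1 s) (at s)"
    by eventually_elim (auto intro!: derivative_eq_intros)
  have pos: "1 + x \<bullet> x > 0" by (simp add: add_pos_nonneg)
  have F1: "(?F1 has_real_derivative - inverse ((bump x)^3) / 4) (at (x \<bullet> x))"
    using pos
    by (auto intro!: derivative_eq_intros simp: bump_def power3_eq_cube field_simps)
  from has_jet_compose[OF j F F1]
  have "has_jet bump (\<lambda>z. z /\<^sub>R bump z)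
     (\<lambda>k. ?F1 (x \<bullet> x) *\<^sub>R (2 *\<^sub>R k) + (- inverse ((bump x)^3) / 4 * ((2 *\<^sub>R x) \<bullet> k)) *\<^sub>R (2 *\<^sub>R x)) x"
    (is "has_jet _ _ ?H x") by (simp add: bump_def[abs_def])
  moreover have "tr ?H = DIM('a) / bump x - (norm x)\<^sup>2 / (bump x)^3"
    unfolding tr_compose by (simp add: tr_scale tr_id bump_def power_mult_distrib field_simps)
  ultimately show ?thesis using that by blast
qed

text \<open>Far from the origin the gradient is almost a unit vector, so \<open>bump\<close> can
  serve as the radial coordinate of a spherical front; near the origin the deviation is large and
  must be handled separately.\<close>

lemma bump_gradient_norm: "(norm (x /\<^sub>R bump x))\<^sup>2 = 1 - 1 / (bump x)\<^sup>2"
proof -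
  have "(norm (x /\<^sub>R bump x))\<^sup>2 = (norm x)\<^sup>2 / (bump x)\<^sup>2"
    by (simp add: power_mult_distrib power_divide divide_inverse power_inverse mult.commute)
  also have "\<dots> = 1 - 1 / (bump x)\<^sup>2"
    unfolding bump_sq by (simp add: field_simps add_nonneg_eq_0_iff)
  finally show ?thesis .
qed

lemma continuous_bump: "continuous_on S bump"
  unfolding bump_def[abs_def] by (intro continuous_intros)

lemma bump_laplacian_bound:
  fixes x :: "'x::euclidean_space"
  obtains H where "has_jet bump (\<lambda>z. z /\<^sub>R bump z) H x" "tr H \<le> DIM('x) / bump x"
proof -
  obtain H where H: "has_jet bump (\<lambda>z. z /\<^sub>R bump z) H x"
    "tr H = DIM('x) / bump x - (norm x)\<^sup>2 / (bump x)^3" using bump_jet by blast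
  have "(norm x)\<^sup>2 / (bump x)^3 \<ge> 0" using bump_ge(3)[of x] by simp
  then show ?thesis using that[OF H(1)] H(2) by simp
qed

section \<open>Parabolic comparison with a Neumann condition\<close>

text \<open>The Neumann condition enters only as a right derivative along the ray in the direction
  \<open>g\<close>, which is all that a contact at the boundary tests; no derivative of
  \<open>u\<close> in other directions is needed there. \<eta> is the growing penalty,
  \<open>X\<close> its gradient, and one constant \<open>C1\<close> bounds both its gradient and its
  Laplacian.\<close>

locale neumann_problem =
  fixes \<Omega> :: "'a::euclidean_space set" and g X :: "'a \<Rightarrow> 'a" and \<eta> :: "'a \<Rightarrow> real"
    and f :: "real \<Rightarrow> real" and u :: "real \<Rightarrow> 'a \<Rightarrow> real" and L C1 :: real
  assumes open_domain: "open \<Omega>"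
    and L_nonneg: "L \<ge> 0"
    and lipschitz: "\<And>r s. 0 \<le> r \<Longrightarrow> r \<le> 1 \<Longrightarrow> 0 \<le> s \<Longrightarrow> s \<le> 1 \<Longrightarrow> \<bar>f r - f s\<bar> \<le> L * \<bar>r - s\<bar>"
    and cont_u: "continuous_on (UNIV \<times> closure \<Omega>) (\<lambda>(t, x). u t x)"
    and range_u: "\<And>t x. x \<in> closure \<Omega> \<Longrightarrow> 0 \<le> u t x \<and> u t x \<le> 1"
    and equation: "\<And>t x. x \<in> \<Omega> \<Longrightarrow> \<exists>G H. has_jet (u t) G H x \<and>
          ((\<lambda>s. u s x) has_real_derivative tr H + f (u t x)) (at t)"
    and inward: "\<And>x. x \<in> frontier \<Omega> \<Longrightarrow> \<forall>\<^sub>F s in at_right 0. x + s *\<^sub>R g x \<in> \<Omega>"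
    and neumann: "\<And>t x. x \<in> frontier \<Omega> \<Longrightarrow>
          ((\<lambda>s. u t (x + s *\<^sub>R g x)) has_real_derivative 0) (at_right 0)"
    and \<eta>_ge: "\<And>x. \<eta> x \<ge> 1" "\<And>x. \<eta> x \<ge> norm x"
    and \<eta>_jet: "\<And>x. \<exists>H. has_jet \<eta> X H x \<and> \<bar>tr H\<bar> \<le> C1"
    and \<eta>_gradient: "\<And>x. norm (X x) \<le> C1"
    and \<eta>_frontier: "\<And>x. x \<in> frontier \<Omega> \<Longrightarrow> g x \<bullet> X x < 0"
begin

lemma continuous_\<eta>: "continuous_on S \<eta>"
proof -
  have "isCont \<eta> x" for x
    using \<eta>_jet[of x] has_jet_gradient has_derivative_continuous by blast
  then show ?thesis by (simp add: continuous_at_imp_continuous_on)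
qed

text \<open>\<open>w\<close> itself need not be differentiable: it may be a maximum of two smooth functions.\<close>
definition touching_subsolution :: "(real \<Rightarrow> 'a \<Rightarrow> real) \<Rightarrow> 'a set \<Rightarrow> real \<Rightarrow> 'a \<Rightarrow> bool" where
  "touching_subsolution w C s x \<longleftrightarrow>
     (\<exists>W Wt G H e. e > 0 \<and> ball x e \<inter> closure \<Omega> \<subseteq> C \<and> (\<forall>t' x'. W t' x' \<le> w t' x') \<and> W s x = w s x \<and>
         ((\<lambda>r. W r x) has_real_derivative Wt) (at s) \<and> has_jet (W s) G H x \<and>
         (x \<in> \<Omega> \<longrightarrow> Wt \<le> tr H + f (w s x)) \<and> (x \<in> frontier \<Omega> \<longrightarrow> g x \<bullet> G x \<ge> 0))"

lemma touching_subsolutionI: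
  assumes "e > 0" "ball x e \<inter> closure \<Omega> \<subseteq> C" "\<And>t' x'. W t' x' \<le> w t' x'" "W s x = w s x"
    and "((\<lambda>r. W r x) has_real_derivative Wt) (at s)" "has_jet (W s) G H x"
    and "x \<in> \<Omega> \<Longrightarrow> Wt \<le> tr H + f (w s x)" "x \<in> frontier \<Omega> \<Longrightarrow> g x \<bullet> G x \<ge> 0"
  shows "touching_subsolution w C s x"
  unfolding touching_subsolution_def using assms by blast

text \<open>The perturbation makes the set where \<open>u\<close> fails to stay above \<open>w\<close> compact, so that there is an
  earliest contact point, and makes all inequalities there strict.\<close>
lemma comparison_strict:
  fixes w :: "real \<Rightarrow> 'a \<Rightarrow> real"
  assumes C: "closed C" "C \<subseteq> closure \<Omega>"
    and cont_w: "continuous_on UNIV (\<lambda>(t, x). w t x)"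
    and w_le: "\<And>t x. w t x \<le> 1"
    and init: "\<And>x. x \<in> C \<Longrightarrow> w T x \<le> u T x"
    and touch: "\<And>s x. T < s \<Longrightarrow> s \<le> t \<Longrightarrow> x \<in> C \<Longrightarrow> u s x < w s x \<Longrightarrow>
       touching_subsolution w C s x"
    and \<epsilon>: "\<epsilon> > 0" and t: "T \<le> t" and x: "x \<in> C"
  shows "u t x - w t x + \<epsilon> * exp ((L + C1 + 1) * (t - T)) * \<eta> x > 0"
proof (rule ccontr)
  \<comment> \<open>In the exponent, L pays for the Lipschitz constant of \<open>f\<close>, C1 for
    the Laplacian of \<eta> (using \<open>\<eta> \<ge> 1\<close>), and the extra 1 leaves a strictly
    positive remainder.\<close>
  define E where "E s = exp ((L + C1 + 1) * (s - T))" for s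
  define m where "m s z = u s z - w s z + \<epsilon> * E s * \<eta> z" for s z
  have C1: "C1 \<ge> 0" by (rule order_trans[OF norm_ge_zero \<eta>_gradient])
  have E_ge: "E s \<ge> 1" if "s \<ge> T" for s
    unfolding E_def using that C1 L_nonneg by simp
  have E_pos: "E s > 0" for s by (simp add: E_def)
  define Z where "Z = {p \<in> {T..t} \<times> C. m (fst p) (snd p) \<le> 0}"
  assume "\<not> ?thesis"
  then have "(t, x) \<in> Z" using t x by (simp add: Z_def m_def E_def)
  have contm: "continuous_on (UNIV \<times> C) (\<lambda>p. m (fst p) (snd p))"
  proof -
    have "continuous_on (UNIV \<times> C) (\<lambda>p. u (fst p) (snd p))"
      using continuous_on_subset[OF cont_u, of "UNIV \<times> C"] C by (auto simp: case_prod_beta)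
    moreover have "continuous_on (UNIV \<times> C) (\<lambda>p. w (fst p) (snd p))"
      using continuous_on_subset[OF cont_w, of "UNIV \<times> C"] by (auto simp: case_prod_beta)
    moreover have "continuous_on (UNIV \<times> C) (\<lambda>p. \<eta> (snd p))"
      by (rule continuous_on_compose2[OF continuous_\<eta>[of UNIV]]) (auto intro: continuous_intros)
    ultimately show ?thesis unfolding m_def E_def by (intro continuous_intros)
  qed
  have "closed Z"
  proof -
    have "Z = {p \<in> {T..t} \<times> C. m (fst p) (snd p) \<in> {..0}}" by (auto simp: Z_def)
    also have "\<dots> = ({T..t} \<times> C) \<inter> (\<lambda>p. m (fst p) (snd p)) -` {..0}" by auto
    also have "closed \<dots>"
      by (rule continuous_closed_preimage)
        (auto intro: continuous_on_subset[OF contm] closed_Times C)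
    finally show ?thesis .
  qed
  moreover have "bounded Z"
  proof (rule bounded_subset)
    show "bounded ({T..t} \<times> cball (0::'a) (1 / \<epsilon>))" by (simp add: bounded_Times)
    show "Z \<subseteq> {T..t} \<times> cball 0 (1 / \<epsilon>)"
    proof
      fix p assume p: "p \<in> Z"
      obtain s z where [simp]: "p = (s, z)" by force
      have sz: "s \<in> {T..t}" "z \<in> C" "m s z \<le> 0" using p by (auto simp: Z_def)
      have "\<epsilon> * 1 * \<eta> z \<le> \<epsilon> * E s * \<eta> z"
        using E_ge[of s] sz \<epsilon> \<eta>_ge(1)[of z] by (intro mult_right_mono mult_left_mono) auto
      also have "\<dots> \<le> 1"
        using sz(3) w_le[of s z] range_u[of z s] C sz(2) by (auto simp: m_def)
      finally have "\<eta> z \<le> 1 / \<epsilon>" using \<epsilon> by (simp add: field_simps)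
      then have "norm z \<le> 1 / \<epsilon>" using \<eta>_ge(2)[of z] by linarith
      then show "p \<in> {T..t} \<times> cball 0 (1 / \<epsilon>)" using sz by simp
    qed
  qed
  ultimately have "compact Z" by (simp add: compact_eq_bounded_closed)
  from continuous_attains_inf[OF this _ continuous_on_fst[OF continuous_on_id]]
  obtain p where p: "p \<in> Z" "\<And>q. q \<in> Z \<Longrightarrow> fst p \<le> fst q"
    using \<open>(t, x) \<in> Z\<close> by (metis empty_iff)
  obtain t0 x0 where [simp]: "p = (t0, x0)" by force
  have t0: "T \<le> t0" "t0 \<le> t" and x0: "x0 \<in> C" and m0: "m t0 x0 \<le> 0" using p(1) by (auto simp: Z_def)
  have x0c: "x0 \<in> closure \<Omega>" using x0 C by auto
  have pos: "\<epsilon> * E t0 * \<eta> x0 > 0" using \<epsilon> E_pos[of t0] \<eta>_ge(1)[of x0] by (simp add: zero_less_mult_iff)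
  have uw: "u t0 x0 < w t0 x0" using m0 pos by (simp add: m_def)
  then have "t0 \<noteq> T" using init[OF x0] by auto
  then have Tt0: "T < t0" using t0 by simp
  have before: "m s z > 0" if "T \<le> s" "s < t0" "z \<in> C" for s z
    using p(2)[of "(s, z)"] that t0 by (force simp: Z_def)
  have at_t0: "m t0 z \<ge> 0" if z: "z \<in> C" for z
  proof -
    have "continuous_on {T..t0} (\<lambda>s. m s z)"
      by (rule continuous_on_compose2[OF contm, of "{T..t0}" "\<lambda>s. (s, z)", simplified])
        (use z in \<open>auto intro!: continuous_intros\<close>)
    then have "((\<lambda>s. m s z) \<longlongrightarrow> m t0 z) (at_left t0)" using Tt0 by (rule continuous_on_Icc_at_leftD)
    moreover have "\<forall>\<^sub>F s in at_left t0. 0 \<le> m s z"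
      using eventually_at_left_real[OF Tt0] by eventually_elim (use before z in \<open>auto intro: less_imp_le\<close>)
    ultimately show ?thesis by (rule tendsto_lowerbound) simp
  qed
  have m00: "m t0 x0 = 0" using at_t0[OF x0] m0 by simp
  obtain W Wt G H e where e: "e > 0" "ball x0 e \<inter> closure \<Omega> \<subseteq> C"
    and W: "\<And>t' x'. W t' x' \<le> w t' x'" "W t0 x0 = w t0 x0"
    and Wt: "((\<lambda>s. W s x0) has_real_derivative Wt) (at t0)" and WJ: "has_jet (W t0) G H x0"
    and Win: "x0 \<in> \<Omega> \<Longrightarrow> Wt \<le> tr H + f (w t0 x0)"
    and Wfr: "x0 \<in> frontier \<Omega> \<Longrightarrow> g x0 \<bullet> G x0 \<ge> 0"
    using touch[OF Tt0 t0(2) x0 uw] unfolding touching_subsolution_def by blast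
  \<comment> \<open>Replacing \<open>w\<close> by the smooth function \<open>W\<close> that touches
    it from below only increases the difference and keeps its value at the contact point, so the
    minimum survives and derivatives become available.\<close>
  define n where "n s z = u s z + ((-1) * W s z + (\<epsilon> * E s) * \<eta> z)" for s z
  have nm: "n s z \<ge> m s z" for s z using W(1)[of s z] by (simp add: n_def m_def)
  have n0: "n t0 x0 = 0" using m00 W(2) by (simp add: n_def m_def)
  have nmin: "n t0 z \<ge> n t0 x0" if "z \<in> ball x0 e \<inter> closure \<Omega>" for z
    using at_t0[of z] nm[of t0 z] e(2) that n0 by auto
  obtain K where K: "has_jet \<eta> X K x0" "\<bar>tr K\<bar> \<le> C1" using \<eta>_jet by blast
  show False
  proof (cases "x0 \<in> \<Omega>")
    case True
    obtain Gu Hu where Ju: "has_jet (u t0) Gu Hu x0"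
      and ut: "((\<lambda>s. u s x0) has_real_derivative tr Hu + f (u t0 x0)) (at t0)"
      using equation[OF True] by blast
    have J: "has_jet (n t0) (\<lambda>z. Gu z + ((-1) *\<^sub>R G z + (\<epsilon> * E t0) *\<^sub>R X z))
        (\<lambda>k. Hu k + ((-1) *\<^sub>R H k + (\<epsilon> * E t0) *\<^sub>R K k)) x0"
      unfolding n_def by (intro has_jet_add has_jet_scale Ju WJ K)
    have "open (ball x0 e \<inter> \<Omega>)" "x0 \<in> ball x0 e \<inter> \<Omega>" using open_domain True e by auto
    then have "\<forall>\<^sub>F z in nhds x0. z \<in> ball x0 e \<inter> \<Omega>" by (rule eventually_nhds_in_open)
    then have "\<forall>\<^sub>F z in nhds x0. n t0 x0 \<le> n t0 z"
      by eventually_elim (use nmin closure_subset in blast)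
    from has_jet_min[OF J this]
    have lap: "tr Hu - tr H + \<epsilon> * E t0 * tr K \<ge> 0"
      unfolding tr_add tr_scale by simp
    have dE: "(E has_real_derivative (L + C1 + 1) * E t0) (at t0)"
      unfolding E_def by (auto intro!: derivative_eq_intros)
    have "((\<lambda>s. n s x0) has_real_derivative
        (tr Hu + f (u t0 x0)) + ((-1) * Wt + \<epsilon> * ((L + C1 + 1) * E t0) * \<eta> x0)) (at t0)"
      unfolding n_def by (intro DERIV_add DERIV_cmult DERIV_cmult_right ut Wt dE)
    then have "(tr Hu + f (u t0 x0)) + ((-1) * Wt + \<epsilon> * ((L + C1 + 1) * E t0) * \<eta> x0) \<le> 0"
      by (rule derivative_nonpos_at_left_min[OF _ Tt0])
        (use before nm n0 x0 in \<open>smt (verit) less_imp_le\<close>)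
    moreover have "Wt \<le> tr H + f (w t0 x0)" using Win True by simp
    moreover have wu: "w t0 x0 - u t0 x0 = \<epsilon> * E t0 * \<eta> x0" using m00 by (simp add: m_def)
    have "\<bar>f (w t0 x0) - f (u t0 x0)\<bar> \<le> L * \<bar>w t0 x0 - u t0 x0\<bar>"
      by (rule lipschitz) (use range_u[OF x0c, of t0] uw w_le[of t0 x0] in auto)
    then have "f (w t0 x0) - f (u t0 x0) \<le> L * (\<epsilon> * E t0 * \<eta> x0)" using wu pos by simp
    moreover have "\<epsilon> * E t0 * tr K \<le> \<epsilon> * E t0 * C1"
      using K(2) \<epsilon> E_pos[of t0] by (intro mult_left_mono) auto
    ultimately have "\<epsilon> * ((L + C1 + 1) * E t0) * \<eta> x0 - L * (\<epsilon> * E t0 * \<eta> x0) - \<epsilon> * E t0 * C1 \<le> 0"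
      using lap by linarith
    moreover have "\<epsilon> * ((L + C1 + 1) * E t0) * \<eta> x0 - L * (\<epsilon> * E t0 * \<eta> x0) - \<epsilon> * E t0 * C1
        = \<epsilon> * E t0 * \<eta> x0 + (\<epsilon> * E t0) * (C1 * (\<eta> x0 - 1))" by (simp add: algebra_simps)
    moreover have "(\<epsilon> * E t0) * (C1 * (\<eta> x0 - 1)) \<ge> 0" using \<epsilon> E_pos[of t0] C1 \<eta>_ge(1)[of x0] by simp
    ultimately show False using pos by linarith
  next
    case False
    then have fr: "x0 \<in> frontier \<Omega>" using x0c open_domain by (simp add: frontier_def interior_open)
    have line: "((\<lambda>s. h (x0 + s *\<^sub>R g x0)) has_real_derivative D x0 \<bullet> g x0) (at_right 0)"
      if "has_jet h D B x0" for h D B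
      using eventually_nhds_x_imp_x[OF has_jet_line(1)[OF that, of "g x0"]]
      by (simp add: has_field_derivative_at_within)
    have "((\<lambda>s. n t0 (x0 + s *\<^sub>R g x0)) has_real_derivative
        0 + ((-1) * (G x0 \<bullet> g x0) + (\<epsilon> * E t0) * (X x0 \<bullet> g x0))) (at_right 0)"
      unfolding n_def using line[OF WJ] line[OF K(1)] neumann[OF fr, of t0]
      by (intro DERIV_add DERIV_cmult) auto
    \<comment> \<open>At a boundary contact \<open>u\<close> contributes 0 and \<open>W\<close> at
      most 0; the strict sign comes from \<eta> alone. The difference would then drop below its
      minimum on entering the domain.\<close>
    moreover have "0 + ((-1) * (G x0 \<bullet> g x0) + (\<epsilon> * E t0) * (X x0 \<bullet> g x0)) < 0"
    proof -
      have "(\<epsilon> * E t0) * (X x0 \<bullet> g x0) < 0"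
        using \<eta>_frontier[OF fr] \<epsilon> E_pos[of t0] by (simp add: mult_pos_neg inner_commute)
      then show ?thesis using Wfr[OF fr] by (simp add: inner_commute)
    qed
    ultimately obtain d where d: "d > 0"
      "\<And>s. s > 0 \<Longrightarrow> s < d \<Longrightarrow> n t0 (x0 + s *\<^sub>R g x0) < n t0 (x0 + 0 *\<^sub>R g x0)"
      by (auto dest!: has_real_derivative_neg_dec_right)
    have "\<forall>\<^sub>F s in at_right 0. x0 + s *\<^sub>R g x0 \<in> ball x0 e"
    proof -
      have "((\<lambda>s. x0 + s *\<^sub>R g x0) \<longlongrightarrow> x0 + 0 *\<^sub>R g x0) (at_right 0)" by (intro tendsto_intros)
      then show ?thesis by (rule topological_tendstoD) (use e in auto)
    qed
    moreover have "\<forall>\<^sub>F s in at_right (0::real). 0 < s \<and> s < d"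
      using eventually_at_right_real[OF d(1)] by simp
    ultimately have "\<forall>\<^sub>F s in at_right (0::real). False"
      using inward[OF fr]
    proof eventually_elim
      case (elim s)
      then have "x0 + s *\<^sub>R g x0 \<in> ball x0 e \<inter> closure \<Omega>" using closure_subset by blast
      then show ?case using nmin d(2)[of s] elim by fastforce
    qed
    then show False by simp
  qed
qed

text \<open>The penalty is sent to 0 at one fixed point (t, x), where its factor is just a number;
  hence its growth in x does no harm.\<close>

lemma comparison:
  fixes w :: "real \<Rightarrow> 'a \<Rightarrow> real"
  assumes C: "closed C" "C \<subseteq> closure \<Omega>"
    and cont_w: "continuous_on UNIV (\<lambda>(t, x). w t x)"
    and w_le: "\<And>t x. w t x \<le> 1"
    and init: "\<And>x. x \<in> C \<Longrightarrow> w T x \<le> u T x"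
    and touch: "\<And>s x. T < s \<Longrightarrow> s \<le> t \<Longrightarrow> x \<in> C \<Longrightarrow> u s x < w s x \<Longrightarrow>
       touching_subsolution w C s x"
    and t: "T \<le> t" and x: "x \<in> C"
  shows "w t x \<le> u t x"
proof (rule field_le_epsilon)
  fix d :: real assume d: "d > 0"
  have div: "r > 0 \<Longrightarrow> d / r * r = d" for r by simp
  let ?k = "exp ((L + C1 + 1) * (t - T)) * \<eta> x"
  have k: "?k > 0" using \<eta>_ge(1)[of x] by (simp add: zero_less_mult_iff)
  have "u t x - w t x + d / ?k * exp ((L + C1 + 1) * (t - T)) * \<eta> x > 0"
    by (rule comparison_strict[OF C cont_w w_le init touch _ t x]) (use d k in \<open>auto simp del: mult_exp_exp\<close>)
  moreover have "d / ?k * exp ((L + C1 + 1) * (t - T)) * \<eta> x = d / ?k * ?k" by (simp only: mult.assoc)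
  moreover have "d / ?k * ?k = d" using k by (rule div)
  ultimately show "w t x \<le> u t x + d" by linarith
qed

end

section \<open>Interior gradient bound\<close>

lemma inner_Basis_line:
  fixes w b :: "'a::euclidean_space"
  assumes "b \<in> Basis"
  shows "(w + \<sigma> *\<^sub>R b) \<bullet> (w + \<sigma> *\<^sub>R b) = w \<bullet> w + 2 * \<sigma> * (w \<bullet> b) + \<sigma>\<^sup>2"
  using assms
  by (simp add: inner_add_left inner_add_right inner_commute[of b w] power2_eq_square algebra_simps)

text \<open>The difference \<open>U(z + k e) - U(z - k e)\<close> is a subsolution of a parabolic equation in \<open>(t, z, k)\<close>
  and vanishes for \<open>k = 0\<close>; a barrier concave in \<open>k\<close> then gives a gradient bound.\<close>
lemma interior_gradient_bound:
  fixes U :: "real \<Rightarrow> 'a::euclidean_space \<Rightarrow> real" and F :: real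
  assumes cont: "continuous_on ({t-1..t} \<times> cball x 1) (\<lambda>(s, z). U s z)"
    and rng: "\<And>s z. s \<in> {t-1..t} \<Longrightarrow> z \<in> cball x 1 \<Longrightarrow> 0 \<le> U s z \<and> U s z \<le> 1"
    and eqn: "\<And>s z. t - 1 < s \<Longrightarrow> s \<le> t \<Longrightarrow> z \<in> ball x 1 \<Longrightarrow>
      \<exists>G H D. has_jet (U s) G H z \<and> ((\<lambda>s. U s z) has_real_derivative D) (at s) \<and> \<bar>D - tr H\<bar> \<le> F"
    and e: "e \<in> Basis" and h: "0 \<le> h" "h \<le> 1/4"
  shows "U t (x + h *\<^sub>R e) - U t (x - h *\<^sub>R e) \<le> (4 + (8 * real DIM('a) + 9 + 2 * F) / 4) * h"
proof (rule field_le_epsilon)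
  fix \<epsilon> :: real assume \<epsilon>: "\<epsilon> > 0"
  \<comment> \<open>In \<open>B\<close>, 8 per dimension bounds the contribution of the quadratic
    term, 2F pays for the equation at the two points, and 9 = 4 + 4 + 1 covers the time term, the
    two diagonal directions and strictness. In \<open>A\<close>, the part B/4 ensures A k - B k^2
    \<ge> 4 k for k \<le> 1/4.\<close>
  define B where "B = 8 * real DIM('a) + 9 + 2 * F"
  define A where "A = 4 + B / 4"
  have F: "F \<ge> 0" using eqn[of t x] by fastforce
  have B: "B > 0" using F by (simp add: B_def)
  have ne: "norm e = 1" using e by simp
  \<comment> \<open>The difference of the two values is at most 1 and vanishes for k = 0. Each term
    guards one face: \<epsilon> the face k = 0, the concave term k = 1/4, the quadratic term the
    sphere of radius 1/2, and the last one the initial time. A negative minimum thus avoids all of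
    them.\<close>
  define bar where "bar s z k = \<epsilon> + (A * k - B * k\<^sup>2) + 4 * ((z - x) \<bullet> (z - x)) + 4 * (t - s)" for s z and k :: real
  define P where "P s z k = bar s z k - U s (z + k *\<^sub>R e) + U s (z - k *\<^sub>R e)" for s z and k :: real
  define S where "S = {t-1..t} \<times> cball x (1/2) \<times> {0..1/4::real}"
  have inball: "z + k *\<^sub>R e \<in> ball x 1" "z - k *\<^sub>R e \<in> ball x 1"
    if "z \<in> cball x (1/2)" "0 \<le> k" "k \<le> 1/4" for z and k :: real
  proof -
    have "dist x (z + k *\<^sub>R e) \<le> dist x z + dist z (z + k *\<^sub>R e)" by (rule dist_triangle)
    also have "dist z (z + k *\<^sub>R e) = k" using that ne by (simp add: dist_norm)
    finally show "z + k *\<^sub>R e \<in> ball x 1" using that by simp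
    have "dist x (z - k *\<^sub>R e) \<le> dist x z + dist z (z - k *\<^sub>R e)" by (rule dist_triangle)
    also have "dist z (z - k *\<^sub>R e) = k" using that ne by (simp add: dist_norm)
    finally show "z - k *\<^sub>R e \<in> ball x 1" using that by simp
  qed
  have "compact S" unfolding S_def by (intro compact_Times compact_cball compact_Icc)
  moreover have "continuous_on S (\<lambda>(s, z, k). P s z k)"
  proof -
    have "continuous_on S (\<lambda>p. (\<lambda>(s, z). U s z) (fst p, fst (snd p) + snd (snd p) *\<^sub>R e))"
      by (rule continuous_on_compose2[OF cont])
        (auto simp: S_def intro!: continuous_intros, (use inball in \<open>auto simp: less_imp_le\<close>)[1])
    moreover have "continuous_on S (\<lambda>p. (\<lambda>(s, z). U s z) (fst p, fst (snd p) - snd (snd p) *\<^sub>R e))"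
      by (rule continuous_on_compose2[OF cont])
        (auto simp: S_def intro!: continuous_intros, (use inball in \<open>auto simp: less_imp_le\<close>)[1])
    ultimately show ?thesis
      unfolding P_def bar_def case_prod_beta by (auto intro!: continuous_intros)
  qed
  moreover have "(t, x, h) \<in> S" using h by (simp add: S_def)
  ultimately obtain p where p: "p \<in> S" "\<And>q. q \<in> S \<Longrightarrow> (\<lambda>(s, z, k). P s z k) p \<le> (\<lambda>(s, z, k). P s z k) q"
    using continuous_attains_inf[of S "\<lambda>(s, z, k). P s z k"] by (metis empty_iff)
  obtain s0 z0 k0 where [simp]: "p = (s0, z0, k0)" using prod_cases3 by blast
  have s0: "t - 1 \<le> s0" "s0 \<le> t" and z0: "z0 \<in> cball x (1/2)" and k0: "0 \<le> k0" "k0 \<le> 1/4"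
    using p(1) by (auto simp: S_def)
  have pmin: "P s0 z0 k0 \<le> P s z k" if "(s, z, k) \<in> S" for s z k
    using p(2)[OF that] by simp
  have "P s0 z0 k0 \<ge> 0"
  proof (rule ccontr)
    assume "\<not> P s0 z0 k0 \<ge> 0"
    then have neg: "P s0 z0 k0 < 0" by simp
    have "B * k0\<^sup>2 \<le> B * (k0 * (1/4))"
      unfolding power2_eq_square using B k0 by (intro mult_left_mono) auto
    then have conc: "A * k0 - B * k0\<^sup>2 \<ge> 4 * k0" by (simp add: A_def algebra_simps)
    have diff: "U s0 (z0 + k0 *\<^sub>R e) - U s0 (z0 - k0 *\<^sub>R e) \<le> 1"
      using rng[of s0 "z0 + k0 *\<^sub>R e"] rng[of s0 "z0 - k0 *\<^sub>R e"] inball[OF z0 k0] s0 by auto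
    have small: "bar s0 z0 k0 < 1" using neg diff by (simp add: P_def)
    have sq: "(z0 - x) \<bullet> (z0 - x) = (dist x z0)\<^sup>2"
      by (simp add: dist_norm norm_minus_commute dot_square_norm)
    define Q where "Q = (z0 - x) \<bullet> (z0 - x)"
    have Q: "Q \<ge> 0" by (simp add: Q_def)
    have lt: "\<epsilon> + 4 * k0 + 4 * Q + 4 * (t - s0) < 1"
      using small conc unfolding bar_def Q_def[symmetric] by linarith
    have s0': "s0 > t - 1" using lt Q k0 \<epsilon> by simp
    have k0': "k0 < 1/4" using lt Q \<epsilon> s0 by simp
    have k0'': "k0 > 0"
    proof (rule ccontr)
      assume "\<not> k0 > 0"
      then have "k0 = 0" using k0 by simp
      then have "bar s0 z0 k0 < 0" using neg by (simp add: P_def)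
      then show False using \<epsilon> s0 Q \<open>k0 = 0\<close> unfolding bar_def Q_def[symmetric] by simp
    qed
    have z0': "z0 \<in> ball x (1/2)"
    proof (rule ccontr)
      assume "z0 \<notin> ball x (1/2)"
      then have d: "dist x z0 = 1/2" using z0 by simp
      have "Q = 1/4" unfolding Q_def sq d by (simp add: power2_eq_square)
      then show False using lt k0 \<epsilon> s0 by simp
    qed
    let ?p = "z0 + k0 *\<^sub>R e" and ?m = "z0 - k0 *\<^sub>R e"
    obtain Gp Hp Dp where jp: "has_jet (U s0) Gp Hp ?p" and tp: "((\<lambda>s. U s ?p) has_real_derivative Dp) (at s0)"
      and dp: "\<bar>Dp - tr Hp\<bar> \<le> F"
      using eqn[OF s0' s0(2), of ?p] inball[OF z0 k0] by blast
    obtain Gm Hm Dm where jm: "has_jet (U s0) Gm Hm ?m" and tm: "((\<lambda>s. U s ?m) has_real_derivative Dm) (at s0)"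
      and dm: "\<bar>Dm - tr Hm\<bar> \<le> F"
      using eqn[OF s0' s0(2), of ?m] inball[OF z0 k0] by blast
    have near: "\<forall>\<^sub>F \<sigma> in nhds 0. P s0 z0 k0 \<le> P s0 (z0 + \<sigma> *\<^sub>R v) (k0 + \<sigma> * r)" for v r
    proof -
      have "((\<lambda>\<sigma>. (z0 + \<sigma> *\<^sub>R v, k0 + \<sigma> * r)) \<longlongrightarrow> (z0 + 0 *\<^sub>R v, k0 + 0 * r)) (nhds 0)"
        by (intro tendsto_intros) (simp_all add: filterlim_ident)
      then have "\<forall>\<^sub>F \<sigma> in nhds 0. (z0 + \<sigma> *\<^sub>R v, k0 + \<sigma> * r) \<in> ball x (1/2) \<times> {0<..<1/4}"
        by (rule topological_tendstoD) (use z0' k0' k0'' in \<open>auto simp: open_Times\<close>)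
      then show ?thesis
        by eventually_elim (rule pmin, use s0 in \<open>auto simp: S_def less_imp_le\<close>)
    qed
    \<comment> \<open>Varying z alone shifts both points in parallel; 8 is the second derivative of
      the quadratic term.\<close>
    have other: "Hp b \<bullet> b - Hm b \<bullet> b \<le> 8" if b: "b \<in> Basis" for b
    proof -
      have bar: "bar s0 (z0 + \<sigma> *\<^sub>R b) k0 = bar s0 z0 k0 + 8 * \<sigma> * ((z0 - x) \<bullet> b) + 4 * \<sigma>\<^sup>2" for \<sigma>
      proof -
        have "z0 + \<sigma> *\<^sub>R b - x = (z0 - x) + \<sigma> *\<^sub>R b" by simp
        then show ?thesis unfolding bar_def by (simp only: inner_Basis_line[OF b]) simp
      qed
      have shift: "z0 + \<sigma> *\<^sub>R b + k0 *\<^sub>R e = ?p + \<sigma> *\<^sub>R b" "z0 + \<sigma> *\<^sub>R b - k0 *\<^sub>R e = ?m + \<sigma> *\<^sub>R b" for \<sigma>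
        by (simp_all add: algebra_simps)
      let ?h = "\<lambda>\<sigma>. bar s0 z0 k0 + 8 * \<sigma> * ((z0 - x) \<bullet> b) + 4 * \<sigma>\<^sup>2
        - U s0 (?p + \<sigma> *\<^sub>R b) + U s0 (?m + \<sigma> *\<^sub>R b)"
      have "\<forall>\<^sub>F \<sigma> in nhds 0. (?h has_real_derivative
          8 * ((z0 - x) \<bullet> b) + 8 * \<sigma> - Gp (?p + \<sigma> *\<^sub>R b) \<bullet> b + Gm (?m + \<sigma> *\<^sub>R b) \<bullet> b) (at \<sigma>)"
        using has_jet_line(1)[OF jp, of b] has_jet_line(1)[OF jm, of b]
        by eventually_elim (auto intro!: derivative_eq_intros)
      moreover have "((\<lambda>\<sigma>. 8 * ((z0 - x) \<bullet> b) + 8 * \<sigma> - Gp (?p + \<sigma> *\<^sub>R b) \<bullet> b + Gm (?m + \<sigma> *\<^sub>R b) \<bullet> b)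
          has_real_derivative 8 - Hp b \<bullet> b + Hm b \<bullet> b) (at 0)"
        using has_jet_line(2)[OF jp, of b] has_jet_line(2)[OF jm, of b]
        by (auto intro!: derivative_eq_intros)
      moreover have "\<forall>\<^sub>F \<sigma> in nhds 0. ?h 0 \<le> ?h \<sigma>"
        using near[of b 0] by eventually_elim (simp add: P_def bar shift)
      ultimately have "8 - Hp b \<bullet> b + Hm b \<bullet> b \<ge> 0" by (rule second_derivative_at_min(2))
      then show ?thesis by simp
    qed
    have barh: "bar s0 (z0 + \<sigma> *\<^sub>R ((1/2) *\<^sub>R e)) (k0 + \<sigma> * r) = bar s0 z0 k0 + A * (\<sigma> * r)
        - B * (2 * k0 * \<sigma> * r + \<sigma>\<^sup>2 * r\<^sup>2) + 4 * \<sigma> * ((z0 - x) \<bullet> e) + \<sigma>\<^sup>2" for \<sigma> r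
    proof -
      have "z0 + \<sigma> *\<^sub>R ((1/2) *\<^sub>R e) - x = (z0 - x) + (\<sigma> / 2) *\<^sub>R e" by simp
      then show ?thesis unfolding bar_def
        by (simp only: inner_Basis_line[OF e]) (simp add: power2_eq_square algebra_simps)
    qed
    \<comment> \<open>The diagonals of the (z, k) plane separate the two points: moving z and k
      together shifts only z + k e, moving them oppositely shifts only z - k e. Along each diagonal
      a single pure second derivative of \<open>U\<close> appears, and the concave term contributes
      -B/2. This is where the large constant \<open>B\<close> gains.\<close>
    have shift: "z0 + \<sigma> *\<^sub>R ((1/2) *\<^sub>R e) + (k0 + \<sigma> * (1/2)) *\<^sub>R e = ?p + \<sigma> *\<^sub>R e"
        "z0 + \<sigma> *\<^sub>R ((1/2) *\<^sub>R e) - (k0 + \<sigma> * (1/2)) *\<^sub>R e = ?m"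
        "z0 + \<sigma> *\<^sub>R ((1/2) *\<^sub>R e) + (k0 + \<sigma> * (- 1/2)) *\<^sub>R e = ?p"
        "z0 + \<sigma> *\<^sub>R ((1/2) *\<^sub>R e) - (k0 + \<sigma> * (- 1/2)) *\<^sub>R e = ?m + \<sigma> *\<^sub>R e" for \<sigma> :: real
    proof -
      have half: "(\<sigma> / 2) *\<^sub>R e + (\<sigma> / 2) *\<^sub>R e = \<sigma> *\<^sub>R e" by (simp flip: scaleR_add_left)
      show "z0 + \<sigma> *\<^sub>R ((1/2) *\<^sub>R e) + (k0 + \<sigma> * (1/2)) *\<^sub>R e = ?p + \<sigma> *\<^sub>R e"
        "z0 + \<sigma> *\<^sub>R ((1/2) *\<^sub>R e) - (k0 + \<sigma> * (1/2)) *\<^sub>R e = ?m"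
        "z0 + \<sigma> *\<^sub>R ((1/2) *\<^sub>R e) + (k0 + \<sigma> * (- 1/2)) *\<^sub>R e = ?p"
        "z0 + \<sigma> *\<^sub>R ((1/2) *\<^sub>R e) - (k0 + \<sigma> * (- 1/2)) *\<^sub>R e = ?m + \<sigma> *\<^sub>R e"
        using half by (simp_all add: scaleR_add_left algebra_simps)
    qed
    have plus: "Hp e \<bullet> e \<le> 2 - B / 2"
    proof -
      let ?h = "\<lambda>\<sigma>. bar s0 z0 k0 + A * (\<sigma> * (1/2)) - B * (2 * k0 * \<sigma> * (1/2) + \<sigma>\<^sup>2 * (1/2)\<^sup>2)
         + 4 * \<sigma> * ((z0 - x) \<bullet> e) + \<sigma>\<^sup>2 - U s0 (?p + \<sigma> *\<^sub>R e) + U s0 ?m"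
      have "\<forall>\<^sub>F \<sigma> in nhds 0. (?h has_real_derivative A / 2 - B * (k0 + \<sigma> / 2)
          + 4 * ((z0 - x) \<bullet> e) + 2 * \<sigma> - Gp (?p + \<sigma> *\<^sub>R e) \<bullet> e) (at \<sigma>)"
        using has_jet_line(1)[OF jp, of e]
        by eventually_elim (auto intro!: derivative_eq_intros simp: power2_eq_square algebra_simps)
      moreover have "((\<lambda>\<sigma>. A / 2 - B * (k0 + \<sigma> / 2)
          + 4 * ((z0 - x) \<bullet> e) + 2 * \<sigma> - Gp (?p + \<sigma> *\<^sub>R e) \<bullet> e)
          has_real_derivative - B / 2 + 2 - Hp e \<bullet> e) (at 0)"
        using has_jet_line(2)[OF jp, of e]
        by (auto intro!: derivative_eq_intros)
      moreover have "\<forall>\<^sub>F \<sigma> in nhds 0. ?h 0 \<le> ?h \<sigma>"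
        using near[of "(1/2) *\<^sub>R e" "1/2"]
        by eventually_elim (simp only: P_def barh shift, simp)
      ultimately have "- B / 2 + 2 - Hp e \<bullet> e \<ge> 0" by (rule second_derivative_at_min(2))
      then show ?thesis by simp
    qed
    have minus: "- (Hm e \<bullet> e) \<le> 2 - B / 2"
    proof -
      let ?h = "\<lambda>\<sigma>. bar s0 z0 k0 + A * (\<sigma> * (-1/2)) - B * (2 * k0 * \<sigma> * (-1/2) + \<sigma>\<^sup>2 * (-1/2)\<^sup>2)
         + 4 * \<sigma> * ((z0 - x) \<bullet> e) + \<sigma>\<^sup>2 - U s0 ?p + U s0 (?m + \<sigma> *\<^sub>R e)"
      have "\<forall>\<^sub>F \<sigma> in nhds 0. (?h has_real_derivative - A / 2 - B * (- k0 + \<sigma> / 2)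
          + 4 * ((z0 - x) \<bullet> e) + 2 * \<sigma> + Gm (?m + \<sigma> *\<^sub>R e) \<bullet> e) (at \<sigma>)"
        using has_jet_line(1)[OF jm, of e]
        by eventually_elim (auto intro!: derivative_eq_intros simp: power2_eq_square algebra_simps)
      moreover have "((\<lambda>\<sigma>. - A / 2 - B * (- k0 + \<sigma> / 2)
          + 4 * ((z0 - x) \<bullet> e) + 2 * \<sigma> + Gm (?m + \<sigma> *\<^sub>R e) \<bullet> e)
          has_real_derivative - B / 2 + 2 + Hm e \<bullet> e) (at 0)"
        using has_jet_line(2)[OF jm, of e]
        by (auto intro!: derivative_eq_intros)
      moreover have "\<forall>\<^sub>F \<sigma> in nhds 0. ?h 0 \<le> ?h \<sigma>"
        using near[of "(1/2) *\<^sub>R e" "-1/2"]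
        by eventually_elim (simp only: P_def barh shift, simp)
      ultimately have "- B / 2 + 2 + Hm e \<bullet> e \<ge> 0" by (rule second_derivative_at_min(2))
      then show ?thesis by simp
    qed
    have "tr Hp - tr Hm = (\<Sum>b\<in>Basis. Hp b \<bullet> b - Hm b \<bullet> b)" by (simp add: tr_def sum_subtractf)
    also have "\<dots> = (Hp e \<bullet> e - Hm e \<bullet> e) + (\<Sum>b\<in>Basis - {e}. Hp b \<bullet> b - Hm b \<bullet> b)"
      using e by (simp add: sum.remove)
    also have "\<dots> \<le> (4 - B) + (\<Sum>b\<in>(Basis::'a set) - {e}. 8)"
      using plus minus by (intro add_mono sum_mono other) auto
    also have "(\<Sum>b\<in>(Basis::'a set) - {e}. (8::real)) \<le> (\<Sum>b\<in>(Basis::'a set). 8)" by (rule sum_mono2) auto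
    finally have lap: "tr Hp - tr Hm \<le> 4 - B + 8 * DIM('a)" by simp
    have "((\<lambda>s. P s z0 k0) has_real_derivative - 4 - Dp + Dm) (at s0)"
      unfolding P_def bar_def by (auto intro!: derivative_eq_intros tp tm)
    then have "- 4 - Dp + Dm \<le> 0"
      by (rule derivative_nonpos_at_left_min[OF _ s0']) (use pmin z0 k0 s0 in \<open>auto simp: S_def\<close>)
    then show False using lap dp dm unfolding B_def by linarith
  qed
  then have "0 \<le> P t x h" using pmin[OF \<open>(t, x, h) \<in> S\<close>] by linarith
  moreover have "bar t x h = \<epsilon> + A * h - B * h\<^sup>2" by (simp add: bar_def)
  moreover have "B * h\<^sup>2 \<ge> 0" using B by simp
  ultimately have "U t (x + h *\<^sub>R e) - U t (x - h *\<^sub>R e) \<le> A * h + \<epsilon>"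
    unfolding P_def by linarith
  then show "U t (x + h *\<^sub>R e) - U t (x - h *\<^sub>R e) \<le> (4 + (8 * real DIM('a) + 9 + 2 * F) / 4) * h + \<epsilon>"
    by (simp only: A_def B_def)
qed

text \<open>The increment is telescoped over one coordinate at a time. The factor DIM in the
  smallness condition keeps every intermediate point in the ball and every single step below
  1/2.\<close>

lemma lipschitz_from_coordinates:
  fixes U :: "'a::euclidean_space \<Rightarrow> real" and A :: real
  assumes A: "\<And>z b k. z \<in> cball x 1 \<Longrightarrow> b \<in> Basis \<Longrightarrow> \<bar>k\<bar> \<le> 1/2 \<Longrightarrow> \<bar>U (z + k *\<^sub>R b) - U z\<bar> \<le> A * \<bar>k\<bar>"
    and A0: "A \<ge> 0" and z: "DIM('a) * norm (z - x) \<le> 1/2"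
  shows "\<bar>U z - U x\<bar> \<le> A * DIM('a) * norm (z - x)"
proof -
  define c where "c b = (z - x) \<bullet> b" for b
  have c: "\<bar>c b\<bar> \<le> norm (z - x)" if "b \<in> Basis" for b
    using Basis_le_norm[OF that] by (simp add: c_def)
  have csum: "(\<Sum>b\<in>S. \<bar>c b\<bar>) \<le> DIM('a) * norm (z - x)" if "S \<subseteq> Basis" for S
  proof -
    have "(\<Sum>b\<in>S. \<bar>c b\<bar>) \<le> (\<Sum>b\<in>Basis. \<bar>c b\<bar>)" using that by (intro sum_mono2) auto
    also have "\<dots> \<le> (\<Sum>b\<in>(Basis::'a set). norm (z - x))" by (intro sum_mono c)
    finally show ?thesis by simp
  qed
  have "\<bar>U (x + (\<Sum>b\<in>S. c b *\<^sub>R b)) - U x\<bar> \<le> A * (\<Sum>b\<in>S. \<bar>c b\<bar>)" if "S \<subseteq> Basis" for S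
    using finite_subset[OF that finite_Basis] that
  proof (induction S rule: finite_induct)
    case (insert b S)
    let ?y = "x + (\<Sum>b\<in>S. c b *\<^sub>R b)"
    have "norm (\<Sum>b\<in>S. c b *\<^sub>R b) \<le> (\<Sum>b\<in>S. \<bar>c b\<bar>)"
      using insert.prems by (intro sum_norm_le) auto
    also have "\<dots> \<le> 1/2" using csum[of S] insert.prems z by auto
    finally have y: "?y \<in> cball x 1" by (simp add: dist_norm)
    have "\<bar>c b\<bar> \<le> 1/2" using csum[of "{b}"] insert.prems z by auto
    then have "\<bar>U (?y + c b *\<^sub>R b) - U ?y\<bar> \<le> A * \<bar>c b\<bar>" using A[OF y] insert.prems by simp
    moreover have "x + (\<Sum>b\<in>insert b S. c b *\<^sub>R b) = ?y + c b *\<^sub>R b"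
      using insert.hyps by (simp add: algebra_simps)
    moreover have "(\<Sum>b\<in>insert b S. \<bar>c b\<bar>) = (\<Sum>b\<in>S. \<bar>c b\<bar>) + \<bar>c b\<bar>" using insert.hyps by simp
    ultimately show ?case using insert.IH insert.prems by (simp add: distrib_left abs_le_iff add.assoc)
  qed simp
  from this[of Basis] have "\<bar>U z - U x\<bar> \<le> A * (\<Sum>b\<in>Basis. \<bar>c b\<bar>)"
    by (simp add: c_def euclidean_representation)
  also have "\<dots> \<le> A * (DIM('a) * norm (z - x))" by (intro mult_left_mono csum A0) auto
  finally show ?thesis by simp
qed

section \<open>The traveling wave profile\<close>

text \<open>Going backwards in s, the damping makes a large derivative persist:
  \<open>exp (c * r) * (y1 r - \<epsilon> / 2)\<close> is nonincreasing, so y1 would stay above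
  \<epsilon>/2 on the whole left half-line, which a bounded \<open>y\<close> does not allow.\<close>

lemma damped_derivative_bound:
  fixes y y1 k :: "real \<Rightarrow> real"
  assumes y: "\<And>s. (y has_real_derivative y1 s) (at s)"
    and y1: "\<And>s. (y1 has_real_derivative - c * y1 s - k s) (at s)"
    and bound: "\<And>s. \<bar>y s\<bar> \<le> 1" and c: "c > 0" and \<epsilon>: "\<epsilon> > 0"
    and k: "\<And>s. s \<le> S \<Longrightarrow> \<bar>k s\<bar> \<le> c * \<epsilon> / 2" and s: "s \<le> S"
  shows "y1 s \<le> \<epsilon>"
proof (rule ccontr)
  assume "\<not> y1 s \<le> \<epsilon>"
  then have y1s: "y1 s > \<epsilon>" by simp
  define h where "h r = exp (c * r) * (y1 r - \<epsilon> / 2)" for r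
  have dh: "(h has_real_derivative exp (c * r) * (- k r - c * \<epsilon> / 2)) (at r)" for r
    unfolding h_def by (auto intro!: derivative_eq_intros y1 simp: algebra_simps)
  have low: "y1 r \<ge> \<epsilon> / 2" if "r \<le> s" for r
  proof -
    have "h s \<le> h r"
    proof (rule DERIV_nonpos_imp_nonincreasing[OF that])
      fix x assume "r \<le> x" "x \<le> s"
      then have "- k x - c * \<epsilon> / 2 \<le> 0" using k[of x] s by auto
      then have "exp (c * x) * (- k x - c * \<epsilon> / 2) \<le> 0" by (simp add: mult_nonneg_nonpos)
      then show "\<exists>D. (h has_real_derivative D) (at x) \<and> D \<le> 0" using dh by blast
    qed
    moreover have "h s > 0" using y1s \<epsilon> by (simp add: h_def)
    ultimately have "h r > 0" by linarith
    then show ?thesis by (simp add: h_def zero_less_mult_iff)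
  qed
  \<comment> \<open>On this length a slope of at least \<epsilon>/2 makes \<open>y\<close> rise by
    3, while its oscillation is at most 2.\<close>
  define r where "r = s - 6 / \<epsilon>"
  have rs: "r < s" using \<epsilon> by (simp add: r_def)
  obtain z where z: "r < z" "z < s" "y s - y r = (s - r) * y1 z"
    using MVT2[OF rs, of y y1] y by blast
  have "(s - r) * y1 z \<ge> 6 / \<epsilon> * (\<epsilon> / 2)"
    using low[of z] z rs \<epsilon> by (intro mult_mono) (auto simp: r_def)
  moreover have "6 / \<epsilon> * (\<epsilon> / 2) = 3" using \<epsilon> by simp
  ultimately show False using z(3) bound[of s] bound[of r] by (simp add: abs_le_iff)
qed

text \<open>Dividing by B + 1 instead of B covers B = 0 in the choices of constants below.\<close>

lemma mult_le_of_le_divide: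
  fixes B x K :: real
  assumes "B \<ge> 0" "x \<ge> 0" "x \<le> K / (B + 1)"
  shows "B * x \<le> K"
proof -
  have "x * (B + 1) \<le> K" using assms by (simp add: pos_le_divide_eq)
  then show ?thesis using assms(2) by (simp add: algebra_simps)
qed

locale bistable_wave =
  fixes f f' :: "real \<Rightarrow> real" and \<alpha> c :: real and \<phi> \<phi>1 :: "real \<Rightarrow> real"
  assumes \<alpha>: "0 < \<alpha>" "\<alpha> < 1"
    and df: "\<And>s. (f has_real_derivative f' s) (at s)"
    and cont_f': "continuous_on UNIV f'"
    and f'_neg: "f' 0 < 0" "f' 1 < 0"
    and f_one: "f 1 = 0"
    and f_neg: "\<And>s. 0 < s \<Longrightarrow> s < \<alpha> \<Longrightarrow> f s < 0"
    and f_pos: "\<And>s. \<alpha> < s \<Longrightarrow> s < 1 \<Longrightarrow> f s > 0"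
    and c: "c > 0"
    and d\<phi>: "\<And>s. (\<phi> has_real_derivative \<phi>1 s) (at s)"
    and d\<phi>1: "\<And>s. (\<phi>1 has_real_derivative - c * \<phi>1 s - f (\<phi> s)) (at s)"
    and range_\<phi>: "\<And>s. 0 < \<phi> s" "\<And>s. \<phi> s < 1"
    and lim_\<phi>: "(\<phi> \<longlongrightarrow> 1) at_bot" "(\<phi> \<longlongrightarrow> 0) at_top"
begin

section \<open>Bounds on the nonlinearity and strict monotonicity of the profile\<close>

lemma cont_f: "continuous_on S f"
  using df DERIV_isCont continuous_at_imp_continuous_on by blast

lemma cont_\<phi>: "continuous_on S \<phi>"
  using d\<phi> DERIV_isCont continuous_at_imp_continuous_on by blast

lemma cont_\<phi>1: "continuous_on S \<phi>1"
  using d\<phi>1 DERIV_isCont continuous_at_imp_continuous_on by blast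

lemma f_lipschitz:
  obtains L where "L \<ge> 0" "\<And>r s. 0 \<le> r \<Longrightarrow> r \<le> 1 \<Longrightarrow> 0 \<le> s \<Longrightarrow> s \<le> 1 \<Longrightarrow> \<bar>f r - f s\<bar> \<le> L * \<bar>r - s\<bar>"
proof -
  have "continuous_on {0..1} f'" using cont_f' continuous_on_subset by blast
  then have "compact (f' ` {0..1})" by (rule compact_continuous_image) simp
  then obtain B where B: "\<And>x. x \<in> {0..1} \<Longrightarrow> norm (f' x) \<le> B"
    using compact_imp_bounded bounded_iff by (metis image_eqI)
  have "norm (f r - f s) \<le> B * norm (r - s)" if "r \<in> {0..1}" "s \<in> {0..1}" for r s
    by (rule field_differentiable_bound[of "{0..1}" f f']) (use B that in \<open>auto intro: has_field_derivative_at_within[OF df]\<close>)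
  moreover have "B \<ge> 0" by (rule order_trans[OF norm_ge_zero B[of 0]]) simp
  ultimately show ?thesis using that by simp
qed

lemma f_bound:
  obtains B where "B \<ge> 0" "\<And>r. 0 \<le> r \<Longrightarrow> r \<le> 1 \<Longrightarrow> \<bar>f r\<bar> \<le> B"
proof -
  have "compact (f ` {0..1})" by (rule compact_continuous_image[OF cont_f]) simp
  then obtain B where B: "\<And>x. x \<in> {0..1} \<Longrightarrow> norm (f x) \<le> B"
    using compact_imp_bounded bounded_iff by (metis image_eqI)
  moreover have "B \<ge> 0" by (rule order_trans[OF norm_ge_zero B[of 0]]) simp
  ultimately show ?thesis using that by simp
qed

text \<open>Both rest states are stable, and \<beta> is half the weaker slope. The width 2 \<delta>
  leaves room to shift a value within \<delta> of 1 down by a loss q \<le> \<delta>.\<close>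

lemma f_decreasing_at_ends:
  obtains \<delta> \<beta> where "\<delta> > 0" "\<delta> \<le> 1 / 8" "\<beta> > 0"
    "\<And>r s. 0 \<le> r \<Longrightarrow> r < s \<Longrightarrow> s \<le> 2 * \<delta> \<Longrightarrow> f s - f r \<le> - \<beta> * (s - r)"
    "\<And>r s. 1 - 2 * \<delta> \<le> r \<Longrightarrow> r < s \<Longrightarrow> s \<le> 1 \<Longrightarrow> f s - f r \<le> - \<beta> * (s - r)"
proof -
  define \<beta> where "\<beta> = min (- f' 0) (- f' 1) / 2"
  have \<beta>: "\<beta> > 0" using f'_neg by (simp add: \<beta>_def)
  have "open {..< - \<beta>}" by simp
  then have "open (f' -` {..< - \<beta>})" using cont_f' by (rule open_vimage)
  moreover have "0 \<in> f' -` {..< - \<beta>}" "1 \<in> f' -` {..< - \<beta>}" using f'_neg by (auto simp: \<beta>_def min_def)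
  ultimately obtain e0 e1 where e: "e0 > 0" "e1 > 0" "ball 0 e0 \<subseteq> f' -` {..< - \<beta>}" "ball 1 e1 \<subseteq> f' -` {..< - \<beta>}"
    by (meson openE)
  define \<delta> where "\<delta> = min (1 / 8) (min e0 e1 / 4)"
  have \<delta>: "\<delta> > 0" "\<delta> \<le> 1 / 8" "2 * \<delta> < e0" "2 * \<delta> < e1" using e by (auto simp: \<delta>_def min_def)
  have mv: "f s - f r \<le> - \<beta> * (s - r)" if rs: "r < s" and f': "\<And>x. r \<le> x \<Longrightarrow> x \<le> s \<Longrightarrow> f' x < - \<beta>" for r s
  proof -
    obtain z where z: "r < z" "z < s" "f s - f r = (s - r) * f' z" using MVT2[OF rs, of f f'] df by blast
    have "(s - r) * f' z \<le> (s - r) * - \<beta>" using f'[of z] z rs by (intro mult_left_mono) auto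
    then show ?thesis using z(3) by (simp add: mult.commute)
  qed
  show ?thesis
  proof (rule that[OF \<delta>(1,2) \<beta>])
    fix r s assume "0 \<le> r" "r < s" "s \<le> 2 * \<delta>"
    then show "f s - f r \<le> - \<beta> * (s - r)" using e(3) \<delta> by (intro mv) (auto simp: subset_eq dist_real_def)
  next
    fix r s assume "1 - 2 * \<delta> \<le> r" "r < s" "s \<le> 1"
    then show "f s - f r \<le> - \<beta> * (s - r)" using e(4) \<delta> by (intro mv) (auto simp: subset_eq dist_real_def)
  qed
qed

text \<open>The forcing f(\<phi>) tends to f(1) = 0, so the damped estimate applies to \<phi> and to
  its negative.\<close>

lemma \<phi>1_at_bot:
  assumes "\<epsilon> > 0"
  obtains S where "\<And>s. s \<le> S \<Longrightarrow> \<bar>\<phi>1 s\<bar> \<le> \<epsilon>"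
proof -
  have "isCont f 1" using df DERIV_isCont by blast
  then have "((\<lambda>s. f (\<phi> s)) \<longlongrightarrow> f 1) at_bot" using lim_\<phi>(1) by (rule isCont_tendsto_compose)
  then have "\<forall>\<^sub>F s in at_bot. dist (f (\<phi> s)) (f 1) < c * \<epsilon> / 2"
    by (rule tendstoD) (use c assms in simp)
  then obtain S where S: "\<And>s. s \<le> S \<Longrightarrow> \<bar>f (\<phi> s)\<bar> \<le> c * \<epsilon> / 2"
    unfolding eventually_at_bot_linorder by (auto simp: f_one intro: less_imp_le)
  have \<phi>_le: "\<bar>\<phi> s\<bar> \<le> 1" for s using range_\<phi>[of s] by simp
  have "\<bar>\<phi>1 s\<bar> \<le> \<epsilon>" if "s \<le> S" for s
  proof -
    have "\<phi>1 s \<le> \<epsilon>"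
      by (rule damped_derivative_bound[of \<phi> \<phi>1 c "\<lambda>s. f (\<phi> s)" \<epsilon> S])
        (use d\<phi> d\<phi>1 c assms S that \<phi>_le in auto)
    moreover have "- \<phi>1 s \<le> \<epsilon>"
    proof (rule damped_derivative_bound[of "\<lambda>s. - \<phi> s" "\<lambda>s. - \<phi>1 s" c "\<lambda>s. - f (\<phi> s)" \<epsilon> S])
      show "((\<lambda>s. - \<phi>1 s) has_real_derivative - c * - \<phi>1 s - - f (\<phi> s)) (at s)" for s
        using DERIV_minus[OF d\<phi>1[of s]] by (simp add: add.commute)
    qed (use d\<phi> c assms S that \<phi>_le in \<open>auto intro!: DERIV_minus\<close>)
    ultimately show ?thesis by simp
  qed
  then show ?thesis using that by blast
qed

text \<open>With the integrating factor, \<open>exp (c * r) * \<phi>1 r\<close> has derivative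
  -exp(c r) f(\<phi>), which is negative as long as \<phi> > \<alpha>, and it starts from 0 at
  -infinity.\<close>

lemma \<phi>1_neg_while_above:
  assumes above: "\<And>r. r \<le> s \<Longrightarrow> \<phi> r > \<alpha>"
  shows "\<phi>1 s < 0"
proof -
  define k where "k r = exp (c * r) * \<phi>1 r" for r
  have dk: "(k has_real_derivative - exp (c * r) * f (\<phi> r)) (at r)" for r
    unfolding k_def by (auto intro!: derivative_eq_intros d\<phi>1 simp: algebra_simps)
  have neg: "- exp (c * r) * f (\<phi> r) < 0" if "r \<le> s" for r
    using f_pos[of "\<phi> r"] above[OF that] range_\<phi>(2)[of r] by simp
  have dec: "k r' < k r" if "r < r'" "r' \<le> s" for r r'
    by (rule DERIV_neg_imp_decreasing[OF that(1)]) (use dk neg that in force)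
  \<comment> \<open>The limit at -infinity yields only a weak sign, so it is used at s - 1; the
    decrease from s - 1 to s makes it strict.\<close>
  have "k (s - 1) \<le> \<epsilon>" if "\<epsilon> > 0" for \<epsilon>
  proof -
    have e: "\<epsilon> * exp (- c * s) > 0" using that by simp
    obtain S where S: "\<And>r. r \<le> S \<Longrightarrow> \<bar>\<phi>1 r\<bar> \<le> \<epsilon> * exp (- c * s)" using \<phi>1_at_bot[OF e] by blast
    define r where "r = min S (s - 2)"
    have "r < s - 1" by (simp add: r_def min_def)
    have "k (s - 1) \<le> k r" using dec[of r "s - 1"] \<open>r < s - 1\<close> by simp
    also have "\<dots> \<le> exp (c * r) * (\<epsilon> * exp (- c * s))"
      unfolding k_def using S[of r] by (intro mult_left_mono) (auto simp: r_def)
    also have "\<dots> \<le> exp (c * s) * (\<epsilon> * exp (- c * s))"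
      using that c by (intro mult_right_mono) (auto simp: r_def)
    also have "\<dots> = \<epsilon> * (exp (c * s) * exp (- c * s))" by simp
    also have "\<dots> = \<epsilon>" by (simp flip: exp_add)
    finally show ?thesis .
  qed
  then have "k (s - 1) \<le> 0" using field_le_epsilon[of "k (s - 1)" 0] by simp
  moreover have "k s < k (s - 1)" by (rule dec) auto
  ultimately have "k s < 0" by linarith
  then show ?thesis by (simp add: k_def mult_less_0_iff)
qed

text \<open>The energy \<open>\<phi>'\<^sup>2 / 2 + F(\<phi>)\<close> is nonincreasing with limit at least \<open>F(0)\<close>, so \<open>\<phi>'\<close> cannot vanish
  where \<open>F(\<phi>) < F(0)\<close>.\<close>
lemma \<phi>1_nonzero_below:
  assumes below: "\<phi> s \<le> \<alpha>"
  shows "\<phi>1 s \<noteq> 0"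
proof
  assume z: "\<phi>1 s = 0"
  \<comment> \<open>The base point -1 keeps 0 inside the interval of integration, so that
    \<open>F\<close> is differentiable from both sides at 0, the limit of \<phi>.\<close>
  define F where "F p = integral {-1..p} f" for p
  have dF: "(F has_real_derivative f p) (at p)" if "0 \<le> p" "p \<le> 1" for p
  proof -
    have "(F has_real_derivative f p) (at p within {-1..2})"
      unfolding F_def by (rule integral_has_real_derivative[OF cont_f]) (use that in auto)
    moreover have "at p within {-1..2} = at p" using that by (intro at_within_Icc_at) auto
    ultimately show ?thesis by simp
  qed
  define E where "E r = (\<phi>1 r)\<^sup>2 / 2 + F (\<phi> r)" for r
  have dE: "(E has_real_derivative - c * (\<phi>1 r)\<^sup>2) (at r)" for r
  proof -
    have "((\<lambda>r. F (\<phi> r)) has_real_derivative f (\<phi> r) * \<phi>1 r) (at r)"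
      by (rule DERIV_chain2[OF dF d\<phi>]) (use range_\<phi>[of r] in auto)
    then show ?thesis
      unfolding E_def
      by (auto intro!: derivative_eq_intros d\<phi>1 simp: power2_eq_square field_simps)
  qed
  have "F (\<phi> r) \<le> F (\<phi> s)" if "s \<le> r" for r
  proof -
    have "E r \<le> E s"
      by (rule DERIV_nonpos_imp_nonincreasing[OF that]) (use dE c in force)
    moreover have "F (\<phi> r) \<le> E r" "E s = F (\<phi> s)" by (simp_all add: E_def z)
    ultimately show ?thesis by linarith
  qed
  then have "\<forall>\<^sub>F r in at_top. F (\<phi> r) \<le> F (\<phi> s)" unfolding eventually_at_top_linorder by blast
  moreover have "((\<lambda>r. F (\<phi> r)) \<longlongrightarrow> F 0) at_top"
    by (rule isCont_tendsto_compose[OF DERIV_isCont[OF dF] lim_\<phi>(2)]) auto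
  ultimately have "F 0 \<le> F (\<phi> s)" by (intro tendsto_upperbound) auto
  moreover obtain y where "0 < y" "y < \<phi> s" "F (\<phi> s) - F 0 = (\<phi> s - 0) * f y"
    using MVT2[OF range_\<phi>(1)[of s], of F f] range_\<phi>(2)[of s] dF by fastforce
  moreover have "f y < 0" using calculation below by (intro f_neg) auto
  ultimately show False using range_\<phi>(1)[of s] mult_pos_neg[of "\<phi> s" "f y"] by simp
qed

text \<open>At the first point where \<phi>' is not negative, \<phi> has been decreasing up to
  there. If its value still exceeds \<alpha>, the integrating factor argument applies; otherwise
  \<phi>' vanishes there by continuity, against the energy argument.\<close>

lemma \<phi>1_neg: "\<phi>1 s < 0"
proof (rule ccontr)
  assume "\<not> \<phi>1 s < 0"
  define N where "N = {s. 0 \<le> \<phi>1 s}"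
  have "\<forall>\<^sub>F s in at_bot. \<phi> s > \<alpha>" using lim_\<phi>(1) \<alpha>(2) by (rule order_tendstoD)
  then obtain S where S: "\<And>s. s \<le> S \<Longrightarrow> \<phi> s > \<alpha>" unfolding eventually_at_bot_linorder by blast
  have lb: "S \<le> r" if "r \<in> N" for r
  proof (rule ccontr)
    assume "\<not> S \<le> r"
    then have "\<phi>1 r < 0" by (intro \<phi>1_neg_while_above S) auto
    then show False using that by (simp add: N_def)
  qed
  have "s \<in> N" using \<open>\<not> \<phi>1 s < 0\<close> by (simp add: N_def)
  then have "N \<noteq> {}" by blast
  moreover have "bdd_below N" using lb by (auto simp: bdd_below_def)
  moreover have "closed N" unfolding N_def by (intro closed_Collect_le cont_\<phi>1 continuous_intros)
  ultimately have iN: "Inf N \<in> N" by (rule closed_contains_Inf)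
  define s1 where "s1 = Inf N"
  have neg: "\<phi>1 r < 0" if "r < s1" for r
  proof (rule ccontr)
    assume "\<not> \<phi>1 r < 0"
    then have "r \<in> N" by (simp add: N_def)
    then have "s1 \<le> r" unfolding s1_def using \<open>bdd_below N\<close> by (rule cInf_lower)
    then show False using that by simp
  qed
  have ge: "\<phi>1 s1 \<ge> 0" using iN by (simp add: N_def s1_def)
  show False
  proof (cases "\<phi> s1 > \<alpha>")
    case True
    have "\<phi> r > \<alpha>" if "r \<le> s1" for r
    proof (cases "r = s1")
      case False
      then have "r < s1" using that by simp
      from MVT2[OF this, of \<phi> \<phi>1] obtain z where "r < z" "z < s1" "\<phi> s1 - \<phi> r = (s1 - r) * \<phi>1 z"
        using d\<phi> by blast
      moreover have "(s1 - r) * \<phi>1 z < 0" using neg[of z] calculation by (intro mult_pos_neg) auto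
      ultimately show ?thesis using True by linarith
    qed (use True in simp)
    then have "\<phi>1 s1 < 0" by (rule \<phi>1_neg_while_above)
    then show False using ge by simp
  next
    case False
    have "(\<phi>1 \<longlongrightarrow> \<phi>1 s1) (at_left s1)"
      using DERIV_isCont[OF d\<phi>1[of s1]] unfolding isCont_def by (rule tendsto_within_subset) simp
    moreover have "\<forall>\<^sub>F r in at_left s1. \<phi>1 r \<le> 0"
      using neg by (auto simp: eventually_at_filter intro!: always_eventually less_imp_le)
    ultimately have "\<phi>1 s1 \<le> 0" by (rule tendsto_upperbound) simp
    then show False using ge \<phi>1_nonzero_below[of s1] False by simp
  qed
qed

section \<open>The transition layer and the subsolution inequality\<close>

lemma \<phi>_strict_antimono: "r < s \<Longrightarrow> \<phi> s < \<phi> r"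
  by (rule DERIV_neg_imp_decreasing) (assumption, intro exI conjI, rule d\<phi>, rule \<phi>1_neg)

lemma \<phi>_antimono: "r \<le> s \<Longrightarrow> \<phi> s \<le> \<phi> r"
  using \<phi>_strict_antimono[of r s] by (cases "r = s") auto

lemma \<phi>_near_0:
  assumes "\<epsilon> > 0" obtains Z where "Z \<ge> 0" "\<And>s. s \<ge> Z \<Longrightarrow> \<phi> s \<le> \<epsilon>"
proof -
  have "\<forall>\<^sub>F s in at_top. \<phi> s < \<epsilon>" using lim_\<phi>(2) assms by (rule order_tendstoD)
  then obtain Z where "\<And>s. s \<ge> Z \<Longrightarrow> \<phi> s < \<epsilon>" unfolding eventually_at_top_linorder by blast
  then show ?thesis using that[of "max 0 Z"] by (auto intro: less_imp_le)
qed

lemma \<phi>_near_1: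
  assumes "\<epsilon> > 0" obtains Z where "Z \<le> 0" "\<And>s. s \<le> Z \<Longrightarrow> \<phi> s \<ge> 1 - \<epsilon>"
proof -
  have "\<forall>\<^sub>F s in at_bot. \<phi> s > 1 - \<epsilon>" using lim_\<phi>(1) assms by (intro order_tendstoD) auto
  then obtain Z where "\<And>s. s \<le> Z \<Longrightarrow> \<phi> s > 1 - \<epsilon>" unfolding eventually_at_bot_linorder by blast
  then show ?thesis using that[of "min 0 Z"] by (auto intro: less_imp_le)
qed

text \<open>Intermediate values occur only on a compact interval, where the continuous function
  \<phi>' attains a negative maximum; if that interval is empty, any \<kappa> will do.\<close>

lemma \<phi>1_uniform:
  assumes "\<delta> > 0"
  obtains \<kappa> where "\<kappa> > 0" "\<And>s. \<delta> \<le> \<phi> s \<Longrightarrow> \<phi> s \<le> 1 - \<delta> \<Longrightarrow> \<phi>1 s \<le> - \<kappa>"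
proof -
  obtain Z0 where Z0: "\<And>s. s \<ge> Z0 \<Longrightarrow> \<phi> s \<le> \<delta> / 2" using \<phi>_near_0[of "\<delta> / 2"] assms by auto
  obtain Z1 where Z1: "\<And>s. s \<le> Z1 \<Longrightarrow> \<phi> s \<ge> 1 - \<delta> / 2" using \<phi>_near_1[of "\<delta> / 2"] assms by auto
  have sub: "s \<in> {Z1..Z0}" if "\<delta> \<le> \<phi> s" "\<phi> s \<le> 1 - \<delta>" for s
    using Z0[of s] Z1[of s] that assms by force
  show ?thesis
  proof (cases "Z1 \<le> Z0")
    case True
    then obtain x where x: "\<forall>s\<in>{Z1..Z0}. \<phi>1 s \<le> \<phi>1 x"
      using continuous_attains_sup[OF _ _ cont_\<phi>1, of "{Z1..Z0}"] by auto
    show ?thesis using that[of "- \<phi>1 x"] \<phi>1_neg[of x] x sub by simp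
  next
    case False
    then show ?thesis using that[of 1] sub by force
  qed
qed

text \<open>The condition under which \<open>\<phi>(\<zeta>) - q\<close> is a subsolution where it is positive; \<open>a\<close> stands for
  \<open>|\<nabla>\<zeta>|\<^sup>2\<close> and \<open>b\<close> for \<open>\<zeta>\<^sub>t - \<Delta>\<zeta>\<close>. The second half is for the flat part of an expanding ball, where
  \<open>|\<nabla>\<zeta>|\<close> is far from 1 but \<open>\<phi>(\<zeta>)\<close> is close to 1.\<close>
definition admissible_loss :: "real \<Rightarrow> bool" where
  "admissible_loss q \<longleftrightarrow>
     (\<exists>\<mu>>0. \<forall>a b s. q < \<phi> s \<longrightarrow> \<bar>a - 1\<bar> \<le> \<mu> \<longrightarrow> - c / 4 \<le> b \<longrightarrow>
        \<phi>1 s * b \<le> (- c * \<phi>1 s - f (\<phi> s)) * a + f (\<phi> s - q)) \<and>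
     (\<forall>D\<ge>0. \<exists>Z. \<forall>a b s. s \<le> Z \<longrightarrow> 0 \<le> a \<longrightarrow> a \<le> 1 \<longrightarrow> - D \<le> b \<longrightarrow>
        \<phi>1 s * b \<le> (- c * \<phi>1 s - f (\<phi> s)) * a + f (\<phi> s - q))"

text \<open>After rearranging, the claim is \<phi>' (b + c a) + f(\<phi>) (a - 1) + (f(\<phi>) -
  f(\<phi> - q)) \<le> 0. In the transition layer the first term gains \<kappa> c/2, which beats the
  other two, each at most \<kappa> c/8. Near the rest states \<phi>' gives nothing, but the last
  term is at most -\<beta> q.\<close>

lemma small_loss_admissible:
  obtains q0 where "q0 > 0" "\<And>q. 0 < q \<Longrightarrow> q \<le> q0 \<Longrightarrow> admissible_loss q"
proof -
  obtain \<delta> \<beta> where \<delta>: "\<delta> > 0" "\<delta> \<le> 1 / 8" and \<beta>: "\<beta> > 0"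
    and d0: "\<And>r s. 0 \<le> r \<Longrightarrow> r < s \<Longrightarrow> s \<le> 2 * \<delta> \<Longrightarrow> f s - f r \<le> - \<beta> * (s - r)"
    and d1: "\<And>r s. 1 - 2 * \<delta> \<le> r \<Longrightarrow> r < s \<Longrightarrow> s \<le> 1 \<Longrightarrow> f s - f r \<le> - \<beta> * (s - r)"
    using f_decreasing_at_ends by blast
  obtain \<kappa> where \<kappa>: "\<kappa> > 0" "\<And>s. \<delta> \<le> \<phi> s \<Longrightarrow> \<phi> s \<le> 1 - \<delta> \<Longrightarrow> \<phi>1 s \<le> - \<kappa>"
    using \<phi>1_uniform \<delta>(1) by blast
  obtain L where L: "L \<ge> 0" "\<And>r s. 0 \<le> r \<Longrightarrow> r \<le> 1 \<Longrightarrow> 0 \<le> s \<Longrightarrow> s \<le> 1 \<Longrightarrow> \<bar>f r - f s\<bar> \<le> L * \<bar>r - s\<bar>"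
    using f_lipschitz by blast
  obtain B where B: "B \<ge> 0" "\<And>r. 0 \<le> r \<Longrightarrow> r \<le> 1 \<Longrightarrow> \<bar>f r\<bar> \<le> B" using f_bound by blast
  define q0 where "q0 = min \<delta> (\<kappa> * c / 8 / (L + 1))"
  have q0: "q0 > 0" "q0 \<le> \<delta>" "L * q0 \<le> \<kappa> * c / 8"
  proof -
    show "q0 > 0" "q0 \<le> \<delta>" using \<delta> \<kappa> c L by (auto simp: q0_def)
    show "L * q0 \<le> \<kappa> * c / 8"
      using L \<open>q0 > 0\<close> by (intro mult_le_of_le_divide) (auto simp: q0_def)
  qed
  have near_1: "f (\<phi> s) - f (\<phi> s - q) \<le> - \<beta> * q" if "0 < q" "q \<le> q0" "\<phi> s \<ge> 1 - \<delta>" for q s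
    using d1[of "\<phi> s - q" "\<phi> s"] that q0 range_\<phi>(2)[of s] by simp
  have near_0: "f (\<phi> s) - f (\<phi> s - q) \<le> - \<beta> * q" if "0 < q" "q < \<phi> s" "\<phi> s \<le> \<delta>" for q s
    using d0[of "\<phi> s - q" "\<phi> s"] that \<delta> by simp
  show ?thesis
  proof (rule that[OF q0(1)], unfold admissible_loss_def, intro conjI allI impI)
    fix q assume q: "0 < q" "q \<le> q0"
    \<comment> \<open>\<mu> depends on q because near the rest states the only gain is \<beta> q.
      The bound 1/4 gives a \<ge> 3/4, hence b + c a \<ge> c/2.\<close>
    define \<mu> where "\<mu> = min (1 / 4) (min (\<beta> * q / (B + 1)) (\<kappa> * c / 8 / (B + 1)))"
    have \<mu>: "\<mu> > 0" "\<mu> \<le> 1 / 4" "B * \<mu> \<le> \<beta> * q" "B * \<mu> \<le> \<kappa> * c / 8"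
    proof -
      show "\<mu> > 0" using \<beta> q \<kappa> c B by (simp add: \<mu>_def)
      show "\<mu> \<le> 1 / 4" unfolding \<mu>_def by (rule min.cobounded1)
      note m = mult_le_of_le_divide[OF B(1) less_imp_le[OF \<open>\<mu> > 0\<close>]]
      show "B * \<mu> \<le> \<beta> * q" by (rule m) (simp add: \<mu>_def)
      have "\<mu> \<le> \<kappa> * c / 8 / (B + 1)" unfolding \<mu>_def by (simp only: min.coboundedI2 min.cobounded2)
      then show "B * \<mu> \<le> \<kappa> * c / 8" by (rule m)
    qed
    show "\<exists>\<mu>>0. \<forall>a b s. q < \<phi> s \<longrightarrow> \<bar>a - 1\<bar> \<le> \<mu> \<longrightarrow> - c / 4 \<le> b \<longrightarrow>
        \<phi>1 s * b \<le> (- c * \<phi>1 s - f (\<phi> s)) * a + f (\<phi> s - q)"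
    proof (intro exI[of _ \<mu>] conjI \<mu>(1) allI impI)
      fix a b s assume s: "q < \<phi> s" and a: "\<bar>a - 1\<bar> \<le> \<mu>" and b: "- c / 4 \<le> b"
      have "f (\<phi> s) * (a - 1) \<le> \<bar>f (\<phi> s)\<bar> * \<bar>a - 1\<bar>" by (metis abs_ge_self abs_mult)
      also have "\<dots> \<le> B * \<mu>" using B(2)[of "\<phi> s"] range_\<phi>[of s] a B(1) by (intro mult_mono) auto
      finally have fa: "f (\<phi> s) * (a - 1) \<le> B * \<mu>" .
      have "c * a \<ge> c * (3 / 4)" using a \<mu>(2) c by (intro mult_left_mono) auto
      then have ba: "b + c * a \<ge> c / 2" using b by simp
      have "\<phi>1 s * (b + c * a) + f (\<phi> s) * (a - 1) + (f (\<phi> s) - f (\<phi> s - q)) \<le> 0"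
      proof (cases "\<delta> \<le> \<phi> s \<and> \<phi> s \<le> 1 - \<delta>")
        case True
        then have "\<kappa> * (c / 2) \<le> - \<phi>1 s * (b + c * a)"
          using \<kappa>(2)[of s] \<kappa>(1) ba c by (intro mult_mono) auto
        moreover have "f (\<phi> s) - f (\<phi> s - q) \<le> L * q"
          using L(2)[of "\<phi> s" "\<phi> s - q"] range_\<phi>[of s] s q by auto
        moreover have "L * q \<le> L * q0" using L q by (intro mult_left_mono) auto
        moreover have "\<kappa> * c > 0" using \<kappa> c by simp
        ultimately show ?thesis using fa \<mu>(4) q0(3) by simp
      next
        case False
        then have "f (\<phi> s) - f (\<phi> s - q) \<le> - \<beta> * q" using near_0[of q s] near_1[of q s] s q by force
        moreover have "\<phi>1 s * (b + c * a) \<le> 0"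
          using \<phi>1_neg[of s] ba c by (intro mult_nonpos_nonneg) auto
        ultimately show ?thesis using fa \<mu>(3) by simp
      qed
      then show "\<phi>1 s * b \<le> (- c * \<phi>1 s - f (\<phi> s)) * a + f (\<phi> s - q)" by (simp add: algebra_simps)
    qed
  next
    fix q D assume q: "0 < q" "q \<le> q0" and D: "0 \<le> (D::real)"
    \<comment> \<open>Far behind the front \<phi>' is so small that any bounded \<open>b\<close>
      costs at most \<beta> q, and f(\<phi>) \<ge> 0 turns a \<le> 1 into an advantage.\<close>
    obtain Z1 where Z1: "\<And>s. s \<le> Z1 \<Longrightarrow> \<phi> s \<ge> 1 - \<delta>" using \<phi>_near_1[OF \<delta>(1)] by auto
    have "\<beta> * q / (D + 1) > 0" using \<beta> q D by simp
    then obtain Z2 where Z2: "\<And>s. s \<le> Z2 \<Longrightarrow> \<bar>\<phi>1 s\<bar> \<le> \<beta> * q / (D + 1)" using \<phi>1_at_bot by blast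
    show "\<exists>Z. \<forall>a b s. s \<le> Z \<longrightarrow> 0 \<le> a \<longrightarrow> a \<le> 1 \<longrightarrow> - D \<le> b \<longrightarrow>
        \<phi>1 s * b \<le> (- c * \<phi>1 s - f (\<phi> s)) * a + f (\<phi> s - q)"
    proof (intro exI[of _ "min Z1 Z2"] allI impI)
      fix a b s :: real assume s: "s \<le> min Z1 Z2" and a: "0 \<le> a" "a \<le> 1" and b: "- D \<le> b"
      have phi: "\<phi> s \<ge> 1 - \<delta>" and phi1: "\<bar>\<phi>1 s\<bar> \<le> \<beta> * q / (D + 1)" using s Z1 Z2 by auto
      have "- \<phi>1 s * (- b) \<le> - \<phi>1 s * D" using \<phi>1_neg[of s] b by (intro mult_left_mono) auto
      also have "\<dots> = \<bar>\<phi>1 s\<bar> * D" using \<phi>1_neg[of s] by simp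
      also have "\<dots> \<le> \<beta> * q / (D + 1) * (D + 1)" using phi1 D \<beta> q by (intro mult_mono) auto
      also have "\<dots> = \<beta> * q" using D by simp
      finally have "\<phi>1 s * b \<le> \<beta> * q" by simp
      moreover have "\<phi>1 s * (c * a) \<le> 0" using \<phi>1_neg[of s] c a by (intro mult_nonpos_nonneg) auto
      moreover have "f (\<phi> s) - f (\<phi> s - q) \<le> - \<beta> * q" using near_1 q phi by blast
      moreover have "\<beta> * (1 - \<phi> s) \<ge> 0" using \<beta> range_\<phi>(2)[of s] by simp
      then have "f (\<phi> s) \<ge> 0"
        using d1[of "\<phi> s" 1] phi range_\<phi>(2)[of s] \<delta> f_one by simp
      then have "f (\<phi> s) * (a - 1) \<le> 0" using a by (intro mult_nonneg_nonpos) auto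
      ultimately show "\<phi>1 s * b \<le> (- c * \<phi>1 s - f (\<phi> s)) * a + f (\<phi> s - q)" by (simp add: algebra_simps)
    qed
  qed
qed

end

section \<open>Entire solutions outside a wall\<close>

text \<open>A classical solution here has partial derivatives that are differentiable at each point,
  with no continuity of second derivatives. This is enough: the components of the gradient are these
  partial derivatives, so the gradient itself is differentiable.\<close>

lemma has_jet_frechet:
  fixes h :: "'a::euclidean_space \<Rightarrow> real"
  assumes \<Omega>: "open \<Omega>" "x \<in> \<Omega>" and h: "\<And>z. z \<in> \<Omega> \<Longrightarrow> h differentiable (at z)"
    and h2: "\<And>b. b \<in> Basis \<Longrightarrow> (\<lambda>z. frechet_derivative h (at z) b) differentiable (at x)"
  obtains G H where "has_jet h G H x" "tr H = lap h x"
proof -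
  define G where "G z = (\<Sum>b\<in>Basis. frechet_derivative h (at z) b *\<^sub>R b)" for z
  define H where "H k = (\<Sum>b\<in>Basis. frechet_derivative (\<lambda>z. frechet_derivative h (at z) b) (at x) k *\<^sub>R b)" for k
  have "(h has_derivative (\<lambda>k. G z \<bullet> k)) (at z)" if "z \<in> \<Omega>" for z
  proof -
    have d: "(h has_derivative frechet_derivative h (at z)) (at z)"
      using h[OF that] by (simp add: frechet_derivative_works)
    then have lin: "linear (frechet_derivative h (at z))"
      by (meson has_derivative_bounded_linear bounded_linear.linear)
    have "frechet_derivative h (at z) k = G z \<bullet> k" for k
    proof -
      have "frechet_derivative h (at z) k = frechet_derivative h (at z) (\<Sum>b\<in>Basis. (k \<bullet> b) *\<^sub>R b)"
        by (simp add: euclidean_representation)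
      also have "\<dots> = (\<Sum>b\<in>Basis. (k \<bullet> b) * frechet_derivative h (at z) b)"
        using lin by (simp add: linear_sum linear_scale)
      also have "\<dots> = G z \<bullet> k"
        unfolding G_def by (simp add: inner_sum_left inner_commute[of k] mult.commute)
      finally show ?thesis .
    qed
    then show ?thesis using d by (simp add: ext[of "frechet_derivative h (at z)" "\<lambda>k. G z \<bullet> k"])
  qed
  then have "\<forall>\<^sub>F z in nhds x. (h has_derivative (\<lambda>k. G z \<bullet> k)) (at z)"
    using eventually_nhds_in_open[OF \<Omega>] by (rule eventually_mono[rotated])
  moreover have "(G has_derivative H) (at x)"
    unfolding G_def H_def using h2 by (auto intro!: derivative_intros simp: frechet_derivative_works)
  moreover have "tr H = lap h x"
    unfolding tr_def lap_def H_def by (intro sum.cong) (auto simp: inner_sum_left inner_Basis if_distrib cong: if_cong)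
  ultimately show ?thesis using that unfolding has_jet_def by blast
qed

text \<open>By the mean value theorem a difference quotient at 0 is a derivative at an interior
  point. This converts the Neumann condition, stated as a limit from inside, into a derivative at
  the boundary point.\<close>

lemma right_derivative_from_limit:
  fixes h h' :: "real \<Rightarrow> real"
  assumes e: "e > 0" and cont: "continuous_on {0..<e} h"
    and d: "\<And>s. 0 < s \<Longrightarrow> s < e \<Longrightarrow> (h has_real_derivative h' s) (at s)"
    and lim: "(h' \<longlongrightarrow> l) (at_right 0)"
  shows "(h has_real_derivative l) (at_right 0)"
  unfolding has_field_derivative_iff
proof (rule tendstoI)
  fix \<epsilon> :: real assume \<epsilon>: "\<epsilon> > 0"
  obtain d0 where d0: "d0 > 0" "\<And>s. 0 < s \<Longrightarrow> s < d0 \<Longrightarrow> dist (h' s) l < \<epsilon>"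
    using tendstoD[OF lim \<epsilon>] unfolding eventually_at_right_field by auto
  have "\<forall>\<^sub>F s in at_right (0::real). s \<in> {0<..<min e d0}"
    using eventually_at_right_real[of 0 "min e d0"] e d0 by simp
  then show "\<forall>\<^sub>F s in at_right 0. dist ((h s - h 0) / (s - 0)) l < \<epsilon>"
  proof eventually_elim
    case (elim s)
    then have s: "0 < s" "s < e" "s < d0" by auto
    have c: "continuous_on {0..s} h" using cont by (rule continuous_on_subset) (use s in auto)
    have "h differentiable (at r)" if "0 < r" "r < s" for r
      using d[of r] that s by (auto simp: real_differentiable_def)
    from MVT[OF s(1) c this] obtain l' z where z: "0 < z" "z < s" "DERIV h z :> l'" "h s - h 0 = (s - 0) * l'"
      by blast
    have "l' = h' z" using z(3) d[of z] z s DERIV_unique by fastforce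
    then show ?case using z d0(2)[of z] s by simp
  qed
qed

lemma wall_frontier:
  assumes "wall M K \<rho> g" and x: "x \<in> frontier K"
  shows "\<rho> x = 0"
proof (rule ccontr)
  assume "\<rho> x \<noteq> 0"
  have K: "closed K" "K = {x. \<rho> x \<le> 0}" and d: "\<And>x. (\<rho> has_derivative (\<lambda>h. g x \<bullet> h)) (at x)"
    using assms(1) unfolding wall_def by blast+
  have "continuous_on UNIV \<rho>"
    by (intro continuous_at_imp_continuous_on ballI has_derivative_continuous[OF d])
  then have o: "open (\<rho> -` {..<0})" by (intro open_vimage) auto
  have sub: "\<rho> -` {..<0} \<subseteq> K" using K(2) by auto
  have "x \<in> K" using frontier_subset_closed[OF K(1)] x by (rule subsetD)
  then have "x \<in> \<rho> -` {..<0}" using K(2) \<open>\<rho> x \<noteq> 0\<close> by auto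
  from interiorI[OF o this sub] have "x \<in> interior K" .
  then show False using x by (simp add: frontier_def)
qed

text \<open>\<eta> adds to \<open>bump\<close> a decreasing bounded function of \<rho>. Bounded
  curvature of \<rho> keeps the Laplacian under control, and on the boundary the second part has
  gradient -A g. With A = 2/\<delta> and |g| \<ge> \<delta> it outweighs the slope of
  \<open>bump\<close>, which is at most 1: |g| - A |g|^2 < 0.\<close>

lemma wall_penalty:
  fixes K :: "(real \<times> (real^'m)) set"
  assumes wl: "wall M K \<rho> g"
  obtains \<eta> X C1 where "\<And>x. \<eta> x \<ge> 1" "\<And>x. \<eta> x \<ge> norm x"
    "\<And>x. \<exists>H. has_jet \<eta> X H x \<and> \<bar>tr H\<bar> \<le> C1" "\<And>x. norm (X x) \<le> C1"
    "\<And>x. x \<in> frontier K \<Longrightarrow> g x \<bullet> X x < 0"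
proof -
  let ?N = "real DIM(real \<times> (real^'m))"
  have d\<rho>: "\<And>x. (\<rho> has_derivative (\<lambda>h. g x \<bullet> h)) (at x)" using wl unfolding wall_def by blast
  obtain H B where dg: "\<And>x. (g has_derivative H x) (at x)" and B: "\<And>x. onorm (H x) \<le> B"
    using wl unfolding wall_def by blast
  obtain \<delta> where \<delta>: "\<delta> > 0" "\<And>x. \<rho> x = 0 \<Longrightarrow> norm (g x) \<ge> \<delta>" using wl unfolding wall_def by blast
  have "bounded (range g)" using wl unfolding wall_def by blast
  then obtain g0 where g0: "\<And>x. norm (g x) \<le> g0" unfolding bounded_iff by blast
  have g0': "g0 \<ge> 0" by (rule order_trans[OF norm_ge_zero g0[of 0]])
  have B0: "B \<ge> 0"
    by (rule order_trans[OF onorm_pos_le[OF has_derivative_bounded_linear[OF dg]] B[of 0]])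
  define A where "A = 2 / \<delta>"
  have A: "A > 0" using \<delta> by (simp add: A_def)
  \<comment> \<open>The constant A pi/2 makes the arctan part positive, so \<eta> stays above
    \<open>bump\<close>; it is written as an affine function to fit the sum rule for jets.\<close>
  define \<eta> where "\<eta> z = bump z + ((-A) * arctan (\<rho> z) + (0 \<bullet> z + A * (pi / 2)))" for z
  define X where "X z = z /\<^sub>R bump z + ((-A) *\<^sub>R (inverse (1 + (\<rho> z)\<^sup>2) *\<^sub>R g z) + 0)" for z
  \<comment> \<open>The sum of a bound for the Laplacian and a bound for the gradient, so that each
    is dominated.\<close>
  define C1 where "C1 = ?N + 1 + A * (?N * B + g0\<^sup>2) + (1 + A * g0)"
  have inv1: "\<bar>inverse (1 + s\<^sup>2)\<bar> \<le> 1" for s :: real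
    by (simp add: inverse_eq_divide divide_le_eq add_pos_nonneg)
  show ?thesis
  proof (rule that[of \<eta> X C1])
    fix x
    have "\<eta> x \<ge> bump x"
    proof -
      have "A * (pi / 2 - arctan (\<rho> x)) \<ge> 0" using A arctan_ubound[of "\<rho> x"] by simp
      then show ?thesis by (simp add: \<eta>_def algebra_simps)
    qed
    then show "\<eta> x \<ge> 1" "\<eta> x \<ge> norm x" using bump_ge[of x] by auto
    have "norm (X x) \<le> norm (x /\<^sub>R bump x) + norm ((-A) *\<^sub>R (inverse (1 + (\<rho> x)\<^sup>2) *\<^sub>R g x))"
      unfolding X_def add_0_right by (rule norm_triangle_ineq)
    also have "norm (x /\<^sub>R bump x) \<le> 1"
      using bump_ge[of x] by (simp add: divide_inverse[symmetric] divide_le_eq mult.commute[of "inverse _"])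
    also have "norm ((-A) *\<^sub>R (inverse (1 + (\<rho> x)\<^sup>2) *\<^sub>R g x)) = A * (\<bar>inverse (1 + (\<rho> x)\<^sup>2)\<bar> * norm (g x))"
      using A by (simp add: abs_mult)
    also have "\<dots> \<le> A * (1 * g0)" using A inv1 g0 by (intro mult_left_mono mult_mono) auto
    finally have "norm (X x) \<le> 1 + A * g0" by simp
    moreover have "0 \<le> ?N + 1 + A * (?N * B + g0\<^sup>2)" using A B0 by simp
    ultimately show "norm (X x) \<le> C1" unfolding C1_def by linarith
    obtain Hb where Hb: "has_jet bump (\<lambda>z. z /\<^sub>R bump z) Hb x"
      "tr Hb = ?N / bump x - (norm x)\<^sup>2 / (bump x)^3" using bump_jet by blast
    have j\<rho>: "has_jet \<rho> g (H x) x" unfolding has_jet_def using d\<rho> dg by (auto intro: always_eventually)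
    let ?F1 = "\<lambda>s. inverse (1 + s\<^sup>2)" and ?F2 = "- 2 * \<rho> x / (1 + (\<rho> x)\<^sup>2)\<^sup>2"
    have ne: "1 + s\<^sup>2 \<noteq> 0" for s :: real using zero_le_power2[of s] by linarith
    have F1: "(?F1 has_real_derivative ?F2) (at (\<rho> x))"
      using ne[of "\<rho> x"] by (auto intro!: derivative_eq_intros simp: power2_eq_square field_simps)
    have F: "\<forall>\<^sub>F s in nhds (\<rho> x). (arctan has_real_derivative ?F1 s) (at s)"
      by (auto intro!: always_eventually DERIV_arctan)
    let ?Ha = "\<lambda>k. ?F1 (\<rho> x) *\<^sub>R H x k + (?F2 * (g x \<bullet> k)) *\<^sub>R g x"
    have "has_jet \<eta> X (\<lambda>k. Hb k + ((-A) *\<^sub>R ?Ha k + 0)) x"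
      unfolding \<eta>_def[abs_def] X_def[abs_def]
      by (intro has_jet_add Hb has_jet_scale has_jet_compose[OF j\<rho> F F1] has_jet_affine)
    moreover have "\<bar>tr (\<lambda>k. Hb k + ((-A) *\<^sub>R ?Ha k + 0))\<bar> \<le> C1"
    proof -
      have "tr (\<lambda>k. Hb k + ((-A) *\<^sub>R ?Ha k + 0)) = tr Hb - A * (?F1 (\<rho> x) * tr (H x) + ?F2 * (norm (g x))\<^sup>2)"
      proof -
        have "tr (\<lambda>k. Hb k + ((-A) *\<^sub>R ?Ha k + 0)) = tr Hb + ((-A) * tr ?Ha + 0)"
          by (simp only: tr_add[of Hb] tr_add[of "\<lambda>k. (-A) *\<^sub>R ?Ha k"] tr_scale[of _ ?Ha] tr_zero)
        then show ?thesis unfolding tr_compose by simp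
      qed
      moreover have "\<bar>tr Hb\<bar> \<le> ?N + 1"
      proof -
        have "0 \<le> ?N / bump x" "?N / bump x \<le> ?N"
          using bump_ge[of x] by (auto simp: divide_le_eq mult_le_cancel_left1)
        moreover have "(norm x)\<^sup>2 * 1 \<le> (bump x)\<^sup>2 * bump x"
          using bump_ge[of x] by (intro mult_mono power_mono) auto
        then have "(norm x)\<^sup>2 \<le> (bump x)^3" by (simp add: power3_eq_cube power2_eq_square)
        then have "0 \<le> (norm x)\<^sup>2 / (bump x)^3" "(norm x)\<^sup>2 / (bump x)^3 \<le> 1"
          using bump_ge[of x] by (auto simp: divide_le_eq)
        ultimately show ?thesis using Hb(2) by linarith
      qed
      moreover have "\<bar>?F1 (\<rho> x) * tr (H x)\<bar> \<le> ?N * B"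
      proof -
        have "\<bar>H x b \<bullet> b\<bar> \<le> B" if "b \<in> Basis" for b
        proof -
          have "\<bar>H x b \<bullet> b\<bar> \<le> norm (H x b)" using that by (rule Basis_le_norm)
          also have "\<dots> \<le> onorm (H x) * norm b" by (rule onorm[OF has_derivative_bounded_linear[OF dg]])
          finally show ?thesis using B[of x] that by simp
        qed
        then have "\<bar>tr (H x)\<bar> \<le> (\<Sum>b\<in>(Basis::(real \<times> (real^'m)) set). B)"
          unfolding tr_def by (intro order_trans[OF sum_abs] sum_mono)
        then have "\<bar>tr (H x)\<bar> \<le> ?N * B" by simp
        then have "\<bar>?F1 (\<rho> x)\<bar> * \<bar>tr (H x)\<bar> \<le> 1 * (?N * B)" using inv1 by (intro mult_mono) auto
        then show ?thesis by (simp add: abs_mult)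
      qed
      moreover have "\<bar>?F2 * (norm (g x))\<^sup>2\<bar> \<le> g0\<^sup>2"
      proof -
        have "\<bar>\<rho> x\<bar> * 2 \<le> 1 + (\<rho> x)\<^sup>2"
          using zero_le_power2[of "\<bar>\<rho> x\<bar> - 1"] by (simp add: power2_diff)
        also have "\<dots> \<le> (1 + (\<rho> x)\<^sup>2)\<^sup>2" by (rule self_le_power) auto
        finally have "\<bar>?F2\<bar> \<le> 1" using ne[of "\<rho> x"] by (simp add: abs_mult divide_le_eq)
        then have "\<bar>?F2\<bar> * (norm (g x))\<^sup>2 \<le> 1 * g0\<^sup>2"
          using g0[of x] by (intro mult_mono power_mono) auto
        then show ?thesis by (simp only: abs_mult abs_power2 mult_1_left)
      qed
      ultimately have t: "tr (\<lambda>k. Hb k + ((-A) *\<^sub>R ?Ha k + 0)) = tr Hb - A * (?F1 (\<rho> x) * tr (H x) + ?F2 * (norm (g x))\<^sup>2)"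
        and t1: "\<bar>tr Hb\<bar> \<le> ?N + 1"
        and t2: "\<bar>?F1 (\<rho> x) * tr (H x) + ?F2 * (norm (g x))\<^sup>2\<bar> \<le> ?N * B + g0\<^sup>2" by (linarith+)
      have "\<bar>A * (?F1 (\<rho> x) * tr (H x) + ?F2 * (norm (g x))\<^sup>2)\<bar> \<le> A * (?N * B + g0\<^sup>2)"
        using t2 A by (simp add: abs_mult)
      moreover have "0 \<le> 1 + A * g0" using A g0' by simp
      ultimately show ?thesis unfolding t C1_def using t1 by linarith
    qed
    ultimately show "\<exists>H. has_jet \<eta> X H x \<and> \<bar>tr H\<bar> \<le> C1" by blast
  next
    fix x assume "x \<in> frontier K"
    then have \<rho>0: "\<rho> x = 0" by (rule wall_frontier[OF wl])
    have n: "norm (g x) \<ge> \<delta>" by (rule \<delta>(2)[OF \<rho>0])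
    have "g x \<bullet> (x /\<^sub>R bump x) \<le> norm (g x) * norm (x /\<^sub>R bump x)" by (rule norm_cauchy_schwarz)
    also have "\<dots> \<le> norm (g x) * 1"
      using bump_ge[of x] by (intro mult_left_mono)
        (auto simp: divide_inverse[symmetric] divide_le_eq mult.commute[of "inverse _"])
    finally have "g x \<bullet> X x \<le> norm (g x) - A * (norm (g x))\<^sup>2"
      by (simp add: X_def \<rho>0 inner_add_right inner_diff_right dot_square_norm)
    also have "\<dots> = norm (g x) * (1 - A * norm (g x))" by (simp add: power2_eq_square algebra_simps)
    also have "\<dots> < 0"
    proof (rule mult_pos_neg)
      show "norm (g x) > 0" using n \<delta> by linarith
      have "A * norm (g x) \<ge> A * \<delta>" using n A by (intro mult_left_mono) auto
      moreover have "A * \<delta> = 2" using \<delta> by (simp add: A_def)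
      ultimately show "1 - A * norm (g x) < 0" by simp
    qed
    finally show "g x \<bullet> X x < 0" .
  qed
qed

text \<open>The direction \<open>g\<close> enters the domain because \<rho> grows along it at rate
  |g|^2 > 0; the strict bounds inside become weak ones on the closure by continuity.\<close>

lemma neumann_problem_entire_solution:
  fixes K :: "(real \<times> (real^'m)) set"
  assumes wl: "wall M K \<rho> g" and sol: "entire_solution f K g u"
    and bounds: "\<And>t x. x \<in> - K \<Longrightarrow> 0 < u t x \<and> u t x < 1"
    and L: "L \<ge> 0" "\<And>r s. 0 \<le> r \<Longrightarrow> r \<le> 1 \<Longrightarrow> 0 \<le> s \<Longrightarrow> s \<le> 1 \<Longrightarrow> \<bar>f r - f s\<bar> \<le> L * \<bar>r - s\<bar>"
  obtains \<eta> X C1 where "neumann_problem (- K) g X \<eta> f u L C1"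
proof -
  obtain \<eta> X C1 where \<eta>: "\<And>x. \<eta> x \<ge> 1" "\<And>x. \<eta> x \<ge> norm x"
    "\<And>x. \<exists>H. has_jet \<eta> X H x \<and> \<bar>tr H\<bar> \<le> C1" "\<And>x. norm (X x) \<le> C1"
    "\<And>x. x \<in> frontier K \<Longrightarrow> g x \<bullet> X x < 0"
    using wall_penalty[OF wl] by blast
  have K: "closed K" "K = {x. \<rho> x \<le> 0}" and d\<rho>: "\<And>x. (\<rho> has_derivative (\<lambda>h. g x \<bullet> h)) (at x)"
    using wl unfolding wall_def by blast+
  have op: "open (- K)" using K(1) by (simp add: open_Compl)
  have cont: "continuous_on (UNIV \<times> closure (- K)) (\<lambda>(t, x). u t x)"
    and diff: "\<And>t x. x \<in> - K \<Longrightarrow> (\<lambda>s. u s x) differentiable (at t)"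
      "\<And>t x. x \<in> - K \<Longrightarrow> u t differentiable (at x)"
      "\<And>t x b. x \<in> - K \<Longrightarrow> b \<in> Basis \<Longrightarrow> (\<lambda>z. frechet_derivative (u t) (at z) b) differentiable (at x)"
    and eq: "\<And>t x. x \<in> - K \<Longrightarrow> deriv (\<lambda>s. u s x) t = lap (u t) x + f (u t x)"
    and neu: "\<And>t x. x \<in> frontier K \<Longrightarrow>
      ((\<lambda>z. frechet_derivative (u t) (at z) (g x)) \<longlongrightarrow> 0) (at x within - K)"
    using sol unfolding entire_solution_def by auto
  have contt: "continuous_on (closure (- K)) (u t)" for t
    by (rule continuous_on_compose2[OF cont, of "closure (- K)" "\<lambda>x. (t, x)", simplified])
      (auto intro!: continuous_intros)
  have inw: "\<forall>\<^sub>F s in at_right 0. x + s *\<^sub>R g x \<in> - K" if x: "x \<in> frontier K" for x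
  proof -
    have \<rho>0: "\<rho> x = 0" by (rule wall_frontier[OF wl x])
    have "norm (g x) > 0" using wl \<rho>0 unfolding wall_def by (meson less_le_trans)
    have "((\<lambda>s. x + s *\<^sub>R g x) has_derivative (\<lambda>s. s *\<^sub>R g x)) (at 0)"
      by (auto intro!: derivative_eq_intros)
    from has_derivative_compose[OF this d\<rho>]
    have "((\<lambda>s. \<rho> (x + s *\<^sub>R g x)) has_real_derivative g x \<bullet> g x) (at 0)"
      by (simp add: has_field_derivative_def mult.commute[of _ "g x \<bullet> g x"])
    from DERIV_pos_inc_right[OF this] \<open>norm (g x) > 0\<close>
    obtain d where d: "d > 0" "\<And>s. 0 < s \<Longrightarrow> s < d \<Longrightarrow> \<rho> (x + s *\<^sub>R g x) > 0"
      using \<rho>0 by auto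
    show ?thesis
      using eventually_at_right_real[OF d(1)] by eventually_elim (use d(2) K(2) in force)
  qed
  have neu': "((\<lambda>s. u t (x + s *\<^sub>R g x)) has_real_derivative 0) (at_right 0)" if x: "x \<in> frontier K" for t x
  proof -
    obtain e where e: "e > 0" "\<And>s. 0 < s \<Longrightarrow> s < e \<Longrightarrow> x + s *\<^sub>R g x \<in> - K"
      using inw[OF x] unfolding eventually_at_right_field by auto
    have xc: "x \<in> closure (- K)" using x by (simp add: frontier_closures)
    have xK: "x \<in> K" using frontier_subset_closed[OF K(1)] x by (rule subsetD)
    show ?thesis
    proof (rule right_derivative_from_limit[OF e(1),
          where h' = "\<lambda>s. frechet_derivative (u t) (at (x + s *\<^sub>R g x)) (g x)"])
      show "continuous_on {0..<e} (\<lambda>s. u t (x + s *\<^sub>R g x))"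
      proof (rule continuous_on_compose2[OF contt])
        show "(\<lambda>s. x + s *\<^sub>R g x) ` {0..<e} \<subseteq> closure (- K)"
        proof (rule image_subsetI)
          fix s assume "s \<in> {0..<e}"
          then show "x + s *\<^sub>R g x \<in> closure (- K)"
            using e(2)[of s] xc closure_subset[of "- K"] by (cases "s = 0") auto
        qed
      qed (intro continuous_intros)
      show "((\<lambda>s. u t (x + s *\<^sub>R g x)) has_real_derivative
          frechet_derivative (u t) (at (x + s *\<^sub>R g x)) (g x)) (at s)" if "0 < s" "s < e" for s
      proof -
        have l: "((\<lambda>s. x + s *\<^sub>R g x) has_derivative (\<lambda>s. s *\<^sub>R g x)) (at s)"
          by (auto intro!: derivative_eq_intros)
        have d: "(u t has_derivative frechet_derivative (u t) (at (x + s *\<^sub>R g x))) (at (x + s *\<^sub>R g x))"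
          using diff(2)[OF e(2)[OF that]] by (simp add: frechet_derivative_works)
        have lin: "linear (frechet_derivative (u t) (at (x + s *\<^sub>R g x)))"
          using d by (meson has_derivative_bounded_linear bounded_linear.linear)
        show ?thesis using has_derivative_compose[OF l d] lin
          by (simp add: has_field_derivative_def linear_scale mult_commute_abs)
      qed
      have "((\<lambda>s. x + s *\<^sub>R g x) \<longlongrightarrow> x + 0 *\<^sub>R g x) (at_right 0)" by (intro tendsto_intros)
      moreover have "\<forall>\<^sub>F s in at_right 0. x + s *\<^sub>R g x \<in> - K \<and> x + s *\<^sub>R g x \<noteq> x"
        using inw[OF x] by eventually_elim (use xK in auto)
      ultimately have "filterlim (\<lambda>s. x + s *\<^sub>R g x) (at x within - K) (at_right 0)"
        by (simp add: filterlim_at)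
      then show "((\<lambda>s. frechet_derivative (u t) (at (x + s *\<^sub>R g x)) (g x)) \<longlongrightarrow> 0) (at_right 0)"
        by (rule filterlim_compose[OF neu[OF x]])
    qed
  qed
  have fr: "frontier (- K) = frontier K" by (simp add: frontier_complement)
  have eqn: "\<exists>G H. has_jet (u t) G H x \<and> ((\<lambda>s. u s x) has_real_derivative tr H + f (u t x)) (at t)"
    if x: "x \<in> - K" for t x
  proof -
    obtain G H where GH: "has_jet (u t) G H x" "tr H = lap (u t) x"
      by (rule has_jet_frechet[OF op x diff(2) diff(3)[OF x]])
    have "((\<lambda>s. u s x) has_real_derivative deriv (\<lambda>s. u s x) t) (at t)"
      using diff(1)[OF x, of t] by (simp add: DERIV_deriv_iff_real_differentiable)
    then show ?thesis using GH eq[OF x] by metis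
  qed
  have rng: "0 \<le> u t x \<and> u t x \<le> 1" if "x \<in> closure (- K)" for t x
  proof -
    have "u t ` closure (- K) \<subseteq> {0..1}"
      by (rule image_closure_subset[OF contt]) (use less_imp_le[OF conjunct1[OF bounds]] less_imp_le[OF conjunct2[OF bounds]] in force)+
    then show ?thesis using that by auto
  qed
  have "neumann_problem (- K) g X \<eta> f u L C1"
    by (unfold_locales; (unfold fr)?; (assumption | rule op L cont eqn rng inw neu' \<eta>)+)
  then show ?thesis by (rule that)
qed

section \<open>Invasion\<close>

lemma finite_net:
  fixes S :: "'x::metric_space set"
  assumes "compact S" "d > 0"
  obtains P where "finite P" "P \<subseteq> S" "\<And>x. x \<in> S \<Longrightarrow> \<exists>p\<in>P. dist p x < d"
proof -
  obtain P where P: "P \<subseteq> S" "finite P" and cov: "S \<subseteq> (\<Union>p\<in>P. ball p d)"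
    by (rule compactE_image[OF assms(1), of S "\<lambda>p. ball p d"]) (use assms(2) in auto)
  have "\<exists>p\<in>P. dist p x < d" if "x \<in> S" for x using subsetD[OF cov that] by simp
  then show ?thesis by (rule that[OF P(2,1)])
qed

lemma fst_inner: "fst x = (1, 0) \<bullet> (x :: real \<times> 'b::euclidean_space)"
  by (cases x) simp

text \<open>The wall enters only through the slab containing it and the sign of the first component
  of \<open>g\<close> on either side of x1 = a; directional convexity is needed for nothing but
  these signs.\<close>

locale wall_invasion =
  neumann_problem \<Omega> g X \<eta> f u L C1 + bistable_wave f f' \<alpha> c \<phi> \<phi>1
  for \<Omega> :: "(real \<times> 'b::euclidean_space) set" and g X :: "real \<times> 'b \<Rightarrow> real \<times> 'b"
    and \<eta> f u L C1 f' \<alpha> c \<phi> \<phi>1 +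
  fixes M a :: real and v :: "real \<times> 'b \<Rightarrow> real"
  assumes M: "M > 0"
    and outside: "\<And>x. fst x < 0 \<or> fst x > M \<Longrightarrow> x \<in> \<Omega>"
    and normal_right: "\<And>x. x \<in> frontier \<Omega> \<Longrightarrow> fst x > a \<Longrightarrow> fst (g x) \<ge> 0"
    and normal_left: "\<And>x. x \<in> frontier \<Omega> \<Longrightarrow> fst x < a \<Longrightarrow> fst (g x) \<le> 0"
    and past: "\<And>\<epsilon>. \<epsilon> > 0 \<Longrightarrow> \<exists>T. \<forall>t\<le>T. \<forall>x\<in>\<Omega>. \<bar>u t x - \<phi> (fst x - c * t)\<bar> < \<epsilon>"
    and lim_v: "\<And>x. x \<in> \<Omega> \<Longrightarrow> ((\<lambda>t. u t x) \<longlongrightarrow> v x) at_top"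
    and propagation: "\<And>y. ((\<lambda>s. v (s, y)) \<longlongrightarrow> 1) at_top"
begin

lemma frontier_not_in: "x \<in> frontier \<Omega> \<Longrightarrow> x \<notin> \<Omega>"
  using open_domain by (simp add: frontier_def interior_open)

lemma in_closure: "x \<in> \<Omega> \<Longrightarrow> x \<in> closure \<Omega>"
  using closure_subset by blast

text \<open>The subsolution is 1 - \<epsilon> minus an exponential in x1 that moves left at speed 1
  + L: its Laplacian costs one unit and the Lipschitz bound on \<open>f\<close> costs L. It is
  positive only for x1 < 0, so it never meets the wall. The bound \<open>B\<close> may depend on T,
  since a single starting time is needed later.\<close>

lemma left_persistence:
  assumes \<epsilon>: "0 < \<epsilon>" "\<epsilon> < 1 - \<alpha>"
  obtains B where "\<And>x. fst x \<le> - B \<Longrightarrow> 1 - 2 * \<epsilon> \<le> u T x"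
proof -
  obtain T' where T': "\<And>t x. t \<le> T' \<Longrightarrow> x \<in> \<Omega> \<Longrightarrow> \<bar>u t x - \<phi> (fst x - c * t)\<bar> < \<epsilon> / 2"
    using past[of "\<epsilon> / 2"] half_gt_zero[OF \<epsilon>(1)] by blast
  define T0 where "T0 = min T T'"
  have T0: "T0 \<le> T" "T0 \<le> T'" by (auto simp: T0_def)
  obtain Z where Z: "\<And>s. s \<le> Z \<Longrightarrow> \<phi> s \<ge> 1 - \<epsilon> / 2" using \<phi>_near_1[of "\<epsilon> / 2"] \<epsilon> by auto
  define B0 where "B0 = max 1 (- Z - c * T0)"
  have B0: "B0 > 0" "- B0 \<le> Z + c * T0" by (auto simp: B0_def)
  define w where "w t x = 1 - \<epsilon> - exp (fst x + B0 + (1 + L) * (t - T0))" for t and x :: "real \<times> 'b"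
  have "w T x \<le> u T x" if x: "x \<in> closure \<Omega>" for x
  proof (rule comparison[where C = "closure \<Omega>" and T = T0, OF closed_closure subset_refl _ _ _ _ _ x])
    show "continuous_on UNIV (\<lambda>(t, x). w t x)"
      unfolding w_def case_prod_beta by (intro continuous_intros)
    show "w t x \<le> 1" for t x using \<epsilon>(1) exp_ge_zero[of "fst x + B0 + (1 + L) * (t - T0)"]
      unfolding w_def by linarith
    show "T0 \<le> T" by (rule T0)
    show "w T0 x \<le> u T0 x" if "x \<in> closure \<Omega>" for x
    proof (cases "fst x \<le> - B0")
      case True
      have "x \<in> \<Omega>" using outside[of x] True B0 by simp
      then have "u T0 x \<ge> \<phi> (fst x - c * T0) - \<epsilon> / 2" using T'[OF T0(2), of x] by linarith
      moreover have "\<phi> (fst x - c * T0) \<ge> 1 - \<epsilon> / 2" by (rule Z) (use True B0 in simp)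
      moreover have "w T0 x \<le> 1 - \<epsilon>" by (simp add: w_def)
      ultimately show ?thesis by linarith
    next
      case False
      then have "exp (fst x + B0) \<ge> 1" by simp
      moreover have "w T0 x = 1 - \<epsilon> - exp (fst x + B0)" by (simp add: w_def)
      ultimately show ?thesis using range_u[OF that, of T0] \<epsilon>(1) by linarith
    qed
    fix s x
    assume s: "T0 < s" "s \<le> T" and x: "x \<in> closure \<Omega>" and less: "u s x < w s x"
    define E where "E = exp (fst x + B0 + (1 + L) * (s - T0))"
    have wE: "w s x = 1 - \<epsilon> - E" by (simp add: w_def E_def)
    have E: "0 < E" "E < 1 - \<epsilon>" using less range_u[OF x, of s] wE by (auto simp: E_def)
    then have "E < 1" using \<epsilon> by linarith
    then have "fst x + B0 + (1 + L) * (s - T0) < 0" by (simp add: E_def)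
    moreover have "(1 + L) * (s - T0) \<ge> 0" using s L_nonneg by simp
    ultimately have "fst x < 0" using B0 by linarith
    then have x\<Omega>: "x \<in> \<Omega>" using outside by blast
    let ?r = "B0 + (1 + L) * (s - T0)"
    have J0: "has_jet (\<lambda>z. (1, 0) \<bullet> z + ?r) (\<lambda>z. (1, 0)) (\<lambda>k. 0) x" by (rule has_jet_affine)
    have E': "exp ((1, 0) \<bullet> x + ?r) = E" by (simp add: E_def fst_inner add.assoc)
    have weq: "w s = (\<lambda>z. 1 - \<epsilon> - exp ((1, 0) \<bullet> z + ?r))"
      by (auto simp: w_def fst_inner add.assoc)
    obtain H where J: "has_jet (w s) (\<lambda>z. (- exp ((1, 0) \<bullet> z + ?r)) *\<^sub>R (1, 0)) H x"
      and "tr H = - exp ((1, 0) \<bullet> x + ?r) * tr (\<lambda>k::real \<times> 'b. 0::real \<times> 'b)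
        + - exp ((1, 0) \<bullet> x + ?r) * (norm ((1, 0) :: real \<times> 'b))\<^sup>2"
      unfolding weq
      by (rule jet_of_composition[OF J0, of "\<lambda>r. 1 - \<epsilon> - exp r" "\<lambda>r. - exp r"])
        (auto intro!: derivative_eq_intros always_eventually)
    then have t: "tr H = - E" unfolding E' by (simp add: tr_zero norm_Pair)
    have "((\<lambda>r. w r x) has_real_derivative - (1 + L) * E) (at s)"
      unfolding w_def E_def by (auto intro!: derivative_eq_intros simp: algebra_simps)
    moreover have "- (1 + L) * E \<le> - E + f (w s x)"
    proof -
      have "\<bar>f (w s x) - f (1 - \<epsilon>)\<bar> \<le> L * \<bar>w s x - (1 - \<epsilon>)\<bar>"
        by (rule lipschitz) (use E \<epsilon> \<alpha> wE in auto)
      moreover have "\<bar>w s x - (1 - \<epsilon>)\<bar> = E" using E by (simp add: wE)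
      moreover have "f (1 - \<epsilon>) > 0" using f_pos \<epsilon> by simp
      ultimately show ?thesis by (simp add: algebra_simps)
    qed
    ultimately show "touching_subsolution w (closure \<Omega>) s x"
      using J t x\<Omega> frontier_not_in[of x]
      by (intro touching_subsolutionI[where W = w and e = 1]) auto
  qed
  then have w: "x \<in> \<Omega> \<Longrightarrow> w T x \<le> u T x" for x using in_closure by blast
  have "1 - 2 * \<epsilon> \<le> u T x" if x: "fst x \<le> - max 1 (B0 + (1 + L) * (T - T0) - ln \<epsilon>)" for x
  proof -
    have "fst x < 0" using x by linarith
    then have "w T x \<le> u T x" using outside w by blast
    moreover have "exp (fst x + B0 + (1 + L) * (T - T0)) \<le> exp (ln \<epsilon>)" using x by simp
    then have "exp (fst x + B0 + (1 + L) * (T - T0)) \<le> \<epsilon>" using \<epsilon> by simp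
    ultimately show ?thesis by (simp add: w_def)
  qed
  then show ?thesis using that by blast
qed

text \<open>The gradient bound for \<open>u\<close> and for 1 - u controls both signs, uniformly in
  time. From M + 3, one unit is lost to reach \<open>z\<close>, at most half a unit to the midpoint,
  and a unit ball about that still misses the slab.\<close>

lemma right_lipschitz:
  obtains \<Lambda> where "\<Lambda> \<ge> 0"
    "\<And>t x z. fst x \<ge> M + 3 \<Longrightarrow> DIM(real \<times> 'b) * norm (z - x) \<le> 1/2 \<Longrightarrow> \<bar>u t z - u t x\<bar> \<le> \<Lambda> * norm (z - x)"
proof -
  obtain F where F: "F \<ge> 0" "\<And>r. 0 \<le> r \<Longrightarrow> r \<le> 1 \<Longrightarrow> \<bar>f r\<bar> \<le> F" using f_bound by blast
  define A where "A = 4 + (8 * real DIM(real \<times> 'b) + 9 + 2 * F) / 4"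
  have A: "A \<ge> 0" using F by (simp add: A_def)
  have right: "fst z \<ge> r - d" if "dist y z \<le> d" "fst y \<ge> r" for y z :: "real \<times> 'b" and r d
    using dist_fst_le[of y z] that by (simp add: dist_real_def abs_le_iff)
  have step: "\<bar>u t (y + h *\<^sub>R b) - u t (y - h *\<^sub>R b)\<bar> \<le> A * h"
    if y: "fst y \<ge> M + 3/2" and h: "0 \<le> h" "h \<le> 1/4" and b: "b \<in> Basis" for t y h b
  proof -
    have in\<Omega>: "z \<in> \<Omega>" if "z \<in> cball y 1" for z
      using right[of y z 1 "M + 3/2"] that y outside[of z] by simp
    have cu: "continuous_on ({t-1..t} \<times> cball y 1) (\<lambda>(s, z). u s z)"
      by (rule continuous_on_subset[OF cont_u]) (use in\<Omega> in_closure in auto)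
    have "u t (y + h *\<^sub>R b) - u t (y - h *\<^sub>R b) \<le> A * h"
      unfolding A_def
    proof (rule interior_gradient_bound[OF cu _ _ b h])
      show "0 \<le> u s z \<and> u s z \<le> 1" if "z \<in> cball y 1" for s z
        using range_u in\<Omega>[OF that] in_closure by blast
      show "\<exists>G H D. has_jet (u s) G H z \<and> ((\<lambda>s. u s z) has_real_derivative D) (at s) \<and> \<bar>D - tr H\<bar> \<le> F"
        if z: "z \<in> ball y 1" for s z
      proof -
        have z\<Omega>: "z \<in> \<Omega>" using in\<Omega>[of z] z by simp
        then obtain G H where "has_jet (u s) G H z" "((\<lambda>s. u s z) has_real_derivative tr H + f (u s z)) (at s)"
          using equation by blast
        moreover have "\<bar>(tr H + f (u s z)) - tr H\<bar> \<le> F" using F(2) range_u[OF in_closure[OF z\<Omega>], of s] by simp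
        ultimately show ?thesis by blast
      qed
    qed
    moreover have "(1 - u t (y + h *\<^sub>R b)) - (1 - u t (y - h *\<^sub>R b)) \<le> A * h"
      unfolding A_def
    proof (rule interior_gradient_bound[where U = "\<lambda>s z. 1 - u s z", OF _ _ _ b h])
      show "continuous_on ({t-1..t} \<times> cball y 1) (\<lambda>(s, z). 1 - u s z)"
        using cu unfolding case_prod_beta by (intro continuous_intros)
      show "0 \<le> 1 - u s z \<and> 1 - u s z \<le> 1" if "z \<in> cball y 1" for s z
        using range_u[of z s] in\<Omega>[OF that] in_closure by auto
      show "\<exists>G H D. has_jet (\<lambda>z. 1 - u s z) G H z \<and> ((\<lambda>s. 1 - u s z) has_real_derivative D) (at s) \<and> \<bar>D - tr H\<bar> \<le> F"
        if z: "z \<in> ball y 1" for s z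
      proof -
        have z\<Omega>: "z \<in> \<Omega>" using in\<Omega>[of z] z by simp
        then obtain G H where GH: "has_jet (u s) G H z" "((\<lambda>s. u s z) has_real_derivative tr H + f (u s z)) (at s)"
          using equation by blast
        have "has_jet (\<lambda>z. (-1) * u s z + (0 \<bullet> z + 1)) (\<lambda>z. (-1) *\<^sub>R G z + 0) (\<lambda>k. (-1) *\<^sub>R H k + 0) z"
          by (intro has_jet_add has_jet_scale GH has_jet_affine)
        then have J: "has_jet (\<lambda>z. 1 - u s z) (\<lambda>z. (-1) *\<^sub>R G z + 0) (\<lambda>k. (-1) *\<^sub>R H k + 0) z"
          by simp
        have D: "((\<lambda>s. 1 - u s z) has_real_derivative 0 - (tr H + f (u s z))) (at s)"
          by (intro DERIV_diff DERIV_const GH)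
        have "tr (\<lambda>k. (-1) *\<^sub>R H k + 0) = - tr H" using tr_scale[of "-1" H] by simp
        then have "\<bar>0 - (tr H + f (u s z)) - tr (\<lambda>k. (-1) *\<^sub>R H k + 0)\<bar> \<le> F"
          using F(2)[of "u s z"] range_u[OF in_closure[OF z\<Omega>], of s] by simp
        then show ?thesis using J D by blast
      qed
    qed
    ultimately show ?thesis by (simp add: abs_le_iff)
  qed
  have coord: "\<bar>u t (z + k *\<^sub>R b) - u t z\<bar> \<le> A * \<bar>k\<bar>"
    if x: "fst x \<ge> M + 3" and z: "z \<in> cball x 1" and b: "b \<in> Basis" and k: "\<bar>k\<bar> \<le> 1/2" for t x z b k
  proof -
    \<comment> \<open>The gradient bound is for differences symmetric about a centre, so an
      increment is centred at its midpoint.\<close>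
    define y where "y = z + (k / 2) *\<^sub>R b"
    have "fst z \<ge> M + 2" using right[of x z 1 "M + 3"] z x by simp
    then have y: "fst y \<ge> M + 3/2"
      using right[of z y "1/4" "M + 2"] k b by (simp add: y_def dist_norm)
    have half: "(k / 2) *\<^sub>R b + (k / 2) *\<^sub>R b = k *\<^sub>R b" by (simp flip: scaleR_add_left)
    have ends: "z + k *\<^sub>R b = y + (k / 2) *\<^sub>R b" "z = y - (k / 2) *\<^sub>R b"
      using half by (simp_all add: y_def add.assoc)
    have "\<bar>u t (z + k *\<^sub>R b) - u t z\<bar> = \<bar>u t (y + (\<bar>k\<bar> / 2) *\<^sub>R b) - u t (y - (\<bar>k\<bar> / 2) *\<^sub>R b)\<bar>"
    proof (cases "k \<ge> 0")
      case True
      then show ?thesis unfolding ends(1) by (subst ends(2)) simp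
    next
      case False
      then have abs: "\<bar>k\<bar> / 2 = - (k / 2)" by simp
      have "y + (\<bar>k\<bar> / 2) *\<^sub>R b = z" "y - (\<bar>k\<bar> / 2) *\<^sub>R b = z + k *\<^sub>R b"
        unfolding abs scaleR_minus_left ends(1) by (simp only: ends(2) add_uminus_conv_diff, simp only: diff_minus_eq_add)
      then show ?thesis by (simp only: abs_minus_commute)
    qed
    also have "\<dots> \<le> A * (\<bar>k\<bar> / 2)" using k by (intro step y b) auto
    also have "\<dots> \<le> A * \<bar>k\<bar>" using A by (intro mult_left_mono) auto
    finally show ?thesis .
  qed
  show ?thesis
  proof (rule that[of "A * DIM(real \<times> 'b)"])
    show "A * DIM(real \<times> 'b) \<ge> 0" using A by simp
    show "\<bar>u t z - u t x\<bar> \<le> A * DIM(real \<times> 'b) * norm (z - x)"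
      if "fst x \<ge> M + 3" "DIM(real \<times> 'b) * norm (z - x) \<le> 1/2" for t x z
      by (rule lipschitz_from_coordinates[OF coord[OF that(1)] A that(2)])
  qed
qed

text \<open>A Lipschitz bound uniform in time reduces both limits to finitely many points. The net
  \<open>Y\<close> lives in the y-directions only, so it is independent of where the ball is placed
  and gives a threshold \<open>S\<close> for \<open>v\<close>; the ball is put beyond
  \<open>S\<close>, and its net \<open>P\<close> gives a common time. The limit and the two nets
  cost q/4 each.\<close>

lemma ball_where_large:
  assumes q: "q > 0"
  obtains x0 t0 where "fst x0 \<ge> b" "\<And>x. x \<in> cball x0 R \<Longrightarrow> u t0 x \<ge> 1 - q"
proof -
  obtain \<Lambda> where \<Lambda>: "\<Lambda> \<ge> 0"
    "\<And>t x z. fst x \<ge> M + 3 \<Longrightarrow> DIM(real \<times> 'b) * norm (z - x) \<le> 1/2 \<Longrightarrow> \<bar>u t z - u t x\<bar> \<le> \<Lambda> * norm (z - x)"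
    using right_lipschitz by blast
  define N where "N = real DIM(real \<times> 'b)"
  have N: "N > 0" by (simp add: N_def)
  define d where "d = min (1 / (2 * N)) (q / 4 / (\<Lambda> + 1))"
  have d: "d > 0" using q \<Lambda> N by (simp add: d_def)
  have "N * d \<le> N * (1 / (2 * N))" using N by (intro mult_left_mono) (auto simp: d_def)
  then have Nd: "N * d \<le> 1/2" using N by simp
  have \<Lambda>d: "\<Lambda> * d \<le> q / 4"
    using \<Lambda>(1) d by (intro mult_le_of_le_divide) (auto simp: d_def)
  have near: "u t z \<ge> u t x - q / 4" if x: "fst x \<ge> M + 3" and xz: "dist x z \<le> d" for t x z
  proof -
    have n: "norm (z - x) \<le> d" using xz by (simp add: dist_norm norm_minus_commute)
    have "N * norm (z - x) \<le> N * d" using n N by (intro mult_left_mono) auto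
    then have "\<bar>u t z - u t x\<bar> \<le> \<Lambda> * norm (z - x)"
      using Nd by (intro \<Lambda>(2) x) (simp only: N_def)
    also have "\<dots> \<le> \<Lambda> * d" using n \<Lambda>(1) by (rule mult_left_mono)
    finally show ?thesis using \<Lambda>d by linarith
  qed
  obtain Y where Y: "finite Y" "Y \<subseteq> cball (0::'b) R" "\<And>y. y \<in> cball 0 R \<Longrightarrow> \<exists>y'\<in>Y. dist y' y < d"
    using finite_net[OF compact_cball d] by blast
  have "\<forall>y'\<in>Y. \<forall>\<^sub>F s in at_top. v (s, y') > 1 - q / 4"
    using propagation q by (intro ballI order_tendstoD(1)[OF propagation]) auto
  then have "\<forall>\<^sub>F s in at_top. \<forall>y'\<in>Y. v (s, y') > 1 - q / 4" by (rule eventually_ball_finite[OF Y(1)])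
  then obtain S where S: "\<And>s y'. s \<ge> S \<Longrightarrow> y' \<in> Y \<Longrightarrow> v (s, y') > 1 - q / 4"
    unfolding eventually_at_top_linorder by blast
  \<comment> \<open>The shift by |R| puts the whole ball, not just its centre, beyond all three
    thresholds.\<close>
  define x0 where "x0 = (max (max S b) (M + 3) + \<bar>R\<bar>, 0 :: 'b)"
  have x0: "fst x \<ge> S" "fst x \<ge> M + 3" "norm (snd x) \<le> R" if "x \<in> cball x0 R" for x
  proof -
    have "\<bar>fst x0 - fst x\<bar> \<le> R" using dist_fst_le[of x0 x] that by (simp add: dist_real_def)
    moreover have "R \<ge> 0" using order_trans[OF zero_le_dist[of x0 x]] that by simp
    ultimately show "fst x \<ge> S" "fst x \<ge> M + 3" by (auto simp: x0_def)
    show "norm (snd x) \<le> R" using dist_snd_le[of x0 x] that by (simp add: x0_def)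
  qed
  obtain P where P: "finite P" "P \<subseteq> cball x0 R" "\<And>x. x \<in> cball x0 R \<Longrightarrow> \<exists>p\<in>P. dist p x < d"
    using finite_net[OF compact_cball d] by blast
  have "\<forall>p\<in>P. \<forall>\<^sub>F t in at_top. u t p \<ge> 1 - q / 2"
  proof
    fix p assume "p \<in> P"
    then have p: "p \<in> cball x0 R" using P by blast
    obtain y' where y': "y' \<in> Y" "dist y' (snd p) < d" using Y(3)[of "snd p"] x0(3)[OF p] by auto
    have "(fst p, y') \<in> \<Omega>" using outside[of "(fst p, y')"] x0(2)[OF p] by simp
    then have "((\<lambda>t. u t (fst p, y')) \<longlongrightarrow> v (fst p, y')) at_top" by (rule lim_v)
    then have "\<forall>\<^sub>F t in at_top. u t (fst p, y') > 1 - q / 4"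
      by (rule order_tendstoD(1)) (rule S[OF x0(1)[OF p] y'(1)])
    then show "\<forall>\<^sub>F t in at_top. u t p \<ge> 1 - q / 2"
    proof eventually_elim
      case (elim t)
      have "dist (fst p, y') p \<le> d" using y'(2) by (cases p) (simp add: dist_Pair_Pair)
      then have "u t p \<ge> u t (fst p, y') - q / 4" using x0(2)[OF p] by (intro near) auto
      then show ?case using elim by simp
    qed
  qed
  then have "\<forall>\<^sub>F t in at_top. \<forall>p\<in>P. u t p \<ge> 1 - q / 2" by (rule eventually_ball_finite[OF P(1)])
  then obtain t0 where t0: "\<And>p. p \<in> P \<Longrightarrow> u t0 p \<ge> 1 - q / 2"
    unfolding eventually_at_top_linorder by blast
  show ?thesis
  proof (rule that[of x0 t0])
    show "fst x0 \<ge> b" by (simp add: x0_def)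
    fix x assume x: "x \<in> cball x0 R"
    obtain p where p: "p \<in> P" "dist p x < d" using P(3)[OF x] by blast
    have "u t0 x \<ge> u t0 p - q / 4" using x0(2)[of p] p P(2) by (intro near) auto
    then show "u t0 x \<ge> 1 - q" using t0[OF p(1)] q by simp
  qed
qed

lemma jet_of_profile:
  assumes "has_jet \<zeta> G H x"
  obtains H' where "has_jet (\<lambda>z. \<phi> (\<zeta> z) - q) (\<lambda>z. \<phi>1 (\<zeta> z) *\<^sub>R G z) H' x"
    "tr H' = \<phi>1 (\<zeta> x) * tr H + (- c * \<phi>1 (\<zeta> x) - f (\<phi> (\<zeta> x))) * (norm (G x))\<^sup>2"
proof -
  have "\<forall>\<^sub>F s in nhds (\<zeta> x). ((\<lambda>r. \<phi> r - q) has_real_derivative \<phi>1 s) (at s)"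
    by (auto intro!: always_eventually derivative_eq_intros d\<phi>)
  from jet_of_composition[OF assms this d\<phi>1] show ?thesis using that by blast
qed

text \<open>Each target (t, y) gets its own ball, which leaves \<open>x0\<close> at time
  \<open>t0\<close> and arrives with its centre at the target exactly at time t. A large ball would
  expand by itself at nearly speed c, so it tolerates being dragged at speed c/8.\<close>

lemma right_convergence:
  assumes q: "0 < q" "admissible_loss q"
  obtains X1 where "X1 \<ge> b0" "\<And>Y. \<exists>T. \<forall>t\<ge>T. \<forall>y. norm y \<le> Y \<longrightarrow> 1 - 2 * q \<le> u t (X1, y)"
proof -
  define N where "N = real DIM(real \<times> 'b)"
  have N: "N > 0" by (simp add: N_def)
  obtain \<mu> where \<mu>: "\<mu> > 0" "\<And>a b s. q < \<phi> s \<Longrightarrow> \<bar>a - 1\<bar> \<le> \<mu> \<Longrightarrow> - c / 4 \<le> b \<Longrightarrow>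
        \<phi>1 s * b \<le> (- c * \<phi>1 s - f (\<phi> s)) * a + f (\<phi> s - q)" using q(2) unfolding admissible_loss_def by blast
  have "0 \<le> c / 8 + N" using c N by simp
  then obtain Zt where Zt: "\<And>a b s. s \<le> Zt \<Longrightarrow> 0 \<le> a \<Longrightarrow> a \<le> 1 \<Longrightarrow> - (c / 8 + N) \<le> b \<Longrightarrow>
        \<phi>1 s * b \<le> (- c * \<phi>1 s - f (\<phi> s)) * a + f (\<phi> s - q)" 
    using q(2) unfolding admissible_loss_def by blast
  obtain Zq where Zq: "Zq \<ge> 0" "\<And>s. s \<ge> Zq \<Longrightarrow> \<phi> s \<le> q" using \<phi>_near_0[OF q(1)] by blast
  obtain Z1 where Z1: "\<And>s. s \<le> Z1 \<Longrightarrow> \<phi> s \<ge> 1 - q" using \<phi>_near_1[OF q(1)] by blast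
  \<comment> \<open>Beyond radius about \<open>m0\<close> the squared gradient of
    \<open>bump\<close> is within \<mu> of 1 and the curvature term is at most c/8.\<close>
  define m0 where "m0 = max 1 (max (1 / \<mu>) (8 * N / c))"
  have m0: "m0 \<ge> 1" "1 / m0 \<le> \<mu>" "N / m0 \<le> c / 8"
  proof -
    show "m0 \<ge> 1" by (simp add: m0_def)
    have "1 / \<mu> \<le> m0" "8 * N / c \<le> m0" by (auto simp: m0_def)
    then show "1 / m0 \<le> \<mu>" "N / m0 \<le> c / 8"
      using \<open>m0 \<ge> 1\<close> \<mu>(1) c by (auto simp: field_simps)
  qed
  \<comment> \<open>The first bound puts the core, where the gradient is degenerate, into the flat
    part of the profile; the second makes the value at the centre, where \<open>bump\<close> is 1,
    at least 1 - 2q.\<close>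
  define R0 where "R0 = max (m0 - Zt) (1 - Z1)"
  have R0: "m0 - R0 \<le> Zt" "1 - R0 \<le> Z1" by (auto simp: R0_def)
  \<comment> \<open>The positivity set has radius at most R0 + Zq and slides without changing x1, so
    at this distance it never reaches the slab.\<close>
  obtain x0 t0 where x0: "fst x0 \<ge> max b0 (M + 1 + \<bar>R0 + Zq\<bar>)"
    and t0: "\<And>x. x \<in> cball x0 (R0 + Zq) \<Longrightarrow> u t0 x \<ge> 1 - q"
    using ball_where_large[OF q(1)] by blast
  have main: "1 - 2 * q \<le> u t (fst x0, y)" if t: "t \<ge> t0 + 1 + 8 / c * norm (y - snd x0)" for t y
  proof -
    have cn: "8 / c * norm (y - snd x0) \<ge> 0" using c by simp
    have tt: "t - t0 > 0" using t cn by linarith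
    \<comment> \<open>The constant velocity that brings the centre to the target at time t; the
      waiting time assumed for t makes its norm at most c/8.\<close>
    define d where "d = (0 :: real, (y - snd x0) /\<^sub>R (t - t0))"
    have d: "norm d \<le> c / 8"
    proof -
      have "norm (y - snd x0) \<le> c / 8 * (t - t0)"
        using t c by (simp add: field_simps)
      then have "norm (y - snd x0) / (t - t0) \<le> c / 8" using tt by (simp add: pos_divide_le_eq)
      moreover have "norm d = norm ((y - snd x0) /\<^sub>R (t - t0))" unfolding d_def by (simp only: norm_Pair) simp
      moreover have "\<dots> = norm (y - snd x0) / (t - t0)"
        unfolding norm_scaleR using tt by (simp add: divide_inverse mult.commute)
      ultimately show ?thesis by linarith
    qed
    define \<zeta> where "\<zeta> s x = bump (x - (x0 + (s - t0) *\<^sub>R d)) - R0" for s and x :: "real \<times> 'b"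
    define w where "w s x = \<phi> (\<zeta> s x) - q" for s and x :: "real \<times> 'b"
    have "w t (fst x0, y) \<le> u t (fst x0, y)"
    proof (rule comparison[where C = "closure \<Omega>" and T = t0, OF closed_closure subset_refl])
      show "continuous_on UNIV (\<lambda>(s, x). w s x)"
        unfolding w_def \<zeta>_def case_prod_beta
        by (intro continuous_on_compose2[OF cont_\<phi>[of UNIV]] continuous_on_compose2[OF continuous_bump[of UNIV]]
          continuous_intros) auto
      show "w s x \<le> 1" for s x unfolding w_def using range_\<phi>(2)[of "\<zeta> s x"] q by linarith
      show "t0 \<le> t" using tt by simp
      show "(fst x0, y) \<in> closure \<Omega>" using x0 by (intro in_closure outside) auto
      have pos: "norm (x - (x0 + (s - t0) *\<^sub>R d)) < R0 + Zq" if "w s x > 0" for s x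
      proof -
        have "\<not> \<zeta> s x \<ge> Zq" using that Zq(2)[of "\<zeta> s x"] by (auto simp: w_def)
        then show ?thesis using bump_ge(2)[of "x - (x0 + (s - t0) *\<^sub>R d)"] by (simp add: \<zeta>_def)
      qed
      show "w t0 x \<le> u t0 x" if x: "x \<in> closure \<Omega>" for x
      proof (cases "w t0 x > 0")
        case True
        then have "x \<in> cball x0 (R0 + Zq)" using pos[OF True] by (simp add: dist_norm norm_minus_commute)
        then show ?thesis using t0[of x] range_\<phi>(2)[of "\<zeta> t0 x"] by (simp add: w_def)
      next
        case False
        then show ?thesis using range_u[OF x, of t0] by linarith
      qed
      fix s x assume s: "t0 < s" "s \<le> t" and x: "x \<in> closure \<Omega>" and less: "u s x < w s x"
      have wpos: "w s x > 0" using less range_u[OF x, of s] by linarith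
      let ?c = "x0 + (s - t0) *\<^sub>R d"
      have "\<bar>fst (x - ?c)\<bar> \<le> norm (x - ?c)" by (metis norm_fst_le real_norm_def prod.collapse)
      moreover have "fst (x - ?c) = fst x - fst x0" by (simp add: d_def)
      ultimately have "fst x > M" using pos[OF wpos] x0 by auto
      then have x\<Omega>: "x \<in> \<Omega>" using outside by blast
      let ?G = "\<lambda>z. (z - ?c) /\<^sub>R bump (z - ?c)"
      obtain H where H: "has_jet bump (\<lambda>z. z /\<^sub>R bump z) H (x - ?c)" "tr H \<le> N / bump (x - ?c)"
        unfolding N_def using bump_laplacian_bound by blast
      have "has_jet (\<lambda>z. bump (z - ?c) + (0 \<bullet> z + (- R0))) (\<lambda>z. ?G z + 0) (\<lambda>k. H k + 0) x"
        by (rule has_jet_add[OF has_jet_translate[OF H(1)] has_jet_affine])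
      then have "has_jet (\<zeta> s) ?G H x" by (simp add: \<zeta>_def[abs_def])
      from jet_of_profile[OF this, of q] obtain H' where
        J: "has_jet (w s) (\<lambda>z. \<phi>1 (\<zeta> s z) *\<^sub>R ?G z) H' x"
        and trH': "tr H' = \<phi>1 (\<zeta> s x) * tr H + (- c * \<phi>1 (\<zeta> s x) - f (\<phi> (\<zeta> s x))) * (norm (?G x))\<^sup>2"
        by (auto simp: w_def[abs_def])
      have "((\<lambda>r. x - (x0 + (r - t0) *\<^sub>R d)) has_derivative (\<lambda>k. - (k *\<^sub>R d))) (at s)"
        by (auto intro!: derivative_eq_intros)
      from has_derivative_compose[OF this has_jet_gradient[OF H(1)]]
      have "((\<lambda>r. bump (x - (x0 + (r - t0) *\<^sub>R d))) has_real_derivative - (?G x \<bullet> d)) (at s)"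
        by (rule has_derivative_imp_has_field_derivative) simp
      then have "((\<lambda>r. \<zeta> r x) has_real_derivative - (?G x \<bullet> d)) (at s)"
        unfolding \<zeta>_def by (auto intro!: derivative_eq_intros)
      from DERIV_chain2[OF d\<phi> this]
      have Dt: "((\<lambda>r. w r x) has_real_derivative \<phi>1 (\<zeta> s x) * - (?G x \<bullet> d)) (at s)"
        unfolding w_def by (auto intro!: derivative_eq_intros)
      have Gsq: "(norm (?G x))\<^sup>2 = 1 - 1 / (bump (x - ?c))\<^sup>2" by (rule bump_gradient_norm)
      have G1: "(norm (?G x))\<^sup>2 \<le> 1" using Gsq by simp
      have "norm (?G x) \<le> 1"
        by (rule power2_le_imp_le) (simp_all only: G1 power_one zero_le_one)
      have "?G x \<bullet> d \<le> norm (?G x) * norm d" by (rule norm_cauchy_schwarz)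
      also have "\<dots> \<le> 1 * (c / 8)" using \<open>norm (?G x) \<le> 1\<close> d by (intro mult_mono) auto
      finally have Gd: "?G x \<bullet> d \<le> c / 8" by simp
      let ?b = "- (?G x \<bullet> d) - tr H"
      have sub: "\<phi>1 (\<zeta> s x) * ?b \<le> (- c * \<phi>1 (\<zeta> s x) - f (\<phi> (\<zeta> s x))) * (norm (?G x))\<^sup>2 + f (\<phi> (\<zeta> s x) - q)"
      proof (cases "bump (x - ?c) \<ge> m0")
        case True
        have "N / bump (x - ?c) \<le> N / m0" using True m0(1) N by (intro divide_left_mono) auto
        then have b: "- c / 4 \<le> ?b" using Gd H(2) m0(3) by linarith
        have "m0 * 1 \<le> bump (x - ?c) * bump (x - ?c)" using True m0(1) by (intro mult_mono) auto
        then have "1 / (bump (x - ?c))\<^sup>2 \<le> 1 / m0"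
          using m0(1) by (intro divide_left_mono) (auto simp: power2_eq_square)
        then have "\<bar>(norm (?G x))\<^sup>2 - 1\<bar> \<le> \<mu>" unfolding Gsq using m0(2) by simp
        then show ?thesis using \<mu>(2) b wpos by (simp add: w_def)
      next
        case False
        then have "\<zeta> s x \<le> Zt" using R0(1) by (simp add: \<zeta>_def)
        moreover have "N / bump (x - ?c) \<le> N / 1" using bump_ge(1)[of "x - ?c"] N by (intro divide_left_mono) auto
        then have "- (c / 8 + N) \<le> ?b" using Gd H(2) by simp
        ultimately show ?thesis using G1 by (intro Zt) auto
      qed
      show "touching_subsolution w (closure \<Omega>) s x"
      proof (rule touching_subsolutionI[where W = w and e = 1, OF _ _ _ _ Dt J])
        show "\<phi>1 (\<zeta> s x) * - (?G x \<bullet> d) \<le> tr H' + f (w s x)"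
          using sub unfolding trH' w_def by (simp add: algebra_simps)
      qed (use x\<Omega> frontier_not_in[of x] in auto)
    qed
    moreover have "\<zeta> t (fst x0, y) = 1 - R0"
    proof -
      have "(t - t0) *\<^sub>R d = (0, y - snd x0)" using tt by (simp add: d_def)
      then have "(fst x0, y) - (x0 + (t - t0) *\<^sub>R d) = 0" by (simp add: prod_eq_iff)
      then show ?thesis by (simp only: \<zeta>_def) (simp add: bump_def)
    qed
    moreover have "\<phi> (1 - R0) \<ge> 1 - q" by (rule Z1[OF R0(2)])
    ultimately show ?thesis by (simp add: w_def)
  qed
  show ?thesis
  proof (rule that[of "fst x0"])
    show "fst x0 \<ge> b0" using x0 by simp
    fix Y
    show "\<exists>T. \<forall>t\<ge>T. \<forall>y. norm y \<le> Y \<longrightarrow> 1 - 2 * q \<le> u t (fst x0, y)"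
    proof (intro exI[of _ "t0 + 1 + 8 / c * (Y + norm (snd x0))"] allI impI main)
      fix t and y :: 'b assume t: "t0 + 1 + 8 / c * (Y + norm (snd x0)) \<le> t" and y: "norm y \<le> Y"
      have "norm (y - snd x0) \<le> Y + norm (snd x0)" using norm_triangle_ineq4[of y "snd x0"] y by linarith
      then have "8 / c * norm (y - snd x0) \<le> 8 / c * (Y + norm (snd x0))" using c by (intro mult_left_mono) auto
      then show "t \<ge> t0 + 1 + 8 / c * norm (y - snd x0)" using t by linarith
    qed
  qed
qed

text \<open>Only some late time is claimed, so the fronts may be started after \<open>T1\<close> and
  followed until they have passed over \<open>xs\<close>; what happens afterwards is
  irrelevant.\<close>

lemma frequently_large:
  assumes q: "0 < q" "admissible_loss q" "admissible_loss (q / 2)" "q < 1 - \<alpha>" and xs: "xs \<in> \<Omega>"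
  shows "\<exists>t\<ge>T1. 1 - 2 * q \<le> u t xs"
proof -
  obtain \<mu> where \<mu>: "\<mu> > 0" "\<And>a b s. q < \<phi> s \<Longrightarrow> \<bar>a - 1\<bar> \<le> \<mu> \<Longrightarrow> - c / 4 \<le> b \<Longrightarrow>
        \<phi>1 s * b \<le> (- c * \<phi>1 s - f (\<phi> s)) * a + f (\<phi> s - q)" using q(2) unfolding admissible_loss_def by blast
  obtain Zq where Zq: "Zq \<ge> 0" "\<And>s. s \<ge> Zq \<Longrightarrow> \<phi> s \<le> q" using \<phi>_near_0[OF q(1)] by blast
  obtain Z1 where Z1: "Z1 \<le> 0" "\<And>s. s \<le> Z1 \<Longrightarrow> \<phi> s \<ge> 1 - q" using \<phi>_near_1[OF q(1)] by blast
  have C1: "C1 \<ge> 0" by (rule order_trans[OF norm_ge_zero \<eta>_gradient])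
  \<comment> \<open>The tilt by \<kappa> X changes the squared gradient by at most \<kappa> (2 C1 +
    C1^2), using \<kappa> \<le> 1, and the Laplacian by at most c/8. Together with the speed c/8
    this stays within the allowed -c/4.\<close>
  define \<kappa> where "\<kappa> = min 1 (min (\<mu> / (2 * C1 + C1\<^sup>2 + 1)) (c / 8 / (C1 + 1)))"
  have \<kappa>: "\<kappa> > 0" "\<kappa> \<le> 1" "(2 * C1 + C1\<^sup>2) * \<kappa> \<le> \<mu>" "C1 * \<kappa> \<le> c / 8"
  proof -
    have "2 * C1 + C1\<^sup>2 + 1 > 0" using C1 by (simp add: add_nonneg_pos)
    then show "\<kappa> > 0" using \<mu>(1) c C1 by (simp add: \<kappa>_def)
    show "\<kappa> \<le> 1" by (simp add: \<kappa>_def)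
    have "\<kappa> \<le> \<mu> / (2 * C1 + C1\<^sup>2 + 1)" "\<kappa> \<le> c / 8 / (C1 + 1)"
      unfolding \<kappa>_def by (simp_all only: min.coboundedI2 min.cobounded1 min.cobounded2)
    then show "(2 * C1 + C1\<^sup>2) * \<kappa> \<le> \<mu>" "C1 * \<kappa> \<le> c / 8"
      using mult_le_of_le_divide[of "2 * C1 + C1\<^sup>2" \<kappa> \<mu>] mult_le_of_le_divide[of C1 \<kappa> "c / 8"]
        C1 less_imp_le[OF \<open>\<kappa> > 0\<close>] by simp_all
  qed
  \<comment> \<open>Half the loss is used for the two side bounds: each then gives u \<ge> 1 - q,
    which lies above the subsolution everywhere.\<close>
  have q2: "0 < q / 2" "q / 2 < 1 - \<alpha>" using q by auto
  obtain X1 where X1: "X1 \<ge> max (M + 1) (max (a + 1) (fst xs))"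
    "\<And>Y. \<exists>T. \<forall>t\<ge>T. \<forall>y. norm y \<le> Y \<longrightarrow> 1 - 2 * (q / 2) \<le> u t (X1, y)"
    using right_convergence[OF q2(1) q(3)] by blast
  \<comment> \<open>This radius has to be fixed before T, B and R. Up to time \<open>Te\<close> the
    front has moved at most R + \<kappa> \<eta>(xs) - Z1, so in the positivity condition on the
    plane \<open>R\<close> cancels and a bound free of all three is left.\<close>
  define Y where "Y = (Zq + (X1 - a) + \<kappa> * \<eta> xs - Z1) / \<kappa>"
  obtain T2 where T2: "\<And>t y. t \<ge> T2 \<Longrightarrow> norm y \<le> Y \<Longrightarrow> 1 - q \<le> u t (X1, y)"
    using X1(2)[of Y] by auto
  define T where "T = max T1 T2"
  obtain B where B: "\<And>x. fst x \<le> - B \<Longrightarrow> 1 - q \<le> u T x"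
    using left_persistence[OF q2] by auto
  \<comment> \<open>At the start, positivity then requires |x1 - a| > |a| + |B| + (X1 - a). Since x1
    \<le> X1, this is possible only to the left of -B.\<close>
  define R where "R = Zq + \<bar>a\<bar> + \<bar>B\<bar> + (X1 - a)"
  define s0 where "s0 = c / 8"
  have s0: "s0 > 0" using c by (simp add: s0_def)
  \<comment> \<open>The time at which the argument of the profile at \<open>xs\<close> has fallen to
    at most Z1.\<close>
  define Te where "Te = T + (R + \<kappa> * \<eta> xs - Z1) / s0"
  have Te: "s0 * (Te - T) = R + \<kappa> * \<eta> xs - Z1" using s0 by (simp add: Te_def)
  have "\<kappa> * \<eta> xs \<ge> 0" using \<kappa>(1) \<eta>_ge(1)[of xs] by simp
  then have "R + \<kappa> * \<eta> xs - Z1 \<ge> 0" using Zq(1) X1(1) Z1(1) unfolding R_def by linarith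
  then have TTe: "T \<le> Te" using s0 by (simp add: Te_def)
  define \<zeta> where "\<zeta> \<sigma> t x = R - \<sigma> * (fst x - a) - s0 * (t - T) + \<kappa> * \<eta> x" for \<sigma> t and x :: "real \<times> 'b"
  define w where "w t x = \<phi> (R - \<bar>fst x - a\<bar> - s0 * (t - T) + \<kappa> * \<eta> x) - q" for t and x :: "real \<times> 'b"
  define C where "C = closure \<Omega> \<inter> {x. fst x \<le> X1}"
  have w_lt: "w t x < 1 - q" for t x using range_\<phi>(2) by (simp add: w_def)
  have pos: "R - \<bar>fst x - a\<bar> - s0 * (t - T) + \<kappa> * \<eta> x < Zq" if "w t x > 0" for t x
    using that Zq(2)[of "R - \<bar>fst x - a\<bar> - s0 * (t - T) + \<kappa> * \<eta> x"] unfolding w_def by linarith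
  have "w Te xs \<le> u Te xs"
  proof (rule comparison[where C = C and T = T])
    have "closed {x :: real \<times> 'b. fst x \<le> X1}" by (intro closed_Collect_le continuous_intros)
    then show "closed C" unfolding C_def by (intro closed_Int closed_closure)
    show "C \<subseteq> closure \<Omega>" by (simp add: C_def)
    show "continuous_on UNIV (\<lambda>(t, x). w t x)"
      unfolding w_def case_prod_beta
      by (intro continuous_on_compose2[OF cont_\<phi>[of UNIV]] continuous_on_compose2[OF continuous_\<eta>[of UNIV]]
        continuous_intros) auto
    show "w t x \<le> 1" for t x using w_lt[of t x] q by linarith
    show "T \<le> Te" by (rule TTe)
    show "xs \<in> C" using xs X1(1) in_closure by (simp add: C_def)
    show "w T x \<le> u T x" if x: "x \<in> C" for x
    proof (cases "w T x > 0")
      case True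
      have "\<kappa> * \<eta> x \<ge> 0" using \<kappa>(1) \<eta>_ge(1)[of x] by simp
      then have "\<bar>fst x - a\<bar> > \<bar>a\<bar> + \<bar>B\<bar> + (X1 - a)" using pos[OF True] by (simp add: R_def)
      then have "fst x \<le> - B" using x X1(1) by (auto simp: C_def)
      then show ?thesis using B[of x] w_lt[of T x] by linarith
    next
      case False
      then show ?thesis using range_u[of x T] x by (auto simp: C_def)
    qed
    fix s x assume s: "T < s" "s \<le> Te" and x: "x \<in> C" and less: "u s x < w s x"
    have xc: "x \<in> closure \<Omega>" "fst x \<le> X1" using x by (auto simp: C_def)
    have wpos: "w s x > 0" using less range_u[OF xc(1), of s] by linarith
    \<comment> \<open>The artificial boundary carries no Neumann condition, so contact there has to
      be excluded directly, through the bound for \<open>u\<close> on the plane.\<close>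
    have "fst x \<noteq> X1"
    proof
      assume eq: "fst x = X1"
      have "s0 * (s - T) \<le> s0 * (Te - T)" using s s0 by (intro mult_left_mono) auto
      then have "\<kappa> * \<eta> x \<le> Zq + (X1 - a) + \<kappa> * \<eta> xs - Z1"
        using pos[OF wpos] eq X1(1) unfolding Te by auto
      then have "\<eta> x \<le> Y" using \<kappa>(1) by (simp add: Y_def field_simps)
      moreover have "norm (snd x) \<le> norm x" by (metis norm_snd_le prod.collapse)
      ultimately have "norm (snd x) \<le> Y" using \<eta>_ge(2)[of x] by linarith
      then have "1 - q \<le> u s (X1, snd x)" using s by (intro T2) (auto simp: T_def)
      then show False using less w_lt[of s x] eq by (metis linorder_not_less order.strict_trans1 order.asym prod.collapse)
    qed
    then have gap: "X1 - fst x > 0" using xc(2) by simp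
    \<comment> \<open>\<sigma> selects a smooth branch of |x1 - a|. On the hyperplane x1 = a both
      branches touch from below, and the one with the correct sign along \<open>g\<close> is
      taken.\<close>
    obtain \<sigma> :: real where \<sigma>: "\<sigma> = 1 \<or> \<sigma> = - 1" "\<sigma> * (fst x - a) = \<bar>fst x - a\<bar>"
      "x \<in> frontier \<Omega> \<Longrightarrow> \<sigma> * fst (g x) \<ge> 0"
    proof (cases "fst x > a \<or> fst x = a \<and> fst (g x) \<ge> 0")
      case True
      then show ?thesis using that[of 1] normal_right[of x] by auto
    next
      case False
      then show ?thesis using that[of "- 1"] normal_left[of x] by auto
    qed
    define W where "W t z = \<phi> (\<zeta> \<sigma> t z) - q" for t z
    have Ww: "W t z \<le> w t z" for t z
    proof -
      have "\<sigma> * (fst z - a) \<le> \<bar>fst z - a\<bar>" using \<sigma>(1) by auto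
      then show ?thesis unfolding W_def w_def \<zeta>_def by (intro diff_right_mono \<phi>_antimono) auto
    qed
    have Wx: "W t x = w t x" for t by (simp add: W_def w_def \<zeta>_def \<sigma>(2))
    obtain H where H: "has_jet \<eta> X H x" "\<bar>tr H\<bar> \<le> C1" using \<eta>_jet by blast
    let ?p = "(- \<sigma>, 0) :: real \<times> 'b"
    let ?G = "\<lambda>z. ?p + \<kappa> *\<^sub>R X z"
    let ?r = "R + \<sigma> * a - s0 * (s - T)"
    have "has_jet (\<lambda>z. (?p \<bullet> z + ?r) + \<kappa> * \<eta> z) ?G (\<lambda>k. 0 + \<kappa> *\<^sub>R H k) x"
      by (rule has_jet_add[OF has_jet_affine has_jet_scale[OF H(1)]])
    moreover have "\<zeta> \<sigma> s = (\<lambda>z. (?p \<bullet> z + ?r) + \<kappa> * \<eta> z)"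
      by (auto simp: \<zeta>_def algebra_simps)
    ultimately have "has_jet (\<zeta> \<sigma> s) ?G (\<lambda>k. \<kappa> *\<^sub>R H k) x" by simp
    from jet_of_profile[OF this, of q] obtain H' where
      J: "has_jet (W s) (\<lambda>z. \<phi>1 (\<zeta> \<sigma> s z) *\<^sub>R ?G z) H' x"
      and trH': "tr H' = \<phi>1 (\<zeta> \<sigma> s x) * (\<kappa> * tr H)
        + (- c * \<phi>1 (\<zeta> \<sigma> s x) - f (\<phi> (\<zeta> \<sigma> s x))) * (norm (?G x))\<^sup>2"
      unfolding W_def[abs_def] tr_scale by blast
    have "((\<lambda>r. \<zeta> \<sigma> r x) has_real_derivative - s0) (at s)"
      unfolding \<zeta>_def by (auto intro!: derivative_eq_intros)
    from DERIV_chain2[OF d\<phi> this]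
    have Dt: "((\<lambda>r. W r x) has_real_derivative \<phi>1 (\<zeta> \<sigma> s x) * - s0) (at s)"
      unfolding W_def by (auto intro!: derivative_eq_intros)
    have sq: "\<sigma> * \<sigma> = 1" using \<sigma>(1) by auto
    have X: "norm (X x) \<le> C1" by (rule \<eta>_gradient)
    have Xf: "\<bar>fst (X x)\<bar> \<le> C1"
      using X by (metis norm_fst_le order_trans prod.collapse real_norm_def)
    have "(norm (?G x))\<^sup>2 = 1 + \<kappa> * (\<kappa> * (norm (X x))\<^sup>2 - 2 * (\<sigma> * fst (X x)))"
    proof -
      have "(norm (?G x))\<^sup>2 = ?p \<bullet> ?p + 2 * \<kappa> * (?p \<bullet> X x) + \<kappa> * \<kappa> * (X x \<bullet> X x)"
        unfolding dot_square_norm[symmetric]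
        by (simp add: inner_add_left inner_add_right inner_commute[of "X x" ?p] algebra_simps)
      moreover have "?p \<bullet> ?p = 1" using sq by simp
      moreover have "?p \<bullet> X x = - \<sigma> * fst (X x)" by (cases "X x") simp
      ultimately show ?thesis by (simp only: dot_square_norm) (simp add: algebra_simps)
    qed
    moreover have "\<bar>\<kappa> * (norm (X x))\<^sup>2 - 2 * (\<sigma> * fst (X x))\<bar> \<le> 2 * C1 + C1\<^sup>2"
    proof -
      have "\<bar>\<sigma> * fst (X x)\<bar> \<le> C1" using \<sigma>(1) Xf by auto
      moreover have "\<kappa> * (norm (X x))\<^sup>2 \<le> 1 * C1\<^sup>2"
        using \<kappa> X C1 by (intro mult_mono power_mono) auto
      moreover have "\<kappa> * (norm (X x))\<^sup>2 \<ge> 0" using \<kappa>(1) by simp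
      ultimately show ?thesis by (simp add: abs_le_iff)
    qed
    ultimately have "\<bar>(norm (?G x))\<^sup>2 - 1\<bar> \<le> \<kappa> * (2 * C1 + C1\<^sup>2)"
      using \<kappa>(1) by (simp add: abs_mult)
    then have Gsq: "\<bar>(norm (?G x))\<^sup>2 - 1\<bar> \<le> \<mu>" using \<kappa>(3) by (simp add: mult.commute)
    have "\<kappa> * tr H \<le> \<kappa> * C1" using H(2) \<kappa>(1) by (intro mult_left_mono) auto
    then have "- c / 4 \<le> - s0 - \<kappa> * tr H" using \<kappa>(4) by (simp add: s0_def mult.commute)
    moreover have "q < \<phi> (\<zeta> \<sigma> s x)" using wpos Wx[of s] by (simp add: W_def)
    ultimately have sub: "\<phi>1 (\<zeta> \<sigma> s x) * (- s0 - \<kappa> * tr H) \<le>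
        (- c * \<phi>1 (\<zeta> \<sigma> s x) - f (\<phi> (\<zeta> \<sigma> s x))) * (norm (?G x))\<^sup>2 + f (\<phi> (\<zeta> \<sigma> s x) - q)"
      using Gsq by (intro \<mu>(2))
    show "touching_subsolution w C s x"
    proof (rule touching_subsolutionI[where W = W and e = "X1 - fst x", OF gap _ Ww Wx Dt J])
      show "ball x (X1 - fst x) \<inter> closure \<Omega> \<subseteq> C"
      proof
        fix z assume z: "z \<in> ball x (X1 - fst x) \<inter> closure \<Omega>"
        have "\<bar>fst x - fst z\<bar> \<le> dist x z" using dist_fst_le[of x z] by (simp add: dist_real_def)
        then show "z \<in> C" using z by (auto simp: C_def)
      qed
      show "\<phi>1 (\<zeta> \<sigma> s x) * - s0 \<le> tr H' + f (w s x)"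
        using sub unfolding trH' Wx[symmetric] W_def by (simp add: algebra_simps)
      show "g x \<bullet> (\<phi>1 (\<zeta> \<sigma> s x) *\<^sub>R ?G x) \<ge> 0" if fr: "x \<in> frontier \<Omega>"
      proof -
        have "g x \<bullet> ?G x = - (\<sigma> * fst (g x)) + \<kappa> * (g x \<bullet> X x)"
          by (cases "g x") (simp add: inner_add_right)
        also have "\<dots> \<le> 0"
          using \<sigma>(3)[OF fr] \<eta>_frontier[OF fr] \<kappa>(1) mult_pos_neg[of \<kappa> "g x \<bullet> X x"] by simp
        finally have "g x \<bullet> ?G x \<le> 0" .
        then have "\<phi>1 (\<zeta> \<sigma> s x) * (g x \<bullet> ?G x) \<ge> 0"
          using \<phi>1_neg[of "\<zeta> \<sigma> s x"] by (intro mult_nonpos_nonpos) auto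
        then show ?thesis by simp
      qed
    qed
  qed
  moreover have "w Te xs \<ge> 1 - 2 * q"
  proof -
    have "R - \<bar>fst xs - a\<bar> - s0 * (Te - T) + \<kappa> * \<eta> xs \<le> Z1" unfolding Te by simp
    then show ?thesis using Z1(2) by (force simp: w_def)
  qed
  ultimately show ?thesis using TTe by (intro exI[of _ Te]) (auto simp: T_def)
qed

lemma limit_eq_1:
  assumes x: "x \<in> \<Omega>"
  shows "v x = 1"
proof (rule antisym)
  have "\<forall>\<^sub>F t in at_top. u t x \<le> 1" using range_u[OF in_closure[OF x]] by simp
  then show "v x \<le> 1" by (rule tendsto_upperbound[OF lim_v[OF x]]) simp
  obtain q0 where q0: "q0 > 0" "\<And>q. 0 < q \<Longrightarrow> q \<le> q0 \<Longrightarrow> admissible_loss q"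
    using small_loss_admissible by blast
  show "1 \<le> v x"
  proof (rule ccontr)
    assume "\<not> 1 \<le> v x"
    \<comment> \<open>The last entry makes 1 - 2q strictly larger than v(x), so late values of
      \<open>u\<close> near their limit contradict the bound attained at late times.\<close>
    define q where "q = min q0 (min ((1 - \<alpha>) / 2) ((1 - v x) / 4))"
    have q: "0 < q" "q \<le> q0" "q < 1 - \<alpha>" "2 * q < 1 - v x"
      using q0(1) \<alpha> \<open>\<not> 1 \<le> v x\<close> by (auto simp: q_def min_def)
    have "\<forall>\<^sub>F t in at_top. u t x < 1 - 2 * q" by (rule order_tendstoD(2)[OF lim_v[OF x]]) (use q in simp)
    then obtain T1 where "\<And>t. t \<ge> T1 \<Longrightarrow> u t x < 1 - 2 * q" unfolding eventually_at_top_linorder by blast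
    moreover obtain t where "t \<ge> T1" "1 - 2 * q \<le> u t x"
      using frequently_large[OF q(1) q0(2) q0(2) q(3) x] q by force
    ultimately show False by force
  qed
qed

end

text \<open>The projection condition puts (a, y) into the wall and the segment condition fills in
  everything between it and x. Hence \<rho> \<le> 0 on the way towards x1 = a while \<rho>(x) = 0,
  which fixes the sign of its x1-derivative.\<close>

lemma dir_convex_normal:
  fixes K :: "(real \<times> (real^'m)) set"
  assumes wl: "wall M K \<rho> g"
    and seg: "\<And>y. {s. (s, y) \<in> K} = {} \<or> (\<exists>p q. p \<le> q \<and> {s. (s, y) \<in> K} = {p..q})"
    and proj: "K \<inter> {x. fst x = a} = (\<lambda>x. (a, snd x)) ` K"
    and x: "x \<in> frontier K"
  shows "fst x > a \<Longrightarrow> fst (g x) \<ge> 0" "fst x < a \<Longrightarrow> fst (g x) \<le> 0"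
proof -
  have K: "closed K" "K = {x. \<rho> x \<le> 0}" and d\<rho>: "\<And>x. (\<rho> has_derivative (\<lambda>h. g x \<bullet> h)) (at x)"
    using wl unfolding wall_def by blast+
  have xK: "x \<in> K" using frontier_subset_closed[OF K(1)] x by (rule subsetD)
  have \<rho>0: "\<rho> x = 0" by (rule wall_frontier[OF wl x])
  have aK: "(a, snd x) \<in> K" using proj xK by blast
  have xK': "(fst x, snd x) \<in> K" using xK by simp
  obtain p q where pq: "{s. (s, snd x) \<in> K} = {p..q}" using seg[of "snd x"] xK' by blast
  have iff: "s \<in> {p..q} \<longleftrightarrow> (s, snd x) \<in> K" for s unfolding pq[symmetric] by (rule mem_Collect_eq)
  have between: "\<rho> (s, snd x) \<le> 0" if "s \<in> {min a (fst x)..max a (fst x)}" for s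
  proof -
    have "s \<in> {p..q}" using that iff[THEN iffD2, OF aK] iff[THEN iffD2, OF xK'] by auto
    then have "(s, snd x) \<in> K" by (rule iff[THEN iffD1])
    then show ?thesis unfolding K(2) by (rule CollectD)
  qed
  have "((\<lambda>s. (s, snd x)) has_derivative (\<lambda>s. (s, 0))) (at (fst x))"
    by (auto intro!: derivative_eq_intros)
  from has_derivative_compose[OF this, of \<rho> "\<lambda>h. g x \<bullet> h"] d\<rho>[of x]
  have "((\<lambda>s. \<rho> (s, snd x)) has_derivative (\<lambda>s. g x \<bullet> (s, 0))) (at (fst x))" by simp
  moreover have "(\<lambda>s. g x \<bullet> (s, 0)) = (*) (fst (g x))" by (auto simp: inner_prod_def)
  ultimately have D: "((\<lambda>s. \<rho> (s, snd x)) has_real_derivative fst (g x)) (at (fst x))"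
    by (simp add: has_field_derivative_def)
  show "fst (g x) \<ge> 0" if "fst x > a"
  proof (rule ccontr)
    assume "\<not> fst (g x) \<ge> 0"
    then obtain d where d: "d > 0" "\<And>h. 0 < h \<Longrightarrow> h < d \<Longrightarrow> \<rho> (fst x, snd x) < \<rho> (fst x - h, snd x)"
      using DERIV_neg_dec_left[OF D] by force
    define h where "h = min d (fst x - a) / 2"
    have "0 < h" "h < d" "h < fst x - a" using d(1) that by (auto simp: h_def)
    then show False using d(2)[of h] between[of "fst x - h"] \<rho>0 by auto
  qed
  show "fst (g x) \<le> 0" if "fst x < a"
  proof (rule ccontr)
    assume "\<not> fst (g x) \<le> 0"
    then obtain d where d: "d > 0" "\<And>h. 0 < h \<Longrightarrow> h < d \<Longrightarrow> \<rho> (fst x, snd x) < \<rho> (fst x + h, snd x)"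
      using DERIV_pos_inc_right[OF D] by force
    define h where "h = min d (a - fst x) / 2"
    have "0 < h" "h < d" "h < a - fst x" using d(1) that by (auto simp: h_def)
    then show False using d(2)[of h] between[of "fst x + h"] \<rho>0 by auto
  qed
qed

theorem theorem4p4:
  fixes f :: "real \<Rightarrow> real" and \<alpha> c M :: real and \<phi> :: "real \<Rightarrow> real"
    and K :: "(real \<times> (real^'m)) set" and \<rho> :: "real \<times> (real^'m) \<Rightarrow> real"
    and g :: "real \<times> (real^'m) \<Rightarrow> real \<times> (real^'m)"
    and u :: "real \<Rightarrow> real \<times> (real^'m) \<Rightarrow> real" and v :: "real \<times> (real^'m) \<Rightarrow> real"
  assumes bist: "bistable f \<alpha>"
    and cpos: "c > 0"
    and tw: "traveling_wave f \<alpha> c \<phi>"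
    and wl: "wall M K \<rho> g"
    and dc: "dir_convex K"
    and sol: "entire_solution f K g u"
    and bounds: "\<forall>t. \<forall>x\<in>- K. 0 < u t x \<and> u t x < 1"
    and past: "\<forall>\<epsilon>>0. \<exists>T. \<forall>t\<le>T. \<forall>x\<in>- K. \<bar>u t x - \<phi> (fst x - c * t)\<bar> < \<epsilon>"
    and lim: "\<forall>x\<in>- K. ((\<lambda>t. u t x) \<longlongrightarrow> v x) at_top"
    and propagation: "\<forall>y. ((\<lambda>s. v (s, y)) \<longlongrightarrow> 1) at_top"
  shows "\<forall>x\<in>- K. v x = 1"
proof -
  obtain f' where f': "\<And>s. (f has_real_derivative f' s) (at s)" "continuous_on UNIV f'" "f' 0 < 0" "f' 1 < 0"
    using bist unfolding bistable_def by blast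
  obtain \<phi>1 \<phi>2 where \<phi>: "\<And>s. (\<phi> has_real_derivative \<phi>1 s) (at s)" "\<And>s. (\<phi>1 has_real_derivative \<phi>2 s) (at s)"
    "\<And>s. \<phi>2 s + c * \<phi>1 s + f (\<phi> s) = 0"
    using tw unfolding traveling_wave_def by blast
  have \<phi>2: "\<phi>2 s = - c * \<phi>1 s - f (\<phi> s)" for s using \<phi>(3)[of s] by simp
  interpret bistable_wave f f' \<alpha> c \<phi> \<phi>1
    by unfold_locales (use bist tw cpos f' \<phi> \<phi>2 in \<open>auto simp: bistable_def traveling_wave_def\<close>)
  obtain L where L: "L \<ge> 0" "\<And>r s. 0 \<le> r \<Longrightarrow> r \<le> 1 \<Longrightarrow> 0 \<le> s \<Longrightarrow> s \<le> 1 \<Longrightarrow> \<bar>f r - f s\<bar> \<le> L * \<bar>r - s\<bar>"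
    using f_lipschitz by blast
  have bounds': "0 < u t x \<and> u t x < 1" if "x \<in> - K" for t x using bounds that by blast
  obtain \<eta> X C1 where np: "neumann_problem (- K) g X \<eta> f u L C1"
    by (rule neumann_problem_entire_solution[OF wl sol bounds' L])
  obtain a where seg: "\<And>y. {s. (s, y) \<in> K} = {} \<or> (\<exists>p q. p \<le> q \<and> {s. (s, y) \<in> K} = {p..q})"
    and proj: "K \<inter> {x. fst x = a} = (\<lambda>x. (a, snd x)) ` K"
    using dc unfolding dir_convex_def by blast
  have M: "M > 0" "K \<subseteq> {x. 0 \<le> fst x \<and> fst x \<le> M}" using wl unfolding wall_def by blast+
  have "wall_invasion (- K) g X \<eta> f u L C1 f' \<alpha> c \<phi> \<phi>1 M a v"
  proof (rule wall_invasion.intro[OF np bistable_wave_axioms], unfold_locales)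
    show "M > 0" by (rule M(1))
    show "x \<in> - K" if "fst x < 0 \<or> fst x > M" for x using that M(2) by force
    show "fst (g x) \<ge> 0" if "x \<in> frontier (- K)" "fst x > a" for x
      using dir_convex_normal(1)[OF wl seg proj] that by (simp add: frontier_complement)
    show "fst (g x) \<le> 0" if "x \<in> frontier (- K)" "fst x < a" for x
      using dir_convex_normal(2)[OF wl seg proj] that by (simp add: frontier_complement)
    show "\<exists>T. \<forall>t\<le>T. \<forall>x\<in>- K. \<bar>u t x - \<phi> (fst x - c * t)\<bar> < \<epsilon>" if "\<epsilon> > 0" for \<epsilon>
      using past that by blast
    show "((\<lambda>t. u t x) \<longlongrightarrow> v x) at_top" if "x \<in> - K" for x using lim that by blast
    show "((\<lambda>s. v (s, y)) \<longlongrightarrow> 1) at_top" for y using propagation by blast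
  qed
  then show ?thesis using wall_invasion.limit_eq_1 by blast
qed

end
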